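(* Let $p>2$. There exists an analytic self-map $\varphi$ of the unit disc $\mathbb{D}$ such that $\varphi$ belongs to the disc algebra $A(\mathbb{D})$, $C_\varphi\in\mathcal{S}_p(\mathrm{H}^2)\setminus\mathcal{S}_2(\mathrm{H}^2)$, and $d(E_\varphi)=1$.
   Context: $\mathrm{H}^2$ is the Hardy space on the open unit disc $\mathbb{D}$, $\mathbb{T}=\partial\mathbb{D}$, $A(\mathbb{D})$ is the algebra of functions analytic on $\mathbb{D}$ and continuous on $\overline{\mathbb{D}}$, and $C_\varphi f=f\circ\varphi$. A compact operator belongs to the Schatten class $\mathcal{S}_p(\mathrm{H}^2)$ if its sequence of singular numbers belongs to $\ell^p$. The contact set of $\varphi$ is $E_\varphi=\{\zeta\in\mathbb{T}:|\varphi(\zeta)|\ge1\}$ (so $|\varphi(\zeta)|=1$ there), where $\varphi(\zeta)$ is the boundary value. $d(E)$ denotes the Hausdorff dimension of $E\subset\mathbb{T}$: $d(E)=\inf\{\alpha:\Lambda_\alpha(E)=0\}$, where $\Lambda_\alpha(E)=\lim_{\epsilon\to0}\inf\{\sum_i|\Delta_i|^\alpha: E\subset\bigcup_i\Delta_i,\ |\Delta_i|<\epsilon\}$ ($\Delta_i$ arcs). *)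

theory Defs
  imports "HOL-Complex_Analysis.Complex_Analysis" "HOL-Library.Function_Algebras"
begin

section \<open>The Hardy space of the unit disc\<close>

definition circle_mean :: "(complex \<Rightarrow> complex) \<Rightarrow> real \<Rightarrow> complex" where
  "circle_mean f r = integral {0..2*pi} (\<lambda>t. f (of_real r * cis t)) / (2*pi)"

text \<open>Elements of the space are functions on the open disc. As HOL functions are total, they are
  extended by \<open>0\<close>, so that equality of elements is equality of functions.\<close>

definition hardy2 :: "(complex \<Rightarrow> complex) set" where
  "hardy2 = {f. f holomorphic_on ball 0 1 \<and> (\<forall>z. z \<notin> ball 0 1 \<longrightarrow> f z = 0) \<and>
     bdd_above ((\<lambda>r. Re (circle_mean (\<lambda>z. of_real ((cmod (f z))\<^sup>2)) r)) ` {0..<1})}"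

definition hardy2_inner :: "(complex \<Rightarrow> complex) \<Rightarrow> (complex \<Rightarrow> complex) \<Rightarrow> complex" where
  "hardy2_inner f g = Lim (at_left 1) (circle_mean (\<lambda>z. f z * cnj (g z)))"

definition hardy2_norm :: "(complex \<Rightarrow> complex) \<Rightarrow> real" where
  "hardy2_norm f = sqrt (Re (hardy2_inner f f))"

definition composition_op :: "(complex \<Rightarrow> complex) \<Rightarrow> (complex \<Rightarrow> complex) \<Rightarrow> (complex \<Rightarrow> complex)" where
  "composition_op \<phi> f = (\<lambda>z. if z \<in> ball 0 1 then f (\<phi> z) else 0)"

section \<open>Compact operators, singular numbers, Schatten classes\<close>

definition hardy2_linear :: "((complex \<Rightarrow> complex) \<Rightarrow> (complex \<Rightarrow> complex)) \<Rightarrow> bool" where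
  "hardy2_linear T \<longleftrightarrow> T ` hardy2 \<subseteq> hardy2 \<and>
     (\<forall>f\<in>hardy2. \<forall>g\<in>hardy2. T (f + g) = T f + T g) \<and>
     (\<forall>f\<in>hardy2. \<forall>c. T (\<lambda>z. c * f z) = (\<lambda>z. c * T f z))"

definition hardy2_compact :: "((complex \<Rightarrow> complex) \<Rightarrow> (complex \<Rightarrow> complex)) \<Rightarrow> bool" where
  "hardy2_compact T \<longleftrightarrow> hardy2_linear T \<and>
     (\<forall>f :: nat \<Rightarrow> complex \<Rightarrow> complex. (\<forall>n. f n \<in> hardy2) \<and> (\<exists>B. \<forall>n. hardy2_norm (f n) \<le> B) \<longrightarrow>
        (\<exists>r g. strict_mono r \<and> g \<in> hardy2 \<and>
               (\<lambda>n. hardy2_norm (T (f (r n)) - g)) \<longlonglongrightarrow> 0))"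

definition hardy2_adjoint ::
  "((complex \<Rightarrow> complex) \<Rightarrow> (complex \<Rightarrow> complex)) \<Rightarrow> (complex \<Rightarrow> complex) \<Rightarrow> (complex \<Rightarrow> complex)" where
  "hardy2_adjoint T = (SOME S. S ` hardy2 \<subseteq> hardy2 \<and>
     (\<forall>f\<in>hardy2. \<forall>g\<in>hardy2. hardy2_inner (T f) g = hardy2_inner f (S g)))"

interpretation cfun: vector_space "\<lambda>(c::complex) (f::complex \<Rightarrow> complex) z. c * f z"
  by unfold_locales (auto simp: fun_eq_iff algebra_simps)

text \<open>The singular numbers of a compact operator \<open>T\<close> are the square roots of the eigenvalues of
  \<open>T\<^sup>*T\<close>, in decreasing order and repeated according to multiplicity; the sequence is
  completed by zeros if only finitely many of them are positive. Finiteness is required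
  explicitly since \<^const>\<open>card\<close> is \<open>0\<close> on infinite sets; the eigenspaces
  for \<open>\<sigma> > 0\<close> are finite-dimensional when \<open>T\<close> is compact.\<close>

definition singular_numbers ::
  "((complex \<Rightarrow> complex) \<Rightarrow> (complex \<Rightarrow> complex)) \<Rightarrow> (nat \<Rightarrow> real) \<Rightarrow> bool" where
  "singular_numbers T s \<longleftrightarrow> decseq s \<and> (\<forall>n. 0 \<le> s n) \<and>
     (\<forall>\<sigma>>0. finite {n. s n = \<sigma>} \<and>
        card {n. s n = \<sigma>} =
          cfun.dim {f \<in> hardy2. hardy2_adjoint T (T f) = (\<lambda>z. of_real (\<sigma>\<^sup>2) * f z)})"

definition schatten :: "real \<Rightarrow> ((complex \<Rightarrow> complex) \<Rightarrow> (complex \<Rightarrow> complex)) set" where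
  "schatten p = {T. hardy2_compact T \<and>
     (\<exists>s. singular_numbers T s \<and> summable (\<lambda>n. s n powr p))}"

section \<open>Disc algebra, contact set, Hausdorff dimension\<close>

definition disc_algebra :: "(complex \<Rightarrow> complex) set" where
  "disc_algebra = {f. f holomorphic_on ball 0 1 \<and> continuous_on (cball 0 1) f}"

text \<open>Used for elements of the disc algebra only, so \<open>\<phi> \<zeta>\<close> is the boundary value.\<close>

definition contact_set :: "(complex \<Rightarrow> complex) \<Rightarrow> complex set" where
  "contact_set \<phi> = {\<zeta> \<in> sphere 0 1. 1 \<le> cmod (\<phi> \<zeta>)}"

text \<open>The \<open>i\<close>-th arc is the set of \<open>cis t\<close> with \<open>a i < t < b i\<close>, of length \<open>b i - a i\<close>;
  \<open>a i = b i\<close> is allowed, so finite covers are included.\<close>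

definition arc_content :: "real \<Rightarrow> real \<Rightarrow> complex set \<Rightarrow> ennreal" where
  "arc_content \<alpha> \<epsilon> E = Inf {(\<Sum>i. ennreal ((b i - a i) powr \<alpha>)) | a b :: nat \<Rightarrow> real.
     (\<forall>i. a i \<le> b i \<and> b i - a i \<le> 2*pi \<and> b i - a i < \<epsilon>) \<and> E \<subseteq> (\<Union>i. cis ` {a i<..<b i})}"

definition hausdorff_measure :: "real \<Rightarrow> complex set \<Rightarrow> ennreal" where
  "hausdorff_measure \<alpha> E = Lim (at_right 0) (\<lambda>\<epsilon>. arc_content \<alpha> \<epsilon> E)"

text \<open>Restricting to \<open>\<alpha> > 0\<close> avoids the convention for \<open>0 powr 0\<close> and does not change the infimum.\<close>

definition hausdorff_dim :: "complex set \<Rightarrow> real" where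
  "hausdorff_dim E = Inf {\<alpha>. 0 < \<alpha> \<and> hausdorff_measure \<alpha> E = 0}"

end

theory Submission
  imports Defs "HOL-Real_Asymp.Real_Asymp"
begin

text \<open>
  \<^bold>\<open>The symbol.\<close> It is the Cayley transform \<open>\<phi> = (F - 1) / (F + 1)\<close> of a function
  \<open>F = F0 + F1\<close> with positive real part on the disc that tends to infinity exactly at the
  points of the contact set. The relevant quantity is
  \<open>1 / (1 - \<bar>\<phi>\<bar>\<^sup>2) = \<bar>F + 1\<bar>\<^sup>2 / (4 Re F)\<close>, whose integral over the circle is the
  squared Hilbert--Schmidt norm of the composition operator, and the two summands contribute to it
  almost independently.

  The summand \<open>F1\<close> is infinite on a Cantor set of measure zero and dimension one. It is the square
  root of a function with positive real part, so its values lie in a sector where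
  \<open>\<bar>F1\<bar>\<^sup>2 / Re F1 \<le> 2 Re F1\<close>; the means of \<open>Re F1\<close> over circles are constant, and the
  contribution of the Cantor set is finite. The summand \<open>F0 = 1 / H0\<close> with
  \<open>H0 z = (1 - z) (4 - Ln (1 - z))\<^sup>2\<close> is infinite at the point \<open>1\<close> only and contributes
  \<open>1 / Re H0\<close>, which at angle \<open>t\<close> is of order \<open>1 / (t log (1/t))\<close>. So the integral
  diverges, but only like \<open>log log\<close>.

  \<^bold>\<open>Membership in the Schatten class.\<close> Let \<open>N\<close> orthonormal functions satisfy \<open>\<parallel>T f\<parallel>\<^sup>2 \<ge> \<epsilon>\<close>.
  Then \<open>N \<epsilon>\<close> is at most the sum of the \<open>\<parallel>T f\<parallel>\<^sup>2\<close>, an integral over the circle. Outside an arc of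
  length \<open>\<tau>\<close> around \<open>1\<close> the reproducing kernel bounds the sum of the \<open>\<bar>f \<circ> \<phi>\<bar>\<^sup>2\<close> by
  \<open>1 / (1 - \<bar>\<phi>\<bar>\<^sup>2)\<close>, which gives \<open>O(log log (1/\<tau>))\<close> (\<open>off_window_mean\<close>). On the arc the
  Poisson kernel of the point \<open>1 - \<tau>\<close> is at least \<open>1 / (4 \<tau>)\<close>, and subordination
  (\<open>poisson_mean_composition_le\<close>) bounds the contribution of each function by a multiple of
  \<open>\<tau> / (1 - \<bar>\<phi> (1 - \<tau>)\<bar>)\<close>. Along the radius the full modulus of \<open>H0\<close> counts, so this
  quotient is of order \<open>1 / log\<^sup>2 (1/\<tau>)\<close>. With \<open>log (1/\<tau>)\<close> a multiple of \<open>1/\<surd>\<epsilon>\<close> the arc is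
  absorbed and \<open>N = O(log (1/\<epsilon>) / \<epsilon>)\<close> (\<open>counting_power_bound\<close>). Since eigenvectors of
  \<open>T\<^sup>* T\<close> are orthonormal functions of this kind, the \<open>n\<close>-th singular number is
  \<open>O(n powr - a)\<close> for every \<open>a < 1/2\<close> (\<open>singular_numbers_from_counting\<close>), and the \<open>p\<close>-th
  powers are summable for every \<open>p > 2\<close>. The same counting yields compactness.

  \<^bold>\<open>Failure of the Hilbert--Schmidt property.\<close> For a compact operator the sum of \<open>\<parallel>T e\<parallel>\<^sup>2\<close>
  over an orthonormal system is at most the sum of the squares of the singular numbers
  (\<open>trace_le_square_sum_of_singular_numbers\<close>). For the monomials the former is the divergent
  integral above (\<open>monomial_mean_bound\<close>, \<open>inverse_defect_ge\<close>).

  \<^bold>\<open>Dimension.\<close> A subset of the Cantor set is mapped onto \<open>[0, 1)\<close> by a function that is Hoelder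
  continuous of every order below one, so the content of the Cantor set in every dimension below
  one is positive (\<open>arc_content_cantor_arc\<close>).
\<close>

section \<open>Orthonormal families in inner product spaces\<close>

text \<open>The inner product lives on a subspace \<open>V\<close> of a larger vector space, because elements of the
  Hardy space are functions on the whole plane.\<close>

locale inner_product_subspace = vector_space scale
  for scale :: "complex \<Rightarrow> 'a::ab_group_add \<Rightarrow> 'a" (infixr "\<odot>" 75) +
  fixes V :: "'a set" and ip :: "'a \<Rightarrow> 'a \<Rightarrow> complex"
  assumes V_subspace: "subspace V"
    and ip_add: "\<And>x y z. \<lbrakk>x \<in> V; y \<in> V; z \<in> V\<rbrakk> \<Longrightarrow> ip (x + y) z = ip x z + ip y z"
    and ip_scale: "\<And>c x y. \<lbrakk>x \<in> V; y \<in> V\<rbrakk> \<Longrightarrow> ip (c \<odot> x) y = c * ip x y"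
    and ip_cnj: "\<And>x y. \<lbrakk>x \<in> V; y \<in> V\<rbrakk> \<Longrightarrow> ip y x = cnj (ip x y)"
    and ip_nonneg: "\<And>x. x \<in> V \<Longrightarrow> 0 \<le> Re (ip x x)"
    and ip_definite: "\<And>x. \<lbrakk>x \<in> V; ip x x = 0\<rbrakk> \<Longrightarrow> x = 0"
begin

lemma V_closed [simp]:
  shows "0 \<in> V" and "x \<in> V \<Longrightarrow> y \<in> V \<Longrightarrow> x + y \<in> V" and "x \<in> V \<Longrightarrow> c \<odot> x \<in> V"
    and "x \<in> V \<Longrightarrow> y \<in> V \<Longrightarrow> x - y \<in> V" and "x \<in> V \<Longrightarrow> - x \<in> V"
  using V_subspace
  by (auto simp: subspace_0 subspace_add subspace_scale subspace_diff subspace_neg)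

lemma V_sum: "(\<And>b. b \<in> B \<Longrightarrow> g b \<in> V) \<Longrightarrow> (\<Sum>b\<in>B. g b) \<in> V"
  using V_subspace subspace_sum by blast

lemma ip_add_right: "\<lbrakk>x \<in> V; y \<in> V; z \<in> V\<rbrakk> \<Longrightarrow> ip z (x + y) = ip z x + ip z y"
  using ip_cnj[of "x + y" z] ip_cnj[of x z] ip_cnj[of y z] by (simp add: ip_add)

lemma ip_scale_right: "\<lbrakk>x \<in> V; y \<in> V\<rbrakk> \<Longrightarrow> ip x (c \<odot> y) = cnj c * ip x y"
  using ip_cnj[of "c \<odot> y" x] ip_cnj[of y x] by (simp add: ip_scale)

lemma ip_diff: "\<lbrakk>x \<in> V; y \<in> V; z \<in> V\<rbrakk> \<Longrightarrow> ip (x - y) z = ip x z - ip y z"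
  using ip_add[of "x - y" y z] by simp

lemma ip_diff_right: "\<lbrakk>x \<in> V; y \<in> V; z \<in> V\<rbrakk> \<Longrightarrow> ip z (x - y) = ip z x - ip z y"
  using ip_add_right[of "x - y" y z] by simp

lemma ip_zero_left [simp]: "y \<in> V \<Longrightarrow> ip 0 y = 0"
  using ip_add[of 0 0 y] by simp

lemma ip_zero_right [simp]: "y \<in> V \<Longrightarrow> ip y 0 = 0"
  using ip_add_right[of 0 0 y] by simp

lemma ip_sum: "\<lbrakk>\<And>b. b \<in> B \<Longrightarrow> g b \<in> V; y \<in> V\<rbrakk> \<Longrightarrow> ip (\<Sum>b\<in>B. g b) y = (\<Sum>b\<in>B. ip (g b) y)"
  by (induction B rule: infinite_finite_induct) (auto simp: ip_add V_sum)

definition nrm2 :: "'a \<Rightarrow> real" where "nrm2 x = Re (ip x x)"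

lemma nrm2_nonneg [simp]: "x \<in> V \<Longrightarrow> 0 \<le> nrm2 x"
  by (simp add: nrm2_def ip_nonneg)

lemma ip_self: "x \<in> V \<Longrightarrow> ip x x = of_real (nrm2 x)"
  using ip_cnj[of x x] by (simp add: nrm2_def complex_eq_iff)

lemma nrm2_eq_0: "x \<in> V \<Longrightarrow> nrm2 x = 0 \<longleftrightarrow> x = 0"
  using ip_self[of x] ip_definite[of x] by (auto simp: nrm2_def)

lemma nrm2_scale: "x \<in> V \<Longrightarrow> nrm2 (c \<odot> x) = (cmod c)\<^sup>2 * nrm2 x"
proof -
  assume x: "x \<in> V"
  have "ip (c \<odot> x) (c \<odot> x) = (c * cnj c) * ip x x"
    using x by (simp add: ip_scale ip_scale_right)
  also have "\<dots> = of_real ((cmod c)\<^sup>2 * nrm2 x)"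
    using x by (simp add: ip_self complex_norm_square[symmetric])
  finally show ?thesis by (simp add: nrm2_def)
qed

lemma nrm2_add: "\<lbrakk>x \<in> V; y \<in> V\<rbrakk> \<Longrightarrow> nrm2 (x + y) = nrm2 x + nrm2 y + 2 * Re (ip x y)"
  using ip_cnj[of x y] by (simp add: nrm2_def ip_add ip_add_right)

lemma nrm2_diff: "\<lbrakk>x \<in> V; y \<in> V\<rbrakk> \<Longrightarrow> nrm2 (x - y) = nrm2 x + nrm2 y - 2 * Re (ip x y)"
  using ip_cnj[of x y] by (simp add: nrm2_def ip_diff ip_diff_right)

lemma nrm2_add_le: "\<lbrakk>x \<in> V; y \<in> V\<rbrakk> \<Longrightarrow> nrm2 (x + y) \<le> 2 * nrm2 x + 2 * nrm2 y"
  using nrm2_add[of x y] nrm2_diff[of x y] nrm2_nonneg[of "x - y"] by simp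

lemma nrm2_diff_le: "\<lbrakk>x \<in> V; y \<in> V\<rbrakk> \<Longrightarrow> nrm2 (x - y) \<le> 2 * nrm2 x + 2 * nrm2 y"
  using nrm2_add[of x y] nrm2_diff[of x y] nrm2_nonneg[of "x + y"] by simp

definition orthonormal :: "'a set \<Rightarrow> bool" where
  "orthonormal B \<longleftrightarrow> finite B \<and> B \<subseteq> V \<and> (\<forall>x\<in>B. \<forall>y\<in>B. ip x y = (if x = y then 1 else 0))"

definition proj :: "'a set \<Rightarrow> 'a \<Rightarrow> 'a" where "proj B x = (\<Sum>b\<in>B. ip x b \<odot> b)"

lemma proj_in: "orthonormal B \<Longrightarrow> proj B x \<in> V"
  unfolding proj_def orthonormal_def by (intro V_sum) auto

lemma ip_combination:
  assumes "orthonormal B" "b \<in> B"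
  shows "ip (\<Sum>x\<in>B. c x \<odot> x) b = c b"
proof -
  have "ip (\<Sum>x\<in>B. c x \<odot> x) b = (\<Sum>x\<in>B. ip (c x \<odot> x) b)"
    using assms unfolding orthonormal_def by (intro ip_sum) auto
  also have "\<dots> = (\<Sum>x\<in>B. if x = b then c b else 0)"
    using assms unfolding orthonormal_def by (intro sum.cong) (auto simp: ip_scale subset_iff)
  finally have "ip (\<Sum>x\<in>B. c x \<odot> x) b = (\<Sum>x\<in>B. if x = b then c b else 0)" .
  then show ?thesis using assms by (simp add: orthonormal_def)
qed

lemma ip_residual:
  assumes "orthonormal B" "x \<in> V" "b \<in> B"
  shows "ip (x - proj B x) b = 0"
proof -
  have "b \<in> V" using assms by (auto simp: orthonormal_def)
  then have "ip (x - proj B x) b = ip x b - ip (proj B x) b"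
    using assms by (simp add: ip_diff proj_in)
  then show ?thesis
    using ip_combination[OF assms(1,3), of "ip x"] by (simp add: proj_def)
qed

lemma
  assumes B: "orthonormal B" and x: "x \<in> V"
  shows nrm2_proj: "nrm2 (proj B x) = (\<Sum>b\<in>B. (cmod (ip x b))\<^sup>2)"
    and nrm2_proj_split: "nrm2 x = (\<Sum>b\<in>B. (cmod (ip x b))\<^sup>2) + nrm2 (x - proj B x)"
proof -
  let ?p = "proj B x" and ?y = "x - proj B x"
  have BV: "B \<subseteq> V" using B by (simp add: orthonormal_def)
  have pV: "?p \<in> V" and yV: "?y \<in> V" using B x by (simp_all add: proj_in)
  have "ip ?p ?y = (\<Sum>b\<in>B. ip x b * ip b ?y)"
    unfolding proj_def[of B x] using BV yV
    by (subst ip_sum) (auto simp: ip_scale proj_def subset_iff)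
  also have "\<dots> = 0"
    using ip_residual[OF B x] ip_cnj[OF yV] BV by (intro sum.neutral) auto
  finally have py: "ip ?p ?y = 0" .
  have "ip ?p ?p = (\<Sum>b\<in>B. ip x b * ip b ?p)"
    by (subst (1) proj_def, subst ip_sum) (use BV pV in \<open>auto simp: ip_scale subset_iff\<close>)
  also have "\<dots> = (\<Sum>b\<in>B. ip x b * cnj (ip x b))"
  proof (intro sum.cong refl)
    fix b assume b: "b \<in> B"
    have "ip ?p b = ip x b" unfolding proj_def by (rule ip_combination[OF B b])
    then show "ip x b * ip b ?p = ip x b * cnj (ip x b)"
      using ip_cnj[OF pV, of b] b BV by auto
  qed
  also have "\<dots> = of_real (\<Sum>b\<in>B. (cmod (ip x b))\<^sup>2)"
    by (simp add: complex_norm_square[symmetric])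
  finally show pp: "nrm2 ?p = (\<Sum>b\<in>B. (cmod (ip x b))\<^sup>2)" by (simp add: nrm2_def)
  show "nrm2 x = (\<Sum>b\<in>B. (cmod (ip x b))\<^sup>2) + nrm2 ?y"
    using nrm2_add[OF pV yV] py pp by simp
qed

lemma bessel:
  assumes "orthonormal B" "x \<in> V"
  shows "(\<Sum>b\<in>B. (cmod (ip x b))\<^sup>2) \<le> nrm2 x"
  using nrm2_proj_split[OF assms] nrm2_nonneg[of "x - proj B x"] assms by (simp add: proj_in)

lemma cauchy_schwarz:
  assumes x: "x \<in> V" and y: "y \<in> V"
  shows "(cmod (ip x y))\<^sup>2 \<le> nrm2 x * nrm2 y"
proof (cases "y = 0")
  case True then show ?thesis using x by (simp add: nrm2_def)
next
  case False
  then have pos: "0 < nrm2 y" using nrm2_eq_0[OF y] nrm2_nonneg[OF y] by linarith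
  let ?u = "of_real (1 / sqrt (nrm2 y)) \<odot> y"
  have "nrm2 ?u = 1" using pos y by (simp add: nrm2_scale norm_divide power_divide)
  then have "ip ?u ?u = 1" using y by (simp add: ip_self)
  then have "orthonormal {?u}" using y by (simp add: orthonormal_def)
  from bessel[OF this x] have "(cmod (ip x ?u))\<^sup>2 \<le> nrm2 x" by simp
  moreover have "(cmod (ip x ?u))\<^sup>2 = (cmod (ip x y))\<^sup>2 / nrm2 y"
    using x y pos by (simp add: ip_scale_right norm_mult norm_divide power_mult_distrib power_divide)
  ultimately show ?thesis using pos by (simp only: pos_divide_le_eq)
qed

lemma orthonormal_insert:
  assumes B: "orthonormal B" and x: "x \<in> V" and perp: "\<And>b. b \<in> B \<Longrightarrow> ip x b = 0" and x1: "nrm2 x = 1"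
  shows "orthonormal (insert x B)" "x \<notin> B"
proof -
  have xx: "ip x x = 1" using ip_self[OF x] x1 by simp
  show "x \<notin> B" using perp[of x] xx by auto
  have perp': "ip b x = 0" if "b \<in> B" for b
    using ip_cnj[of x b] perp[OF that] that x B by (auto simp: orthonormal_def)
  show "orthonormal (insert x B)"
    using B x xx perp perp' unfolding orthonormal_def by (auto simp: subset_iff)
qed

lemma normalize:
  assumes x: "x \<in> V" "x \<noteq> 0"
  obtains c :: real where "c > 0" "nrm2 (of_real c \<odot> x) = 1" "c\<^sup>2 * nrm2 x = 1"
proof
  have pos: "0 < nrm2 x" using nrm2_eq_0[OF x(1)] nrm2_nonneg[OF x(1)] x(2) by linarith
  show "1 / sqrt (nrm2 x) > 0" using pos by simp
  show "(1 / sqrt (nrm2 x))\<^sup>2 * nrm2 x = 1" using pos by (simp add: power_divide)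
  then show "nrm2 (of_real (1 / sqrt (nrm2 x)) \<odot> x) = 1"
    using x pos by (simp add: nrm2_scale norm_divide)
qed

lemma orthonormal_independent:
  assumes B: "orthonormal B"
  shows "independent B"
proof -
  have fin: "finite B" using B by (simp add: orthonormal_def)
  show ?thesis
    unfolding independent_explicit_finite_subsets
  proof (intro allI impI ballI)
    fix A u v assume A: "A \<subseteq> B" "finite A" and s: "(\<Sum>v\<in>A. u v \<odot> v) = 0" and v: "v \<in> A"
    have oA: "orthonormal A" using B A unfolding orthonormal_def by (auto simp: subset_iff)
    have "v \<in> V" using v oA by (auto simp: orthonormal_def)
    then show "u v = 0" using ip_combination[OF oA v, of u] s by simp
  qed
qed

lemma dim_eq_card_orthonormal:
  assumes B: "orthonormal B" and "B \<subseteq> W" and sp: "\<And>x. x \<in> W \<Longrightarrow> x = proj B x"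
  shows "dim W = card B"
proof (rule dim_unique)
  show "W \<subseteq> span B"
  proof
    fix x assume "x \<in> W"
    then have "x = (\<Sum>b\<in>B. ip x b \<odot> b)" using sp proj_def by metis
    moreover have "\<dots> \<in> span B" by (intro span_sum span_scale span_base)
    ultimately show "x \<in> span B" by simp
  qed
qed (use assms orthonormal_independent in auto)

text \<open>If only finitely many orthonormal vectors can satisfy \<open>\<parallel>T b\<parallel>\<^sup>2 \<ge> \<epsilon>\<close>, a maximal such family
  spans a finite-dimensional space off which \<open>T\<close> has norm at most \<open>\<surd>\<epsilon>\<close>; on that space weak
  convergence is norm convergence. This replaces the usual approximation of a compact operator by
  operators of finite rank.\<close>

lemma counting_imp_completely_continuous:
  fixes x :: "nat \<Rightarrow> 'a"
  assumes T_in: "\<And>x. x \<in> V \<Longrightarrow> T x \<in> V"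
    and T_add: "\<And>x y. \<lbrakk>x \<in> V; y \<in> V\<rbrakk> \<Longrightarrow> T (x + y) = T x + T y"
    and T_scale: "\<And>c x. x \<in> V \<Longrightarrow> T (c \<odot> x) = c \<odot> T x"
    and bound: "\<And>x. x \<in> V \<Longrightarrow> nrm2 (T x) \<le> C * nrm2 x" and "0 \<le> C"
    and counting: "\<And>\<epsilon>. 0 < \<epsilon> \<Longrightarrow> \<exists>N. \<forall>B. orthonormal B \<and> (\<forall>x\<in>B. \<epsilon> \<le> nrm2 (T x)) \<longrightarrow> card B \<le> N"
    and x: "\<And>n. x n \<in> V" "\<And>n. nrm2 (x n) \<le> D" and weak: "\<And>y. y \<in> V \<Longrightarrow> (\<lambda>n. ip (x n) y) \<longlonglongrightarrow> 0"
  shows "(\<lambda>n. nrm2 (T (x n))) \<longlonglongrightarrow> 0"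
proof (rule LIMSEQ_I)
  fix e :: real assume e: "0 < e"
  have D: "0 \<le> D" using x[of 0] nrm2_nonneg[of "x 0"] by linarith
  define \<epsilon> where "\<epsilon> = e / (4 * (D + 1))"
  have \<epsilon>: "0 < \<epsilon>" using e D by (simp add: \<epsilon>_def)
  define P where "P B \<longleftrightarrow> orthonormal B \<and> (\<forall>x\<in>B. \<epsilon> \<le> nrm2 (T x))" for B
  obtain N where "\<forall>B. P B \<longrightarrow> card B < Suc N" using counting[OF \<epsilon>] by (auto simp: P_def less_Suc_eq_le)
  moreover have "P {}" by (simp add: P_def orthonormal_def)
  ultimately obtain B where B: "P B" "\<And>B'. P B' \<Longrightarrow> card B' \<le> card B"
    using ex_has_greatest_nat[of P "{}" card "Suc N"] by blast
  have oB: "orthonormal B" using B(1) by (simp add: P_def)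
  then have BV: "B \<subseteq> V" and finB: "finite B" by (simp_all add: orthonormal_def)
  have T0: "T 0 = 0" using T_add[of 0 0] by simp
  have off: "nrm2 (T y) \<le> \<epsilon> * nrm2 y" if y: "y \<in> V" "\<And>b. b \<in> B \<Longrightarrow> ip y b = 0" for y
  proof (cases "y = 0")
    case True then show ?thesis by (simp add: T0 nrm2_def)
  next
    case False
    obtain c where c: "c > 0" "nrm2 (of_real c \<odot> y) = 1" "c\<^sup>2 * nrm2 y = 1" using normalize[OF y(1) False] .
    let ?u = "of_real c \<odot> y"
    have u: "?u \<in> V" "\<And>b. b \<in> B \<Longrightarrow> ip ?u b = 0" using y BV by (auto simp: ip_scale subset_iff)
    note ins = orthonormal_insert[OF oB u c(2)]
    have "\<not> P (insert ?u B)" using B(2)[of "insert ?u B"] ins finB by auto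
    then have "nrm2 (T ?u) < \<epsilon>" using B(1) ins(1) by (auto simp: P_def)
    then have "c\<^sup>2 * nrm2 (T y) \<le> \<epsilon> * (c\<^sup>2 * nrm2 y)" using y c T_in by (simp add: T_scale nrm2_scale)
    then have "c\<^sup>2 * nrm2 (T y) \<le> c\<^sup>2 * (\<epsilon> * nrm2 y)" by (simp add: mult_ac)
    then show ?thesis using c by (simp add: mult_le_cancel_left)
  qed
  let ?s = "\<lambda>n. \<Sum>b\<in>B. (cmod (ip (x n) b))\<^sup>2"
  have main: "nrm2 (T (x n)) \<le> 2 * (C * ?s n) + e / 2" for n
  proof -
    let ?p = "proj B (x n)" and ?y = "x n - proj B (x n)"
    have V: "?p \<in> V" "?y \<in> V" using oB x(1) by (simp_all add: proj_in)
    have "nrm2 (T (x n)) = nrm2 (T ?p + T ?y)" using T_add[OF V] by simp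
    also have "\<dots> \<le> 2 * nrm2 (T ?p) + 2 * nrm2 (T ?y)" using V T_in by (intro nrm2_add_le) auto
    also have "nrm2 (T ?p) \<le> C * ?s n" using bound[OF V(1)] nrm2_proj[OF oB x(1)] by simp
    also have "nrm2 (T ?y) \<le> \<epsilon> * nrm2 ?y" using off[OF V(2)] ip_residual[OF oB x(1)] by blast
    also have "nrm2 ?y \<le> D + 1"
      using nrm2_proj_split[OF oB x(1)[of n]] x(2)[of n] sum_nonneg[of B "\<lambda>b. (cmod (ip (x n) b))\<^sup>2"] by simp
    also have "\<epsilon> * (D + 1) = e / 4"
      using D unfolding \<epsilon>_def by (simp add: nonzero_divide_eq_eq nonzero_eq_divide_eq algebra_simps)
    finally show ?thesis using \<epsilon> by simp
  qed
  have "(\<lambda>n. 2 * (C * ?s n)) \<longlonglongrightarrow> 2 * (C * (\<Sum>b\<in>B. (cmod 0)\<^sup>2))"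
    using BV by (intro tendsto_intros weak) auto
  from order_tendstoD(2)[OF this, of "e / 2"]
  have "\<forall>\<^sub>F n in sequentially. 2 * (C * ?s n) < e / 2" using e by simp
  then obtain n0 where "\<And>n. n \<ge> n0 \<Longrightarrow> 2 * (C * ?s n) < e / 2" by (auto simp: eventually_sequentially)
  moreover have "norm (nrm2 (T (x n)) - 0) = nrm2 (T (x n))" for n using T_in[OF x(1)[of n]] by simp
  moreover have "nrm2 (T (x n)) < e" if "n \<ge> n0" for n using main[of n] calculation(1)[OF that] by linarith
  ultimately have "\<forall>n\<ge>n0. norm (nrm2 (T (x n)) - 0) < e" by simp
  then show "\<exists>n0. \<forall>n\<ge>n0. norm (nrm2 (T (x n)) - 0) < e" by blast
qed

end

section \<open>Eigenvalues of a compact operator\<close>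

text \<open>The operator \<open>S\<close> plays the part of the adjoint of \<open>T\<close>. The last axiom bounds the size of
  orthonormal families on which \<open>T\<close> is not small; it controls eigenvalue multiplicities, and later
  its quantitative form gives the decay of the singular numbers.\<close>

locale compact_adjoint_pair = inner_product_subspace +
  fixes T S :: "'a \<Rightarrow> 'a"
  assumes T_in [simp]: "\<And>x. x \<in> V \<Longrightarrow> T x \<in> V"
    and T_add: "\<And>x y. \<lbrakk>x \<in> V; y \<in> V\<rbrakk> \<Longrightarrow> T (x + y) = T x + T y"
    and T_scale: "\<And>c x. x \<in> V \<Longrightarrow> T (c \<odot> x) = c \<odot> T x"
    and S_in [simp]: "\<And>x. x \<in> V \<Longrightarrow> S x \<in> V"
    and adjoint: "\<And>x y. \<lbrakk>x \<in> V; y \<in> V\<rbrakk> \<Longrightarrow> ip (T x) y = ip x (S y)"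
    and T_bounded: "\<exists>C. \<forall>x\<in>V. nrm2 (T x) \<le> C * nrm2 x"
    and T_compact: "\<And>x :: nat \<Rightarrow> 'a. (\<forall>n. x n \<in> V \<and> nrm2 (x n) \<le> 1) \<Longrightarrow>
          \<exists>r g. strict_mono r \<and> g \<in> V \<and> (\<lambda>n. nrm2 (T (x (r n)) - g)) \<longlonglongrightarrow> 0"
    and T_counting: "\<And>\<epsilon>. 0 < \<epsilon> \<Longrightarrow>
          \<exists>N. \<forall>B. orthonormal B \<and> (\<forall>x\<in>B. \<epsilon> \<le> nrm2 (T x)) \<longrightarrow> card B \<le> N"
begin

lemma T_diff: "\<lbrakk>x \<in> V; y \<in> V\<rbrakk> \<Longrightarrow> T (x - y) = T x - T y"
  using T_add[of "x - y" y] by simp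

lemma T_sum: "(\<And>b. b \<in> B \<Longrightarrow> g b \<in> V) \<Longrightarrow> T (\<Sum>b\<in>B. g b) = (\<Sum>b\<in>B. T (g b))"
proof (induction B rule: infinite_finite_induct)
  case (insert x F) then show ?case by (simp add: T_add V_sum)
qed (use T_diff[of 0 0] in auto)

lemma adjoint': "\<lbrakk>x \<in> V; y \<in> V\<rbrakk> \<Longrightarrow> ip (S x) y = ip x (T y)"
  using adjoint[of y x] ip_cnj[of "T y" x] ip_cnj[of y "S x"] by simp

lemma eq_if_ip_eq:
  assumes x: "x \<in> V" "y \<in> V" and eq: "\<And>z. z \<in> V \<Longrightarrow> ip z x = ip z y"
  shows "x = y"
  using ip_definite[of "x - y"] eq[of "x - y"] x by (simp add: ip_diff_right)

lemma S_add: "\<lbrakk>x \<in> V; y \<in> V\<rbrakk> \<Longrightarrow> S (x + y) = S x + S y"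
  by (rule eq_if_ip_eq) (simp_all add: ip_add_right flip: adjoint)

lemma S_scale: "x \<in> V \<Longrightarrow> S (c \<odot> x) = c \<odot> S x"
  by (rule eq_if_ip_eq) (simp_all add: ip_scale_right flip: adjoint)

lemma S_diff: "\<lbrakk>x \<in> V; y \<in> V\<rbrakk> \<Longrightarrow> S (x - y) = S x - S y"
  using S_add[of "x - y" y] by simp

lemma bounded_constant:
  obtains C where "C > 0" "\<And>x. x \<in> V \<Longrightarrow> nrm2 (T x) \<le> C * nrm2 x"
    "\<And>x. x \<in> V \<Longrightarrow> nrm2 (S x) \<le> C * nrm2 x"
proof -
  obtain C0 where C0: "\<And>x. x \<in> V \<Longrightarrow> nrm2 (T x) \<le> C0 * nrm2 x" using T_bounded by blast
  define C where "C = max C0 1"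
  have T: "nrm2 (T x) \<le> C * nrm2 x" if "x \<in> V" for x
    using C0[OF that] mult_right_mono[of C0 C "nrm2 x"] that by (simp add: C_def)
  have "nrm2 (S x) \<le> C * nrm2 x" if x: "x \<in> V" for x
  proof (cases "nrm2 (S x) = 0")
    case True then show ?thesis using x by (simp add: C_def)
  next
    case False
    have "(nrm2 (S x))\<^sup>2 = (cmod (ip (T (S x)) x))\<^sup>2"
      using x by (simp add: adjoint ip_self)
    also have "\<dots> \<le> nrm2 (T (S x)) * nrm2 x" using x by (intro cauchy_schwarz) auto
    also have "\<dots> \<le> C * nrm2 (S x) * nrm2 x" using x by (intro mult_right_mono T) auto
    finally have "nrm2 (S x) * nrm2 (S x) \<le> nrm2 (S x) * (C * nrm2 x)"
      by (simp add: power2_eq_square mult_ac)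
    then show ?thesis using False nrm2_nonneg[of "S x"] x by (simp add: less_le)
  qed
  then show ?thesis using that[of C] T by (auto simp: C_def)
qed

text \<open>A maximising sequence for the quadratic form \<open>\<parallel>T x\<parallel>\<^sup>2\<close> on the unit sphere of the invariant
  subspace orthogonal to \<open>B\<close> is almost a sequence of eigenvectors, so that compactness produces
  one.\<close>

lemma top_eigenvector:
  assumes BV: "B \<subseteq> V" and eig: "\<And>b. b \<in> B \<Longrightarrow> S (T b) = of_real (\<mu> b) \<odot> b"
    and x0: "x0 \<in> V" "\<And>b. b \<in> B \<Longrightarrow> ip x0 b = 0" "nrm2 x0 = 1" "0 < nrm2 (T x0)"
  shows "\<exists>f M. f \<in> V \<and> (\<forall>b\<in>B. ip f b = 0) \<and> nrm2 f = 1 \<and> nrm2 (T x0) \<le> M \<and> S (T f) = of_real M \<odot> f"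
proof -
  obtain C where C: "C > 0" "\<And>x. x \<in> V \<Longrightarrow> nrm2 (T x) \<le> C * nrm2 x"
    "\<And>x. x \<in> V \<Longrightarrow> nrm2 (S x) \<le> C * nrm2 x" using bounded_constant by blast
  define W where "W = {x \<in> V. \<forall>b\<in>B. ip x b = 0}"
  define M where "M = (SUP x\<in>{x\<in>W. nrm2 x = 1}. nrm2 (T x))"
  have WV: "x \<in> V" if "x \<in> W" for x using that by (simp add: W_def)
  have bdd: "bdd_above ((\<lambda>x. nrm2 (T x)) ` {x\<in>W. nrm2 x = 1})"
  proof (intro bdd_aboveI2)
    show "nrm2 (T x) \<le> C" if "x \<in> {x\<in>W. nrm2 x = 1}" for x
      using C(2)[of x] WV[of x] that by simp
  qed
  have x0W: "x0 \<in> {x\<in>W. nrm2 x = 1}" using x0 by (simp add: W_def)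
  have M0: "nrm2 (T x0) \<le> M" unfolding M_def by (rule cSUP_upper[OF x0W bdd])
  then have Mpos: "M > 0" using x0 by linarith
  have form: "nrm2 (T x) \<le> M * nrm2 x" if x: "x \<in> W" for x
  proof (cases "x = 0")
    case True
    have "T 0 = 0" using T_diff[of 0 0] by simp
    then show ?thesis using True by (simp add: nrm2_def)
  next
    case False
    obtain c where c: "c > 0" "nrm2 (of_real c \<odot> x) = 1" "c\<^sup>2 * nrm2 x = 1"
      using normalize[OF WV[OF x] False] by blast
    have "of_real c \<odot> x \<in> W" using x BV by (auto simp: W_def ip_scale subset_iff)
    then have "nrm2 (T (of_real c \<odot> x)) \<le> M"
      unfolding M_def using c by (intro cSUP_upper bdd) auto
    then have "c\<^sup>2 * nrm2 (T x) \<le> M * (c\<^sup>2 * nrm2 x)" using WV[OF x] c by (simp add: T_scale nrm2_scale)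
    then have "c\<^sup>2 * nrm2 (T x) \<le> c\<^sup>2 * (M * nrm2 x)" by (simp add: mult_ac)
    then show ?thesis using c by (simp add: mult_le_cancel_left)
  qed
  have inv: "S (T x) \<in> W" if x: "x \<in> W" for x
  proof -
    have "ip (S (T x)) b = 0" if b: "b \<in> B" for b
    proof -
      have "b \<in> V" using b BV by auto
      then have "ip (S (T x)) b = ip x (S (T b))" using WV[OF x] by (simp add: adjoint' adjoint)
      then show ?thesis using b x \<open>b \<in> V\<close> WV[OF x] by (simp add: eig ip_scale_right W_def)
    qed
    then show ?thesis using WV[OF x] by (simp add: W_def)
  qed
  \<comment> \<open>Cauchy--Schwarz for the form \<open>ip (T x) (T y)\<close> with \<open>y = S (T x)\<close>.\<close>
  have ST: "nrm2 (S (T x)) \<le> M * nrm2 (T x)" if x: "x \<in> W" for x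
  proof (cases "nrm2 (S (T x)) = 0")
    case True then show ?thesis using Mpos WV[OF x] by simp
  next
    case False
    note xV = WV[OF x]
    have "(nrm2 (S (T x)))\<^sup>2 = (cmod (ip (T (S (T x))) (T x)))\<^sup>2"
      using xV by (simp add: adjoint ip_self)
    also have "\<dots> \<le> nrm2 (T (S (T x))) * nrm2 (T x)" using xV by (intro cauchy_schwarz) auto
    also have "\<dots> \<le> M * nrm2 (S (T x)) * nrm2 (T x)"
      using xV by (intro mult_right_mono form inv x) auto
    finally have "nrm2 (S (T x)) * nrm2 (S (T x)) \<le> nrm2 (S (T x)) * (M * nrm2 (T x))"
      by (simp add: power2_eq_square mult_ac)
    then show ?thesis using False nrm2_nonneg[of "S (T x)"] xV by (simp add: less_le)
  qed
  have "\<exists>x. x \<in> W \<and> nrm2 x = 1 \<and> M - 1 / Suc n < nrm2 (T x)" for n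
  proof -
    have "M - 1 / Suc n < M" by simp
    moreover have "{x\<in>W. nrm2 x = 1} \<noteq> {}" using x0W by blast
    ultimately have "\<exists>x\<in>{x\<in>W. nrm2 x = 1}. M - 1 / Suc n < nrm2 (T x)"
      using less_cSUP_iff[OF _ bdd, of "M - 1 / Suc n"] unfolding M_def by blast
    then show ?thesis by blast
  qed
  then obtain x where x: "\<And>n. x n \<in> W" "\<And>n. nrm2 (x n) = 1" "\<And>n. M - 1 / Suc n < nrm2 (T (x n))"
    by metis
  have xV [simp]: "x n \<in> V" for n using WV x(1) by blast
  \<comment> \<open>By \<open>ST\<close> the squared norm is at most \<open>M (M - \<parallel>T x\<parallel>\<^sup>2)\<close>.\<close>
  have resid: "nrm2 (S (T (x n)) - of_real M \<odot> x n) \<le> M * (1 / Suc n)" for n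
  proof -
    have "ip (S (T (x n))) (x n) = of_real (nrm2 (T (x n)))" by (simp add: adjoint' ip_self)
    then have "nrm2 (S (T (x n)) - of_real M \<odot> x n)
        = nrm2 (S (T (x n))) + M\<^sup>2 * nrm2 (x n) - 2 * M * nrm2 (T (x n))"
      by (subst nrm2_diff) (auto simp: nrm2_scale ip_scale_right)
    also have "\<dots> \<le> M * nrm2 (T (x n)) + M\<^sup>2 - 2 * M * nrm2 (T (x n))"
      using ST[OF x(1)[of n]] x(2) by simp
    also have "\<dots> = M * (M - nrm2 (T (x n)))" by (simp add: power2_eq_square algebra_simps)
    also have "\<dots> \<le> M * (1 / Suc n)" using x(3)[of n] Mpos by (intro mult_left_mono) auto
    finally show ?thesis .
  qed
  obtain r g where r: "strict_mono r" and g: "g \<in> V" and lim: "(\<lambda>n. nrm2 (T (x (r n)) - g)) \<longlonglongrightarrow> 0"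
    using T_compact[of x] x(2) by auto
  define f where "f = of_real (1 / M) \<odot> S g"
  have f: "f \<in> V" using g by (simp add: f_def)
  define d where "d n = nrm2 (x (r n) - f)" for n
  have Mf: "of_real M \<odot> f = S g" using Mpos by (simp add: f_def)
  have d_le: "d n \<le> (2 * (M * (1 / Suc (r n))) + 2 * (C * nrm2 (T (x (r n)) - g))) / M\<^sup>2" for n
  proof -
    let ?a = "S (T (x (r n))) - of_real M \<odot> x (r n)" and ?b = "S (T (x (r n))) - S g"
    have "of_real M \<odot> (x (r n) - f) = ?b - ?a"
      by (simp add: scale_right_diff_distrib Mf)
    then have "M\<^sup>2 * d n = nrm2 (?b - ?a)" using f unfolding d_def by (subst nrm2_scale[symmetric, of _ "of_real M", simplified]) auto
    also have "\<dots> \<le> 2 * nrm2 ?b + 2 * nrm2 ?a" using g by (intro nrm2_diff_le) auto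
    also have "nrm2 ?b = nrm2 (S (T (x (r n)) - g))" using g by (simp add: S_diff)
    also have "\<dots> \<le> C * nrm2 (T (x (r n)) - g)" using g by (intro C) auto
    finally have "M\<^sup>2 * d n \<le> 2 * (M * (1 / Suc (r n))) + 2 * (C * nrm2 (T (x (r n)) - g))"
      using resid[of "r n"] by linarith
    then show ?thesis using Mpos by (subst pos_le_divide_eq) (auto simp: mult.commute)
  qed
  have inv0: "(\<lambda>n. 1 / real (Suc (r n))) \<longlonglongrightarrow> 0"
    using LIMSEQ_subseq_LIMSEQ[OF LIMSEQ_inverse_real_of_nat r] by (simp add: o_def inverse_eq_divide)
  have LIM0: "(\<lambda>n. (2 * (M * (1 / Suc (r n))) + 2 * (C * nrm2 (T (x (r n)) - g))) / M\<^sup>2) \<longlonglongrightarrow>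
      (2 * (M * 0) + 2 * (C * 0)) / M\<^sup>2"
    using Mpos by (intro tendsto_intros inv0 lim) auto
  have d0: "d \<longlonglongrightarrow> 0"
  proof (rule tendsto_sandwich[OF _ _ tendsto_const])
    show "(\<lambda>n. (2 * (M * (1 / Suc (r n))) + 2 * (C * nrm2 (T (x (r n)) - g))) / M\<^sup>2) \<longlonglongrightarrow> 0"
      using LIM0 by simp
    show "\<forall>\<^sub>F n in sequentially. 0 \<le> d n" using f by (auto simp: d_def)
    show "\<forall>\<^sub>F n in sequentially. d n \<le> (2 * (M * (1 / Suc (r n))) + 2 * (C * nrm2 (T (x (r n)) - g))) / M\<^sup>2"
      using d_le by auto
  qed
  have perp: "ip f b = 0" if b: "b \<in> B" for b
  proof -
    have bV: "b \<in> V" using b BV by auto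
    have "(cmod (ip f b))\<^sup>2 \<le> d n * nrm2 b" for n
    proof -
      have "ip (x (r n) - f) b = - ip f b" using b bV f x(1)[of "r n"] by (simp add: ip_diff W_def)
      then show ?thesis using cauchy_schwarz[of "x (r n) - f" b] f bV by (simp add: d_def)
    qed
    then have "(cmod (ip f b))\<^sup>2 \<le> 0 * nrm2 b"
      by (intro tendsto_lowerbound[OF tendsto_mult[OF d0 tendsto_const]]) auto
    then show ?thesis by simp
  qed
  have "nrm2 f = 1"
  proof -
    have bound: "\<bar>nrm2 f - 1\<bar> \<le> 2 * sqrt (d n) + d n" for n
    proof -
      let ?e = "x (r n) - f"
      have "f = x (r n) - ?e" by simp
      then have "nrm2 f = nrm2 (x (r n) - ?e)" by simp
      also have "\<dots> = 1 + d n - 2 * Re (ip (x (r n)) ?e)"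
        using f by (subst nrm2_diff) (auto simp: d_def x(2))
      finally have eq: "nrm2 f = 1 + d n - 2 * Re (ip (x (r n)) ?e)" .
      have "\<bar>nrm2 f - 1\<bar> \<le> d n + 2 * cmod (ip (x (r n)) ?e)"
      proof -
        have "0 \<le> d n" using f by (simp add: d_def)
        then show ?thesis using abs_Re_le_cmod[of "ip (x (r n)) ?e"] eq by linarith
      qed
      moreover have "cmod (ip (x (r n)) ?e) \<le> sqrt (d n)"
        using cauchy_schwarz[of "x (r n)" ?e] f x(2) by (intro real_le_rsqrt) (auto simp: d_def)
      ultimately show ?thesis by simp
    qed
    have "(\<lambda>n. 2 * sqrt (d n) + d n) \<longlonglongrightarrow> 2 * sqrt 0 + 0" by (intro tendsto_intros d0)
    then have "\<bar>nrm2 f - 1\<bar> \<le> 2 * sqrt 0 + 0" by (rule tendsto_lowerbound) (use bound in auto)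
    then show ?thesis by simp
  qed
  moreover have "S (T f) = of_real M \<odot> f"
  proof -
    let ?y = "S (T f) - of_real M \<odot> f"
    have bound: "nrm2 ?y \<le> 4 * (C * (C * d n)) + 4 * (M\<^sup>2 * d n) + 2 * (M * (1 / Suc (r n)))" for n
    proof -
      let ?e = "f - x (r n)"
      let ?a = "S (T ?e) - of_real M \<odot> ?e" and ?b = "S (T (x (r n))) - of_real M \<odot> x (r n)"
      have de: "nrm2 ?e = d n"
        using nrm2_scale[of "x (r n) - f" "-1"] f by (simp add: d_def)
      have "?y = ?a + ?b" using f by (simp add: T_diff S_diff scale_right_diff_distrib)
      then have "nrm2 ?y = nrm2 (?a + ?b)" by (rule arg_cong)
      also have "\<dots> \<le> 2 * nrm2 ?a + 2 * nrm2 ?b" using f by (intro nrm2_add_le) auto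
      also have "nrm2 ?a \<le> 2 * nrm2 (S (T ?e)) + 2 * nrm2 (of_real M \<odot> ?e)"
        using f by (intro nrm2_diff_le) auto
      also have "nrm2 (S (T ?e)) \<le> C * nrm2 (T ?e)" using f by (intro C) auto
      also have "nrm2 (T ?e) \<le> C * nrm2 ?e" using f by (intro C) auto
      also have "nrm2 (of_real M \<odot> ?e) = M\<^sup>2 * d n" using f by (simp add: nrm2_scale de)
      finally show ?thesis using resid[of "r n"] C(1) by (simp add: de)
    qed
    have "(\<lambda>n. 4 * (C * (C * d n)) + 4 * (M\<^sup>2 * d n) + 2 * (M * (1 / Suc (r n)))) \<longlonglongrightarrow>
        4 * (C * (C * 0)) + 4 * (M\<^sup>2 * 0) + 2 * (M * 0)"
      by (intro tendsto_intros d0 inv0)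
    then have "nrm2 ?y \<le> 4 * (C * (C * 0)) + 4 * (M\<^sup>2 * 0) + 2 * (M * 0)"
      by (rule tendsto_lowerbound) (use bound in auto)
    then have "nrm2 ?y \<le> 0" by simp
    moreover have yV: "?y \<in> V" using f by (intro V_closed S_in T_in)
    ultimately have "nrm2 ?y = 0" using nrm2_nonneg[OF yV] by linarith
    then have "?y = 0" using nrm2_eq_0[OF yV] by blast
    then show ?thesis by (simp only: right_minus_eq)
  qed
  ultimately show ?thesis using f perp M0 by blast
qed

definition eigen_family :: "real \<Rightarrow> 'a set \<Rightarrow> bool" where
  "eigen_family \<epsilon> B \<longleftrightarrow> orthonormal B \<and> (\<forall>b\<in>B. S (T b) = of_real (nrm2 (T b)) \<odot> b \<and> \<epsilon> \<le> nrm2 (T b))"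

text \<open>Families of orthonormal eigenvectors of \<open>S T\<close> with eigenvalue at least \<open>\<epsilon>\<close>; the eigenvalue
  belonging to \<open>b\<close> is \<open>\<parallel>T b\<parallel>\<^sup>2\<close>. Maximality refers to the number of vectors, which the counting
  axiom keeps bounded.\<close>

definition maximal_eigen_family :: "real \<Rightarrow> 'a set \<Rightarrow> bool" where
  "maximal_eigen_family \<epsilon> B \<longleftrightarrow> eigen_family \<epsilon> B \<and> (\<forall>B'. eigen_family \<epsilon> B' \<longrightarrow> card B' \<le> card B)"

definition eigenspace :: "real \<Rightarrow> 'a set" where
  "eigenspace \<sigma> = {x \<in> V. S (T x) = of_real (\<sigma>\<^sup>2) \<odot> x}"

lemma maximal_eigen_family_exists:
  assumes "0 < \<epsilon>"
  obtains B where "maximal_eigen_family \<epsilon> B"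
proof -
  obtain N where N: "\<And>B. orthonormal B \<Longrightarrow> \<forall>x\<in>B. \<epsilon> \<le> nrm2 (T x) \<Longrightarrow> card B \<le> N"
    using T_counting[OF assms] by blast
  have "eigen_family \<epsilon> {}" by (simp add: eigen_family_def orthonormal_def)
  moreover have "\<forall>B. eigen_family \<epsilon> B \<longrightarrow> card B < Suc N"
    using N by (auto simp: eigen_family_def less_Suc_eq_le)
  ultimately show ?thesis
    using ex_has_greatest_nat[of "eigen_family \<epsilon>" "{}" card "Suc N"] that
    unfolding maximal_eigen_family_def by blast
qed

lemma nrm2_T_eigenvector:
  assumes "x \<in> V" "S (T x) = of_real M \<odot> x"
  shows "nrm2 (T x) = M * nrm2 x"
proof -
  have "of_real (nrm2 (T x)) = ip (T x) (T x)" using assms by (simp add: ip_self)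
  also have "\<dots> = ip x (S (T x))" using adjoint[of x "T x"] assms(1) by simp
  also have "\<dots> = of_real (M * nrm2 x)"
    using assms by (simp add: ip_scale_right ip_self)
  finally show ?thesis by (simp only: of_real_eq_iff)
qed

lemma maximal_no_further_eigenvector:
  assumes B: "maximal_eigen_family \<epsilon> B"
    and x: "x \<in> V" "nrm2 x = 1" "\<And>b. b \<in> B \<Longrightarrow> ip x b = 0" "S (T x) = of_real M \<odot> x"
  shows "M < \<epsilon>"
proof (rule ccontr)
  assume M: "\<not> M < \<epsilon>"
  have oB: "orthonormal B" and fam: "eigen_family \<epsilon> B"
    using B by (auto simp: maximal_eigen_family_def eigen_family_def)
  have "nrm2 (T x) = M" using nrm2_T_eigenvector[OF x(1,4)] x by simp
  then have "eigen_family \<epsilon> (insert x B)"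
    using orthonormal_insert(1)[OF oB x(1,3,2)] fam M x(4) by (auto simp: eigen_family_def)
  then have "card (insert x B) \<le> card B" using B by (auto simp: maximal_eigen_family_def)
  moreover have "x \<notin> B" by (rule orthonormal_insert(2)[OF oB x(1,3,2)])
  ultimately show False using oB by (simp add: orthonormal_def)
qed

text \<open>Otherwise the largest value of \<open>\<parallel>T x\<parallel>\<^sup>2\<close> on the unit sphere orthogonal to the family would
  exceed \<open>\<epsilon>\<close>, and an eigenvector at which it is attained could be added to the family.\<close>

lemma small_off_maximal_eigen_family:
  assumes B: "maximal_eigen_family \<epsilon> B" and \<epsilon>: "0 < \<epsilon>"
    and x: "x \<in> V" "\<And>b. b \<in> B \<Longrightarrow> ip x b = 0"
  shows "nrm2 (T x) \<le> \<epsilon> * nrm2 x"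
proof (rule ccontr)
  assume neg: "\<not> nrm2 (T x) \<le> \<epsilon> * nrm2 x"
  have BV: "B \<subseteq> V" and eig: "\<And>b. b \<in> B \<Longrightarrow> S (T b) = of_real (nrm2 (T b)) \<odot> b"
    using B by (auto simp: maximal_eigen_family_def eigen_family_def orthonormal_def)
  have "x \<noteq> 0"
  proof
    assume "x = 0"
    moreover have "T 0 = 0" using T_diff[of 0 0] by simp
    ultimately show False using neg by (simp add: nrm2_def)
  qed
  then obtain c where c: "c > 0" "nrm2 (of_real c \<odot> x) = 1" "c\<^sup>2 * nrm2 x = 1"
    using normalize[OF x(1)] by blast
  let ?u = "of_real c \<odot> x"
  have "nrm2 (T ?u) = c\<^sup>2 * nrm2 (T x)" using x by (simp add: T_scale nrm2_scale)
  also have "\<dots> > c\<^sup>2 * (\<epsilon> * nrm2 x)" using neg c by (intro mult_strict_left_mono) auto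
  also have "c\<^sup>2 * (\<epsilon> * nrm2 x) = \<epsilon>" using c(3) by (metis mult.left_commute mult.right_neutral)
  finally have big: "\<epsilon> < nrm2 (T ?u)" .
  have "?u \<in> V" "\<And>b. b \<in> B \<Longrightarrow> ip ?u b = 0" using x BV by (auto simp: ip_scale subset_iff)
  then obtain f M where f: "f \<in> V" "\<And>b. b \<in> B \<Longrightarrow> ip f b = 0" "nrm2 f = 1" "nrm2 (T ?u) \<le> M"
      "S (T f) = of_real M \<odot> f"
    using top_eigenvector[OF BV eig, of ?u] c(2) big \<epsilon> by (metis less_trans)
  have "M < \<epsilon>" by (rule maximal_no_further_eigenvector[OF B f(1,3,2,5)])
  with f(4) big show False by simp
qed

lemma eigenspace_subspace: "subspace (eigenspace \<sigma>)"
proof -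
  have "T 0 = 0" "S 0 = 0" using T_diff[of 0 0] S_diff[of 0 0] by simp_all
  then show ?thesis
    unfolding subspace_def eigenspace_def
    by (auto simp: T_add S_add T_scale S_scale scale_right_distrib scale_left_commute)
qed

text \<open>A maximal family contains an orthonormal basis of every eigenspace with \<open>\<sigma>\<^sup>2 \<ge> \<epsilon>\<close>: the part of
  an eigenvector that is orthogonal to the family is again an eigenvector and therefore vanishes.\<close>

lemma dim_eigenspace:
  assumes B: "maximal_eigen_family \<epsilon> B" and \<sigma>: "0 < \<sigma>" "\<epsilon> \<le> \<sigma>\<^sup>2"
  shows "dim (eigenspace \<sigma>) = card {b\<in>B. nrm2 (T b) = \<sigma>\<^sup>2}"
proof -
  define D where "D = {b\<in>B. nrm2 (T b) = \<sigma>\<^sup>2}"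
  have oB: "orthonormal B" and eig: "\<And>b. b \<in> B \<Longrightarrow> S (T b) = of_real (nrm2 (T b)) \<odot> b"
    using B by (auto simp: maximal_eigen_family_def eigen_family_def)
  then have BV: "B \<subseteq> V" by (simp add: orthonormal_def)
  have oD: "orthonormal D" using oB by (auto simp: orthonormal_def D_def)
  have DE: "D \<subseteq> eigenspace \<sigma>"
  proof
    fix b assume b: "b \<in> D"
    then have "S (T b) = of_real (\<sigma>\<^sup>2) \<odot> b" using eig[of b] by (simp add: D_def)
    then show "b \<in> eigenspace \<sigma>" using b BV by (auto simp: D_def eigenspace_def)
  qed
  have perp: "ip x b = 0" if x: "x \<in> eigenspace \<sigma>" and b: "b \<in> B - D" for x b
  proof -
    have xV: "x \<in> V" and bV: "b \<in> V" using x b BV by (auto simp: eigenspace_def)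
    have "of_real (\<sigma>\<^sup>2) * ip x b = ip (S (T x)) b" using x xV bV by (simp add: eigenspace_def ip_scale)
    also have "\<dots> = ip x (S (T b))" using xV bV by (simp add: adjoint adjoint')
    also have "\<dots> = of_real (nrm2 (T b)) * ip x b"
      using xV bV b by (subst eig) (auto simp: ip_scale_right)
    finally have "of_real (\<sigma>\<^sup>2 - nrm2 (T b)) * ip x b = 0" by (simp add: algebra_simps)
    then show ?thesis using b by (auto simp: D_def simp del: of_real_diff)
  qed
  have "x = proj D x" if x: "x \<in> eigenspace \<sigma>" for x
  proof (rule ccontr)
    assume neq: "x \<noteq> proj D x"
    let ?y = "x - proj D x"
    have xV: "x \<in> V" using x by (simp add: eigenspace_def)
    have "proj D x \<in> eigenspace \<sigma>"
      unfolding proj_def using DE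
      by (intro subspace_sum eigenspace_subspace subspace_scale) auto
    then have yE: "?y \<in> eigenspace \<sigma>" using subspace_diff[OF eigenspace_subspace x] by blast
    then have yV: "?y \<in> V" by (simp add: eigenspace_def)
    have yB: "ip ?y b = 0" if "b \<in> B" for b
      using perp[OF yE, of b] ip_residual[OF oD xV, of b] that by (cases "b \<in> D") auto
    obtain c where c: "nrm2 (of_real c \<odot> ?y) = 1" using normalize[OF yV] neq by auto
    have uE: "of_real c \<odot> ?y \<in> eigenspace \<sigma>"
      by (rule subspace_scale[OF eigenspace_subspace yE])
    have "\<sigma>\<^sup>2 < \<epsilon>"
      by (rule maximal_no_further_eigenvector[OF B _ c])
        (use uE yB yV BV in \<open>auto simp: eigenspace_def ip_scale subset_iff\<close>)
    with \<sigma> show False by simp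
  qed
  then show ?thesis using dim_eq_card_orthonormal[OF oD DE] by (simp add: D_def)
qed

text \<open>Split each vector of \<open>E\<close> along a maximal eigenvector family. The two parts stay orthogonal under
  \<open>T\<close>, the first contributes at most the sum of the eigenvalues by Bessel's inequality, and the
  second at most \<open>\<epsilon>\<close> per vector. Letting \<open>\<epsilon>\<close> tend to \<open>0\<close> bounds the trace of \<open>S T\<close> by the sum of
  its eigenvalues without any infinite eigenvector expansion.\<close>

lemma trace_le_eigenvalues:
  assumes B: "maximal_eigen_family \<epsilon> B" and \<epsilon>: "0 < \<epsilon>" and E: "orthonormal E"
  shows "(\<Sum>e\<in>E. nrm2 (T e)) \<le> (\<Sum>b\<in>B. nrm2 (T b)) + of_nat (card E) * \<epsilon>"
proof -
  have oB: "orthonormal B" and eig: "\<And>b. b \<in> B \<Longrightarrow> S (T b) = of_real (nrm2 (T b)) \<odot> b"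
    using B by (auto simp: maximal_eigen_family_def eigen_family_def)
  then have BV: "B \<subseteq> V" and finB: "finite B" by (simp_all add: orthonormal_def)
  have EV: "E \<subseteq> V" and finE: "finite E" using E by (simp_all add: orthonormal_def)
  have each: "nrm2 (T e) \<le> (\<Sum>b\<in>B. nrm2 (T b) * (cmod (ip b e))\<^sup>2) + \<epsilon>" if e: "e \<in> E" for e
  proof -
    have eV: "e \<in> V" using e EV by auto
    let ?p = "proj B e" and ?y = "e - proj B e"
    have pV: "?p \<in> V" and yV: "?y \<in> V" using oB eV by (simp_all add: proj_in)
    have y0: "ip ?y b = 0" if "b \<in> B" for b using ip_residual[OF oB eV that] .
    have Tp: "ip (T ?p) (T z) = (\<Sum>b\<in>B. ip e b * (of_real (nrm2 (T b)) * ip b z))" if z: "z \<in> V" for z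
    proof -
      have "T ?p = (\<Sum>b\<in>B. ip e b \<odot> T b)"
        unfolding proj_def using BV by (subst T_sum) (auto simp: T_scale intro!: sum.cong)
      then have "ip (T ?p) (T z) = (\<Sum>b\<in>B. ip (ip e b \<odot> T b) (T z))"
        using BV z by (simp only:) (intro ip_sum, auto)
      also have "\<dots> = (\<Sum>b\<in>B. ip e b * (of_real (nrm2 (T b)) * ip b z))"
      proof (intro sum.cong refl)
        fix b assume b: "b \<in> B"
        then have bV: "b \<in> V" using BV by auto
        have "ip (T b) (T z) = ip (S (T b)) z" using bV z by (simp add: adjoint')
        also have "\<dots> = of_real (nrm2 (T b)) * ip b z" using bV z b by (subst eig) (auto simp: ip_scale)
        finally show "ip (ip e b \<odot> T b) (T z) = ip e b * (of_real (nrm2 (T b)) * ip b z)"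
          using bV z by (simp add: ip_scale)
      qed
      finally show ?thesis .
    qed
    have by0: "ip b ?y = 0" if "b \<in> B" for b
      using ip_cnj[OF yV, of b] y0[OF that] that BV by auto
    have bp: "ip b ?p = ip b e" if "b \<in> B" for b
    proof -
      have "ip b (?p + ?y) = ip b ?p + ip b ?y" using pV yV that BV by (intro ip_add_right) auto
      then show ?thesis using by0[OF that] by simp
    qed
    have "ip (T ?p) (T ?p) = (\<Sum>b\<in>B. ip e b * (of_real (nrm2 (T b)) * ip b e))"
      using Tp[OF pV] bp by simp
    also have "\<dots> = of_real (\<Sum>b\<in>B. nrm2 (T b) * (cmod (ip b e))\<^sup>2)"
    proof -
      have "ip e b * (of_real (nrm2 (T b)) * ip b e) = of_real (nrm2 (T b) * (cmod (ip b e))\<^sup>2)"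
        if "b \<in> B" for b
      proof -
        have "ip e b = cnj (ip b e)" using ip_cnj[of b e] that BV eV by auto
        then show ?thesis using complex_norm_square[of "ip b e"] by simp
      qed
      then show ?thesis by (simp only: of_real_sum cong: sum.cong)
    qed
    finally have p: "nrm2 (T ?p) = (\<Sum>b\<in>B. nrm2 (T b) * (cmod (ip b e))\<^sup>2)" by (simp add: nrm2_def)
    have py: "ip (T ?p) (T ?y) = 0" using Tp[OF yV] by0 by simp
    have "nrm2 (T e) = nrm2 (T ?p + T ?y)"
      using pV yV T_add[of ?p ?y] by simp
    also have "\<dots> = nrm2 (T ?p) + nrm2 (T ?y)" using nrm2_add[of "T ?p" "T ?y"] pV yV py by simp
    finally have "nrm2 (T e) = nrm2 (T ?p) + nrm2 (T ?y)" .
    moreover have "nrm2 (T ?y) \<le> \<epsilon> * nrm2 ?y"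
      using small_off_maximal_eigen_family[OF B \<epsilon> yV] y0 by blast
    moreover have "nrm2 e = 1" using e E by (auto simp: orthonormal_def nrm2_def)
    then have "nrm2 ?y \<le> 1"
      using nrm2_proj_split[OF oB eV] sum_nonneg[of B "\<lambda>b. (cmod (ip e b))\<^sup>2"] by simp
    ultimately show ?thesis using p \<epsilon> mult_left_mono[of "nrm2 ?y" 1 \<epsilon>] by linarith
  qed
  have "(\<Sum>e\<in>E. nrm2 (T e)) \<le> (\<Sum>e\<in>E. (\<Sum>b\<in>B. nrm2 (T b) * (cmod (ip b e))\<^sup>2) + \<epsilon>)"
    by (intro sum_mono each)
  also have "\<dots> = (\<Sum>b\<in>B. nrm2 (T b) * (\<Sum>e\<in>E. (cmod (ip b e))\<^sup>2)) + of_nat (card E) * \<epsilon>"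
    by (simp add: sum.distrib sum_distrib_left sum.swap[of _ E])
  also have "(\<Sum>b\<in>B. nrm2 (T b) * (\<Sum>e\<in>E. (cmod (ip b e))\<^sup>2)) \<le> (\<Sum>b\<in>B. nrm2 (T b) * 1)"
  proof (intro sum_mono mult_left_mono)
    fix b assume b: "b \<in> B"
    then have "nrm2 b = 1" "b \<in> V" using oB by (auto simp: orthonormal_def nrm2_def)
    then show "(\<Sum>e\<in>E. (cmod (ip b e))\<^sup>2) \<le> 1" using bessel[OF E, of b] by simp
  qed (use BV in auto)
  finally show ?thesis by simp
qed

text \<open>This is the inequality that excludes the Hilbert--Schmidt class: the eigenvalues above \<open>\<epsilon>\<close> form
  a finite part of the sequence of squared singular numbers.\<close>

lemma trace_le_square_sum_of_singular_numbers:
  assumes s: "\<And>\<sigma>. 0 < \<sigma> \<Longrightarrow> finite {n. s n = \<sigma>} \<and> card {n. s n = \<sigma>} = dim (eigenspace \<sigma>)"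
    and summ: "summable (\<lambda>n::nat. (s n :: real)\<^sup>2)" and E: "orthonormal E"
  shows "(\<Sum>e\<in>E. nrm2 (T e)) \<le> (\<Sum>n. (s n)\<^sup>2)"
proof -
  have main: "(\<Sum>e\<in>E. nrm2 (T e)) \<le> (\<Sum>n. (s n)\<^sup>2) + of_nat (card E) * \<epsilon>" if \<epsilon>: "0 < \<epsilon>" for \<epsilon>
  proof -
    obtain B where B: "maximal_eigen_family \<epsilon> B" using maximal_eigen_family_exists[OF \<epsilon>] .
    have finB: "finite B" and big: "\<And>b. b \<in> B \<Longrightarrow> \<epsilon> \<le> nrm2 (T b)"
      using B by (auto simp: maximal_eigen_family_def eigen_family_def orthonormal_def)
    define \<sigma> where "\<sigma> b = sqrt (nrm2 (T b))" for b
    have \<sigma>: "0 < \<sigma> b" "(\<sigma> b)\<^sup>2 = nrm2 (T b)" if "b \<in> B" for b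
      using big[OF that] \<epsilon> by (auto simp: \<sigma>_def)
    have "(\<Sum>b\<in>B. nrm2 (T b)) = (\<Sum>t\<in>\<sigma> ` B. \<Sum>b\<in>{b\<in>B. \<sigma> b = t}. nrm2 (T b))"
      using finB by (rule sum.image_gen)
    also have "\<dots> = (\<Sum>t\<in>\<sigma> ` B. \<Sum>n\<in>{n. s n = t}. (s n)\<^sup>2)"
    proof (intro sum.cong refl)
      fix t assume t: "t \<in> \<sigma> ` B"
      then have t0: "0 < t" "\<epsilon> \<le> t\<^sup>2" using \<sigma> big by auto
      have "{b\<in>B. \<sigma> b = t} = {b\<in>B. nrm2 (T b) = t\<^sup>2}"
        using \<sigma> t0 by (auto simp: \<sigma>_def real_sqrt_unique)
      then have "card {n. s n = t} = card {b\<in>B. \<sigma> b = t}"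
        using s[OF t0(1)] dim_eigenspace[OF B t0] by simp
      moreover have "(\<Sum>b\<in>{b\<in>B. \<sigma> b = t}. nrm2 (T b)) = of_nat (card {b\<in>B. \<sigma> b = t}) * t\<^sup>2"
        using \<sigma>(2) by (subst sum_constant[symmetric], intro sum.cong) auto
      ultimately show "(\<Sum>b\<in>{b\<in>B. \<sigma> b = t}. nrm2 (T b)) = (\<Sum>n\<in>{n. s n = t}. (s n)\<^sup>2)"
        by simp
    qed
    also have "\<dots> = (\<Sum>n\<in>(\<Union>t\<in>\<sigma> ` B. {n. s n = t}). (s n)\<^sup>2)"
      using finB s \<sigma> by (intro sum.UNION_disjoint[symmetric]) auto
    also have "\<dots> \<le> (\<Sum>n. (s n)\<^sup>2)"
      using finB s \<sigma> by (intro sum_le_suminf summ) auto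
    finally show ?thesis using trace_le_eigenvalues[OF B \<epsilon> E] by linarith
  qed
  show ?thesis
  proof (rule field_le_epsilon)
    fix e :: real assume e: "0 < e"
    have "of_nat (card E) * (e / (1 + of_nat (card E))) \<le> e"
      using e by (simp add: field_simps)
    then show "(\<Sum>e\<in>E. nrm2 (T e)) \<le> (\<Sum>n. (s n)\<^sup>2) + e"
      using main[of "e / (1 + of_nat (card E))"] e by fastforce
  qed
qed

end

section \<open>Construction of the singular numbers\<close>

text \<open>With \<open>c t\<close> the total multiplicity on \<open>[t, \<infinity>)\<close>, the required sequence is the generalised
  inverse \<open>s n = sup {t. n < c t}\<close>. The counting function \<open>c\<close> is left continuous because
  only finitely many values lie above any positive bound, so the supremum is attained and
  \<open>t \<le> s n\<close> is equivalent to \<open>n < c t\<close>.\<close>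

lemma decreasing_enumeration:
  fixes d :: "real \<Rightarrow> nat"
  assumes fin: "\<And>\<epsilon>. 0 < \<epsilon> \<Longrightarrow> finite {t. \<epsilon> \<le> t \<and> 0 < d t}"
  obtains s :: "nat \<Rightarrow> real" where "decseq s" "\<And>n. 0 \<le> s n"
    "\<And>t. 0 < t \<Longrightarrow> finite {n. s n = t} \<and> card {n. s n = t} = d t"
    "\<And>t n. 0 < t \<Longrightarrow> t \<le> s n \<longleftrightarrow> n < (\<Sum>u | t \<le> u \<and> 0 < d u. d u)"
proof -
  define A where "A t = {u. t \<le> u \<and> 0 < d u}" for t
  define c where "c t = (\<Sum>u\<in>A t. d u)" for t
  have finA: "finite (A t)" if "0 < t" for t using fin[OF that] by (simp add: A_def)
  have c_mono: "c u \<le> c t" if "0 < t" "t \<le> u" for t u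
    unfolding c_def using that by (intro sum_mono2 finA) (auto simp: A_def)
  define s where "s n = Sup (insert 0 {t. 0 < t \<and> n < c t})" for n
  have bdd: "bdd_above (insert 0 {t. 0 < t \<and> n < c t})" for n
  proof -
    let ?m = "Max (insert 1 (A 1))"
    have "t \<le> ?m" if t: "0 < t" "n < c t" for t
    proof (rule ccontr)
      assume "\<not> t \<le> ?m"
      moreover have "u \<le> ?m" if "u \<in> insert 1 (A 1)" for u
        using finA[of 1] that by (intro Max_ge) auto
      ultimately have lt: "u < t" if "u \<in> insert 1 (A 1)" for u
        using that by (meson le_less_trans not_le)
      have "A t = {}"
      proof (rule ccontr)
        assume "A t \<noteq> {}"
        then obtain u where "t \<le> u" "0 < d u" by (auto simp: A_def)
        then show False using lt[of u] lt[of 1] by (simp add: A_def)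
      qed
      then show False using t by (simp add: c_def)
    qed
    moreover have "1 \<le> ?m" using finA[of 1] by (intro Max_ge) auto
    then have "0 \<le> ?m" by linarith
    ultimately show ?thesis by (intro bdd_aboveI[of _ ?m]) auto
  qed
  have key: "t \<le> s n \<longleftrightarrow> n < c t" if t: "0 < t" for t n
  proof
    assume "n < c t"
    then show "t \<le> s n" unfolding s_def using t by (intro cSup_upper bdd) auto
  next
    assume ts: "t \<le> s n"
    show "n < c t"
    proof (rule ccontr)
      assume neg: "\<not> n < c t"
      \<comment> \<open>Between \<open>m\<close>, the largest value below \<open>t\<close> (or \<open>t/2\<close>), and \<open>t\<close> the function \<open>c\<close> is constant.\<close>
      let ?F = "insert (t/2) {u\<in>A (t/2). u < t}"
      have finF: "finite ?F" using finA[of "t/2"] t by auto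
      define m where "m = Max ?F"
      have mt: "m < t" using t finF by (simp add: m_def)
      have m_ge: "u \<le> m" if "u \<in> ?F" for u unfolding m_def using finF that by (intro Max_ge)
      have m0: "0 < m" using m_ge[of "t/2"] t by simp
      have "u \<le> m" if u: "0 < u" "n < c u" for u
      proof (rule ccontr)
        assume "\<not> u \<le> m"
        then have mu: "m < u" by simp
        have "c u \<le> c t"
        proof (cases "t \<le> u")
          case True then show ?thesis using c_mono t by blast
        next
          case False
          have "A u \<subseteq> A t"
          proof
            fix v assume v: "v \<in> A u"
            show "v \<in> A t"
            proof (rule ccontr)
              assume "v \<notin> A t"
              then have "v < t" using v by (auto simp: A_def)
              moreover have "t/2 \<le> v" using v mu m_ge[of "t/2"] by (simp add: A_def)
              ultimately have "v \<in> ?F" using v by (simp add: A_def)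
              then show False using m_ge[of v] mu v by (simp add: A_def)
            qed
          qed
          then show ?thesis unfolding c_def using finA[OF t] by (intro sum_mono2) auto
        qed
        with u neg show False by simp
      qed
      then have "s n \<le> m" unfolding s_def using m0 by (intro cSup_least) auto
      with ts mt show False by simp
    qed
  qed
  have card: "finite {n. s n = t} \<and> card {n. s n = t} = d t" if t: "0 < t" for t
  proof -
    let ?G = "{u. t < u \<and> 0 < d u}"
    have finG: "finite ?G" by (rule finite_subset[OF _ finA[OF t]]) (auto simp: A_def)
    define t' where "t' = Min (insert (t + 1) ?G)"
    have tt': "t < t'" using finG by (simp add: t'_def)
    have G: "A v = ?G" if "t < v" "v \<le> t'" for v
    proof -
      have "u \<ge> t'" if "u \<in> ?G" for u unfolding t'_def using finG that by (intro Min_le) auto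
      then show ?thesis using that by (force simp: A_def)
    qed
    have gt: "t < s n \<longleftrightarrow> n < c t'" for n
    proof
      assume "t < s n"
      then have "n < c (min (s n) t')" using key[of "min (s n) t'" n] t tt' by auto
      moreover have "c (min (s n) t') = c t'"
        using G[of "min (s n) t'"] G[of t'] \<open>t < s n\<close> tt' by (simp add: c_def)
      ultimately show "n < c t'" by simp
    next
      assume "n < c t'"
      then show "t < s n" using key[of t' n] t tt' by simp
    qed
    have "{n. s n = t} = {c t'..<c t}"
    proof (rule set_eqI)
      fix n
      have "s n = t \<longleftrightarrow> t \<le> s n \<and> \<not> t < s n" by linarith
      then show "n \<in> {n. s n = t} \<longleftrightarrow> n \<in> {c t'..<c t}" using gt[of n] key[OF t, of n] by auto
    qed
    moreover have "c t = d t + c t'"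
    proof -
      have "c t = (\<Sum>u\<in>insert t ?G. d u)"
        unfolding c_def by (rule sum.mono_neutral_left) (use finG in \<open>auto simp: A_def\<close>)
      then show ?thesis using finG G[of t'] tt' by (simp add: c_def)
    qed
    ultimately show ?thesis by simp
  qed
  have "decseq s"
    unfolding decseq_def s_def
    by (intro allI impI cSup_subset_mono bdd) auto
  moreover have "0 \<le> s n" for n unfolding s_def by (intro cSup_upper bdd) auto
  ultimately show ?thesis using that card key by (simp add: c_def A_def)
qed

context compact_adjoint_pair
begin

text \<open>If \<open>s n = \<sigma> > 0\<close> then at least \<open>n + 1\<close> eigenvalues, counted with multiplicity, are at
  least \<open>\<sigma>\<^sup>2\<close>. For \<open>\<sigma>\<^sup>2 \<le> \<epsilon>0\<close> the counting bound gives
  \<open>n + 1 \<le> K * \<sigma> powr (- 2 * \<beta>)\<close>, so \<open>s n powr p\<close> is at most a constant times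
  \<open>(n + 1) powr (- p / (2 * \<beta>))\<close>, and the exponent is below \<open>-1\<close>.\<close>

lemma singular_numbers_from_counting:
  assumes \<epsilon>0: "0 < \<epsilon>0" and K: "0 < K" and \<beta>: "0 < \<beta>" "2 * \<beta> < p"
    and count: "\<And>\<epsilon> B. \<lbrakk>0 < \<epsilon>; \<epsilon> \<le> \<epsilon>0; orthonormal B; \<forall>x\<in>B. \<epsilon> \<le> nrm2 (T x)\<rbrakk>
                   \<Longrightarrow> real (card B) \<le> K * \<epsilon> powr - \<beta>"
  obtains s :: "nat \<Rightarrow> real" where "decseq s" "\<And>n. 0 \<le> s n"
    "\<And>\<sigma>. 0 < \<sigma> \<Longrightarrow> finite {n. s n = \<sigma>} \<and> card {n. s n = \<sigma>} = dim (eigenspace \<sigma>)"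
    "summable (\<lambda>n. s n powr p)"
proof -
  define d where "d \<sigma> = (if 0 < \<sigma> then dim (eigenspace \<sigma>) else 0)" for \<sigma>
  have fam: "finite {t. \<sigma> \<le> t \<and> 0 < d t} \<and>
      (\<exists>B. maximal_eigen_family (\<sigma>\<^sup>2) B \<and> (\<Sum>u | \<sigma> \<le> u \<and> 0 < d u. d u) \<le> card B)" if \<sigma>: "0 < \<sigma>" for \<sigma>
  proof -
    obtain B where B: "maximal_eigen_family (\<sigma>\<^sup>2) B"
      using maximal_eigen_family_exists[of "\<sigma>\<^sup>2"] \<sigma> by auto
    have finB: "finite B" and big: "\<And>b. b \<in> B \<Longrightarrow> \<sigma>\<^sup>2 \<le> nrm2 (T b)"
      using B by (auto simp: maximal_eigen_family_def eigen_family_def orthonormal_def)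
    have d: "d t = card {b\<in>B. nrm2 (T b) = t\<^sup>2}" if "\<sigma> \<le> t" for t
      using dim_eigenspace[OF B, of t] that \<sigma> by (simp add: d_def power_mono)
    have sub: "{t. \<sigma> \<le> t \<and> 0 < d t} \<subseteq> (\<lambda>b. sqrt (nrm2 (T b))) ` B"
    proof
      fix t assume t: "t \<in> {t. \<sigma> \<le> t \<and> 0 < d t}"
      then have "{b\<in>B. nrm2 (T b) = t\<^sup>2} \<noteq> {}" using d[of t] by (auto simp: card_gt_0_iff)
      then obtain b where "b \<in> B" "nrm2 (T b) = t\<^sup>2" by auto
      then show "t \<in> (\<lambda>b. sqrt (nrm2 (T b))) ` B" using t \<sigma> by (intro image_eqI[of _ _ b]) auto
    qed
    then have fin: "finite {t. \<sigma> \<le> t \<and> 0 < d t}" using finB finite_surj by blast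
    have "(\<Sum>u | \<sigma> \<le> u \<and> 0 < d u. d u) = (\<Sum>u | \<sigma> \<le> u \<and> 0 < d u. card {b\<in>B. nrm2 (T b) = u\<^sup>2})"
      using d by (intro sum.cong) auto
    also have "\<dots> = card (\<Union>u\<in>{u. \<sigma> \<le> u \<and> 0 < d u}. {b\<in>B. nrm2 (T b) = u\<^sup>2})"
      using fin finB \<sigma> by (subst card_UN_disjoint) (auto simp: power2_eq_iff_nonneg)
    also have "\<dots> \<le> card B" using finB by (intro card_mono) auto
    finally show ?thesis using fin B by blast
  qed
  obtain s :: "nat \<Rightarrow> real" where s: "decseq s" "\<And>n. 0 \<le> s n"
    "\<And>t. 0 < t \<Longrightarrow> finite {n. s n = t} \<and> card {n. s n = t} = d t"
    "\<And>t n. 0 < t \<Longrightarrow> t \<le> s n \<longleftrightarrow> n < (\<Sum>u | t \<le> u \<and> 0 < d u. d u)"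
    using decreasing_enumeration[of d] fam by blast
  define q where "q = p / (2 * \<beta>)"
  have q: "q > 1" using \<beta> by (simp add: q_def)
  let ?N = "\<Sum>u | sqrt \<epsilon>0 \<le> u \<and> 0 < d u. d u"
  have bound: "s n powr p \<le> K powr q * (real (Suc n) powr - q)" if n: "?N \<le> n" for n
  proof (cases "s n = 0")
    case False
    then have pos: "0 < s n" using s(2)[of n] by linarith
    have "\<not> sqrt \<epsilon>0 \<le> s n" using s(4)[of "sqrt \<epsilon>0" n] \<epsilon>0 n by auto
    then have small: "(s n)\<^sup>2 \<le> \<epsilon>0"
      using pos \<epsilon>0 by (metis less_eq_real_def not_le real_sqrt_le_iff real_sqrt_unique)
    obtain B where B: "maximal_eigen_family ((s n)\<^sup>2) B" "(\<Sum>u | s n \<le> u \<and> 0 < d u. d u) \<le> card B"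
      using fam[OF pos] by blast
    have "n < card B" using s(4)[OF pos, of n] B(2) by simp
    then have "real (Suc n) \<le> real (card B)" by simp
    also have "\<dots> \<le> K * ((s n)\<^sup>2) powr - \<beta>"
      using B(1) small pos by (intro count) (auto simp: maximal_eigen_family_def eigen_family_def)
    also have "((s n)\<^sup>2) powr - \<beta> = s n powr (- (2 * \<beta>))"
      using pos by (simp add: powr_powr flip: powr_numeral)
    finally have "real (Suc n) * s n powr (2 * \<beta>) \<le> K"
      using pos by (simp add: powr_minus field_simps)
    then have "(real (Suc n) * s n powr (2 * \<beta>)) powr q \<le> K powr q"
      using q by (intro powr_mono2) auto
    moreover have "(s n powr (2 * \<beta>)) powr q = s n powr p" using \<beta> by (simp add: powr_powr q_def)
    ultimately have "real (Suc n) powr q * s n powr p \<le> K powr q" by (simp add: powr_mult)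
    then show ?thesis by (simp add: powr_minus field_simps)
  qed (use K in simp)
  have "summable (\<lambda>n. real (Suc n) powr - q)"
    using q summable_Suc_iff[of "\<lambda>n. real n powr - q"] by (simp add: summable_real_powr_iff)
  then have "summable (\<lambda>n. s n powr p)"
    by (rule summable_comparison_test'[where N = ?N, OF summable_mult[where c = "K powr q"]])
      (use bound in simp)
  then show ?thesis using that[of s] s by (simp add: d_def)
qed

end

section \<open>Power series and means over circles\<close>

lemma integral_cis_int:
  "integral {0..2*pi} (\<lambda>t. cis (of_int m * t)) = (if m = 0 then 2 * pi else 0)"
proof (cases "m = 0")
  case False
  let ?F = "\<lambda>t. cis (of_int m * t) / (\<i> * of_int m)"
  have "((\<lambda>t. cis (of_int m * t)) has_integral (?F (2*pi) - ?F 0)) {0..2*pi}"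
  proof (rule fundamental_theorem_of_calculus)
    fix t :: real
    have "((\<lambda>z. exp (\<i> * (of_int m * z)) / (\<i> * of_int m)) has_field_derivative
        exp (\<i> * (of_int m * of_real t))) (at (of_real t))"
      using False by (auto intro!: derivative_eq_intros simp: mult_ac)
    from has_vector_derivative_real_field[OF this] show "(?F has_vector_derivative cis (of_int m * t)) (at t within {0..2*pi})"
      by (simp add: cis_conv_exp)
  qed simp
  moreover have "cis (of_int m * (2 * pi)) = 1"
    using cis_multiple_2pi[of "of_int m"] by (simp add: mult_ac)
  ultimately show ?thesis using False by (simp add: integral_unique)
qed (simp add: scaleR_conv_of_real)

lemma circle_mean_power_cnj_power:
  "circle_mean (\<lambda>z. z ^ n * cnj (z ^ k)) r = (if n = k then of_real (r ^ (2 * n)) else 0)"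
proof -
  have eq: "(of_real r * cis t) ^ n * cnj ((of_real r * cis t) ^ k)
      = of_real (r ^ (n + k)) * cis (of_int (int n - int k) * t)" for t
  proof -
    have "cis t ^ n * cis (- t) ^ k = cis (real n * t - real k * t)"
      unfolding Complex.DeMoivre cis_mult by (rule arg_cong[where f = cis]) simp
    then show ?thesis by (simp add: power_mult_distrib power_add cis_cnj left_diff_distrib)
  qed
  have "circle_mean (\<lambda>z. z ^ n * cnj (z ^ k)) r
      = of_real (r ^ (n + k)) * integral {0..2*pi} (\<lambda>t. cis (of_int (int n - int k) * t)) / (2 * pi)"
    unfolding circle_mean_def eq by (subst integral_mult_right) (rule refl)
  then show ?thesis
    unfolding integral_cis_int by (cases "n = k") (simp_all flip: mult_2)
qed

lemma circle_mean_sums: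
  assumes cont: "\<And>k. continuous_on (sphere 0 r) (u k)" and r: "0 \<le> r"
    and M: "\<And>k z. z \<in> sphere 0 r \<Longrightarrow> cmod (u k z) \<le> M k" "summable M"
    and sums: "\<And>z. z \<in> sphere 0 r \<Longrightarrow> (\<lambda>k. u k z) sums v z"
  shows "(\<lambda>k. circle_mean (u k) r) sums circle_mean v r"
proof -
  let ?z = "\<lambda>t. of_real r * cis t"
  have z: "?z t \<in> sphere 0 r" for t using r by (simp add: norm_mult)
  have cc: "continuous_on {0..2*pi} (\<lambda>t. u k (?z t))" for k
    by (rule continuous_on_compose2[OF cont, of _ ?z]) (use z in \<open>auto intro!: continuous_intros\<close>)
  have "uniform_limit {0..2*pi} (\<lambda>n t. \<Sum>i<n. u i (?z t)) (\<lambda>t. \<Sum>i. u i (?z t)) sequentially"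
    by (rule Weierstrass_m_test) (use M z in auto)
  then obtain I J where I: "\<And>n. ((\<lambda>t. \<Sum>i<n. u i (?z t)) has_integral I n) {0..2*pi}"
      "((\<lambda>t. \<Sum>i. u i (?z t)) has_integral J) {0..2*pi}" "I \<longlonglongrightarrow> J"
    by (rule uniform_limit_integral) (use cc in \<open>auto intro!: continuous_intros\<close>)
  have "I = (\<lambda>n. \<Sum>i<n. integral {0..2*pi} (\<lambda>t. u i (?z t)))"
  proof
    show "I n = (\<Sum>i<n. integral {0..2*pi} (\<lambda>t. u i (?z t)))" for n
      using integral_unique[OF I(1)] cc
      by (subst (asm) integral_sum) (auto intro: integrable_continuous_real)
  qed
  then have "(\<lambda>i. integral {0..2*pi} (\<lambda>t. u i (?z t))) sums J" unfolding sums_def using I(3) by simp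
  moreover have "(\<lambda>t. \<Sum>i. u i (?z t)) = (\<lambda>t. v (?z t))" using sums[OF z] by (auto simp: sums_iff)
  then have "J = integral {0..2*pi} (\<lambda>t. v (?z t))" using integral_unique[OF I(2)] by simp
  ultimately show ?thesis unfolding circle_mean_def by (intro sums_divide) simp
qed

definition hcoef :: "(complex \<Rightarrow> complex) \<Rightarrow> nat \<Rightarrow> complex" where
  "hcoef f n = (deriv ^^ n) f 0 / fact n"

lemma hcoef_sums:
  "\<lbrakk>f holomorphic_on ball 0 1; cmod z < 1\<rbrakk> \<Longrightarrow> (\<lambda>n. hcoef f n * z ^ n) sums f z"
  using holomorphic_power_series[of f 0 1 z] by (simp add: hcoef_def)

lemma power_series_on_disc:
  assumes sums: "\<And>z. cmod z < 1 \<Longrightarrow> (\<lambda>n. a n * z ^ n) sums f z"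
  shows "f holomorphic_on ball 0 1" "hcoef f = a"
proof -
  define F where "F = Abs_fps a"
  have R: "fps_conv_radius F \<ge> 1"
    unfolding fps_conv_radius_def F_def
  proof (rule conv_radius_geI_ex)
    fix r :: real assume "0 < r" "ereal r < 1"
    then show "\<exists>z. norm z = r \<and> summable (\<lambda>n. fps_nth (Abs_fps a) n * z ^ n)"
      using sums[of "of_real r"] by (intro exI[of _ "of_real r"]) (auto simp: sums_iff)
  qed
  have eq: "f z = eval_fps F z" if "z \<in> ball 0 1" for z
    using sums[of z] that by (simp add: eval_fps_def F_def sums_iff)
  have "ball (0::complex) 1 \<subseteq> eball 0 (fps_conv_radius F)"
  proof
    fix z :: complex assume "z \<in> ball 0 1"
    then have "ereal (cmod z) < 1" by simp
    from less_le_trans[OF this R] show "z \<in> eball 0 (fps_conv_radius F)" by (simp add: in_eball_iff)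
  qed
  then have "eval_fps F holomorphic_on ball 0 1" by (rule holomorphic_on_eval_fps)
  then show "f holomorphic_on ball 0 1" by (rule holomorphic_transform) (simp add: eq)
  have "f has_fps_expansion F"
    unfolding has_fps_expansion_def
  proof
    show "0 < fps_conv_radius F" by (rule less_le_trans[OF _ R]) simp
    show "\<forall>\<^sub>F z in nhds 0. eval_fps F z = f z"
      using eventually_nhds_in_open[OF open_ball, of "0::complex" 0 1] by (simp add: eventually_mono eq)
  qed
  then show "hcoef f = a" using fps_nth_fps_expansion by (fastforce simp: hcoef_def F_def)
qed

lemma hcoef_abs_summable:
  assumes f: "f holomorphic_on ball 0 1" and r: "0 \<le> r" "r < 1"
  shows "summable (\<lambda>n. cmod (hcoef f n) * r ^ n)"
proof -
  define \<rho> where "\<rho> = (r + 1) / 2"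
  have "summable (\<lambda>n. hcoef f n * of_real \<rho> ^ n)"
    using hcoef_sums[OF f, of "of_real \<rho>"] r by (auto simp: \<rho>_def sums_iff)
  then have "summable (\<lambda>n. norm (hcoef f n * of_real r ^ n))"
    by (rule powser_insidea) (use r in \<open>auto simp: \<rho>_def\<close>)
  then show ?thesis using r by (simp add: norm_mult norm_power)
qed

text \<open>Expand both factors into their Taylor series, which converge uniformly on the circle; only the
  diagonal terms survive.\<close>

lemma parseval_on_circle:
  assumes f: "f holomorphic_on ball 0 1" and g: "g holomorphic_on ball 0 1" and r: "0 \<le> r" "r < 1"
  shows "(\<lambda>n. hcoef f n * cnj (hcoef g n) * of_real (r ^ (2 * n)))
           sums circle_mean (\<lambda>z. f z * cnj (g z)) r"
proof -
  have sub: "sphere 0 r \<subseteq> ball (0::complex) 1" using r by auto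
  have cg: "continuous_on (sphere 0 r) g"
    using g sub holomorphic_on_imp_continuous_on holomorphic_on_subset by blast
  have scale: "circle_mean (\<lambda>z. c * h z) r = c * circle_mean h r" for c h
    by (simp add: circle_mean_def integral_mult_right)
  have one: "circle_mean (\<lambda>z. z ^ n * cnj (g z)) r = cnj (hcoef g n) * of_real (r ^ (2 * n))" for n
  proof -
    have "(\<lambda>k. circle_mean (\<lambda>z. cnj (hcoef g k) * (z ^ n * cnj (z ^ k))) r)
        sums circle_mean (\<lambda>z. z ^ n * cnj (g z)) r"
    proof (rule circle_mean_sums)
      show "summable (\<lambda>k. r ^ n * (cmod (hcoef g k) * r ^ k))"
        by (intro summable_mult hcoef_abs_summable g r)
      fix z :: complex assume z: "z \<in> sphere 0 r"
      then show "(\<lambda>k. cnj (hcoef g k) * (z ^ n * cnj (z ^ k))) sums (z ^ n * cnj (g z))"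
        using sums_mult[OF sums_cnj[THEN iffD2, OF hcoef_sums[OF g, of z]], of "z ^ n"] r
        by (simp add: mult_ac)
    qed (use r in \<open>auto intro!: continuous_intros simp: norm_mult norm_power\<close>)
    then have "(\<lambda>k. if k = n then cnj (hcoef g k) * of_real (r ^ (2 * n)) else 0)
        sums circle_mean (\<lambda>z. z ^ n * cnj (g z)) r"
      unfolding scale circle_mean_power_cnj_power
      by (rule back_subst[where P = "\<lambda>u. u sums _"]) auto
    from sums_unique2[OF this sums_single[of n "\<lambda>k. cnj (hcoef g k) * of_real (r ^ (2 * n))"]]
    show ?thesis .
  qed
  have bg: "\<exists>B. \<forall>z\<in>sphere 0 r. cmod (g z) \<le> B"
    using compact_imp_bounded[OF compact_continuous_image[OF cg]] by (auto simp: bounded_iff)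
  then obtain B where B: "\<And>z. z \<in> sphere 0 r \<Longrightarrow> cmod (g z) \<le> B" by blast
  have "(\<lambda>n. circle_mean (\<lambda>z. hcoef f n * (z ^ n * cnj (g z))) r) sums circle_mean (\<lambda>z. f z * cnj (g z)) r"
  proof (rule circle_mean_sums)
    show "summable (\<lambda>n. (cmod (hcoef f n) * r ^ n) * B)"
      by (intro summable_mult2 hcoef_abs_summable f r)
    fix z :: complex assume z: "z \<in> sphere 0 r"
    then show "(\<lambda>n. hcoef f n * (z ^ n * cnj (g z))) sums (f z * cnj (g z))"
      using sums_mult2[OF hcoef_sums[OF f, of z], of "cnj (g z)"] r by (simp add: mult_ac)
    show "cmod (hcoef f n * (z ^ n * cnj (g z))) \<le> cmod (hcoef f n) * r ^ n * B" for n
      using B[OF z] z r by (auto simp: norm_mult norm_power mult.assoc intro!: mult_left_mono)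
  qed (use r cg in \<open>auto intro!: continuous_intros\<close>)
  then show ?thesis unfolding scale one by (simp add: mult_ac)
qed

lemma circle_mean_holomorphic:
  assumes f: "f holomorphic_on ball 0 1" and r: "0 \<le> r" "r < 1"
  shows "circle_mean f r = f 0"
proof -
  have "(\<lambda>n. hcoef f n * cnj (hcoef (\<lambda>_. 1) n) * of_real (r ^ (2 * n))) sums circle_mean f r"
    using parseval_on_circle[OF f holomorphic_on_const[of 1] r] by simp
  moreover have "(\<lambda>n. hcoef f n * cnj (hcoef (\<lambda>_. 1) n) * of_real (r ^ (2 * n)))
      = (\<lambda>n. if n = 0 then f 0 else 0)"
    by (auto simp: hcoef_def)
  ultimately show ?thesis using sums_unique2 sums_single[of 0 "\<lambda>_. f 0"] by fastforce
qed

section \<open>The Hardy space as a space of square summable coefficients\<close>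

lemma hardy2_holomorphic: "f \<in> hardy2 \<Longrightarrow> f holomorphic_on ball 0 1"
  by (simp add: hardy2_def)

lemma hardy2_outside: "f \<in> hardy2 \<Longrightarrow> 1 \<le> cmod z \<Longrightarrow> f z = 0"
  by (simp add: hardy2_def)

lemma circle_mean_norm_sums:
  assumes f: "f holomorphic_on ball 0 1" and r: "0 \<le> r" "r < 1"
  shows "(\<lambda>n. (cmod (hcoef f n))\<^sup>2 * r ^ (2 * n)) sums Re (circle_mean (\<lambda>z. of_real ((cmod (f z))\<^sup>2)) r)"
  using sums_Re[OF parseval_on_circle[OF f f r]]
  by (simp only: complex_norm_square[symmetric] of_real_mult[symmetric] of_real_power[symmetric] Re_complex_of_real)

lemma square_summable_if_means_bounded:
  assumes f: "f holomorphic_on ball 0 1"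
    and B: "\<And>r. 0 \<le> r \<Longrightarrow> r < 1 \<Longrightarrow> Re (circle_mean (\<lambda>z. of_real ((cmod (f z))\<^sup>2)) r) \<le> B"
  shows "summable (\<lambda>n. (cmod (hcoef f n))\<^sup>2)" "(\<Sum>n. (cmod (hcoef f n))\<^sup>2) \<le> B"
proof -
  have part: "(\<Sum>n<N. (cmod (hcoef f n))\<^sup>2) \<le> B" for N
  proof -
    have lim: "((\<lambda>r. \<Sum>n<N. (cmod (hcoef f n))\<^sup>2 * r ^ (2 * n)) \<longlongrightarrow> (\<Sum>n<N. (cmod (hcoef f n))\<^sup>2 * 1 ^ (2 * n))) (at_left 1)"
      by (intro tendsto_intros)
    have ev: "\<forall>\<^sub>F r in at_left 1. (\<Sum>n<N. (cmod (hcoef f n))\<^sup>2 * r ^ (2 * n)) \<le> B"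
      using eventually_at_left_real[of 0 1]
    proof (rule eventually_mono)
      fix r :: real assume "r \<in> {0<..<1}"
      then have r: "0 \<le> r" "r < 1" by auto
      have "(\<Sum>n<N. (cmod (hcoef f n))\<^sup>2 * r ^ (2 * n)) \<le> Re (circle_mean (\<lambda>z. of_real ((cmod (f z))\<^sup>2)) r)"
        using circle_mean_norm_sums[OF f r] r unfolding sums_iff
        by (metis (no_types, lifting) sum_le_suminf finite_lessThan mult_nonneg_nonneg zero_le_power zero_le_power2)
      with B[OF r] show "(\<Sum>n<N. (cmod (hcoef f n))\<^sup>2 * r ^ (2 * n)) \<le> B" by linarith
    qed simp
    from tendsto_upperbound[OF lim ev] show ?thesis by simp
  qed
  then show "summable (\<lambda>n. (cmod (hcoef f n))\<^sup>2)"
    by (intro bounded_imp_summable[of _ B]) (auto simp only: lessThan_Suc_atMost[symmetric] zero_le_power2)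
  then show "(\<Sum>n. (cmod (hcoef f n))\<^sup>2) \<le> B" using part by (intro suminf_le_const) auto
qed

lemma hardy2_square_summable:
  assumes f: "f \<in> hardy2"
  shows "summable (\<lambda>n. (cmod (hcoef f n))\<^sup>2)"
proof -
  obtain B where "\<forall>r\<in>{0..<1}. Re (circle_mean (\<lambda>z. of_real ((cmod (f z))\<^sup>2)) r) \<le> B"
    using f by (auto simp: hardy2_def bdd_above_def)
  then show ?thesis using square_summable_if_means_bounded(1)[OF hardy2_holomorphic[OF f], of B] by simp
qed

lemma circle_mean_le_coefficients:
  assumes f: "f holomorphic_on ball 0 1" and s: "summable (\<lambda>n. (cmod (hcoef f n))\<^sup>2)" and r: "0 \<le> r" "r < 1"
  shows "Re (circle_mean (\<lambda>z. of_real ((cmod (f z))\<^sup>2)) r) \<le> (\<Sum>n. (cmod (hcoef f n))\<^sup>2)"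
proof (rule sums_le[OF _ circle_mean_norm_sums[OF f r] summable_sums[OF s]])
  fix n
  have "r ^ (2 * n) \<le> 1" using r by (intro power_le_one) auto
  then show "(cmod (hcoef f n))\<^sup>2 * r ^ (2 * n) \<le> (cmod (hcoef f n))\<^sup>2"
    using mult_left_mono[of "r ^ (2 * n)" 1 "(cmod (hcoef f n))\<^sup>2"] by simp
qed

lemma hardy2_iff:
  "f \<in> hardy2 \<longleftrightarrow> f holomorphic_on ball 0 1 \<and> (\<forall>z. 1 \<le> cmod z \<longrightarrow> f z = 0) \<and> summable (\<lambda>n. (cmod (hcoef f n))\<^sup>2)"
proof
  assume "f \<in> hardy2"
  then show "f holomorphic_on ball 0 1 \<and> (\<forall>z. 1 \<le> cmod z \<longrightarrow> f z = 0) \<and> summable (\<lambda>n. (cmod (hcoef f n))\<^sup>2)"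
    using hardy2_square_summable hardy2_holomorphic hardy2_outside by blast
next
  assume f: "f holomorphic_on ball 0 1 \<and> (\<forall>z. 1 \<le> cmod z \<longrightarrow> f z = 0) \<and> summable (\<lambda>n. (cmod (hcoef f n))\<^sup>2)"
  then have "bdd_above ((\<lambda>r. Re (circle_mean (\<lambda>z. of_real ((cmod (f z))\<^sup>2)) r)) ` {0..<1})"
    by (intro bdd_aboveI2[OF circle_mean_le_coefficients]) auto
  then show "f \<in> hardy2" using f by (simp add: hardy2_def not_less)
qed

definition from_coef :: "(nat \<Rightarrow> complex) \<Rightarrow> complex \<Rightarrow> complex" where
  "from_coef a z = (if cmod z < 1 then \<Sum>n. a n * z ^ n else 0)"

lemma from_coef:
  assumes s: "summable (\<lambda>n. (cmod (a n))\<^sup>2)"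
  shows "from_coef a \<in> hardy2" "hcoef (from_coef a) = a"
proof -
  have sums: "(\<lambda>n. a n * z ^ n) sums from_coef a z" if z: "cmod z < 1" for z
  proof -
    have "summable (\<lambda>n. (cmod (a n))\<^sup>2 + (cmod z ^ n)\<^sup>2)"
    proof (intro summable_add s)
      have "summable (\<lambda>n. ((cmod z)\<^sup>2) ^ n)" using z by (intro summable_geometric) (simp add: power_less_one_iff abs_square_less_1)
      then show "summable (\<lambda>n. (cmod z ^ n)\<^sup>2)" by (simp add: power_mult[symmetric] mult.commute)
    qed
    then have "summable (\<lambda>n. norm (a n * z ^ n))"
    proof (rule summable_comparison_test'[where N = 0])
      fix n
      have "0 \<le> (cmod (a n) - cmod z ^ n)\<^sup>2" by simp
      then have "2 * (cmod (a n) * cmod z ^ n) \<le> (cmod (a n))\<^sup>2 + (cmod z ^ n)\<^sup>2"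
        by (simp add: power2_diff)
      then show "norm (norm (a n * z ^ n)) \<le> (cmod (a n))\<^sup>2 + (cmod z ^ n)\<^sup>2"
        by (simp add: norm_mult norm_power) (smt (verit) zero_le_power2)
    qed
    then show ?thesis using z by (simp add: from_coef_def summable_norm_cancel summable_sums)
  qed
  note ps = power_series_on_disc[of a "from_coef a", OF sums]
  show c: "hcoef (from_coef a) = a" by (rule ps)
  show "from_coef a \<in> hardy2" unfolding hardy2_iff using ps s by (auto simp: from_coef_def)
qed

lemma hardy2_eqI:
  assumes "f \<in> hardy2" "g \<in> hardy2" "hcoef f = hcoef g"
  shows "f = g"
proof
  fix z show "f z = g z"
  proof (cases "cmod z < 1")
    case True
    then show ?thesis using hcoef_sums[OF hardy2_holomorphic[OF assms(1)]]
      hcoef_sums[OF hardy2_holomorphic[OF assms(2)]] assms(3) by (metis sums_unique2)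
  next
    case False then show ?thesis using assms by (simp add: hardy2_outside)
  qed
qed

lemma summable_coef_product:
  assumes "summable (\<lambda>n. (cmod (a n))\<^sup>2)" "summable (\<lambda>n. (cmod (b n))\<^sup>2)"
  shows "summable (\<lambda>n. cmod (a n * cnj (b n)))"
proof (rule summable_comparison_test'[where N = 0])
  show "summable (\<lambda>n. (cmod (a n))\<^sup>2 + (cmod (b n))\<^sup>2)" using assms by (rule summable_add)
  fix n
  have "0 \<le> (cmod (a n) - cmod (b n))\<^sup>2" by simp
  then have "2 * (cmod (a n) * cmod (b n)) \<le> (cmod (a n))\<^sup>2 + (cmod (b n))\<^sup>2"
    by (simp add: power2_diff)
  then show "norm (cmod (a n * cnj (b n))) \<le> (cmod (a n))\<^sup>2 + (cmod (b n))\<^sup>2"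
    by (simp add: norm_mult) (smt (verit) zero_le_power2)
qed

text \<open>On the circle of radius \<open>r\<close> the mean is the sum of the coefficient products damped by powers of
  \<open>r\<close>; dominated convergence for series lets \<open>r\<close> tend to \<open>1\<close>.\<close>

lemma hardy2_inner_limit:
  assumes f: "f \<in> hardy2" and g: "g \<in> hardy2"
  shows "(circle_mean (\<lambda>z. f z * cnj (g z)) \<longlongrightarrow> (\<Sum>n. hcoef f n * cnj (hcoef g n))) (at_left 1)"
proof -
  let ?u = "\<lambda>n r. hcoef f n * cnj (hcoef g n) * of_real (r ^ (2 * n))"
  have "((\<lambda>r. \<Sum>n. ?u n r) \<longlongrightarrow> (\<Sum>n. hcoef f n * cnj (hcoef g n))) (at_left 1)"
  proof (rule tannerys_theorem[THEN conjunct2, THEN conjunct2])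
    show "summable (\<lambda>n. cmod (hcoef f n * cnj (hcoef g n)))"
      by (intro summable_coef_product hardy2_square_summable f g)
    have "(?u n \<longlongrightarrow> hcoef f n * cnj (hcoef g n) * of_real (1 ^ (2 * n))) (at_left 1)" for n
      by (intro tendsto_intros)
    then show "(?u n \<longlongrightarrow> hcoef f n * cnj (hcoef g n)) (at_left 1)" for n by simp
    have "\<forall>\<^sub>F r::real in at_left 1. r \<in> {0<..<1}" by (rule eventually_at_left_real) simp
    then show "\<forall>\<^sub>F (n, r) in sequentially \<times>\<^sub>F at_left 1. cmod (?u n r) \<le> cmod (hcoef f n * cnj (hcoef g n))"
      unfolding eventually_prod_filter
      by (intro exI[of _ "\<lambda>_. True"] exI[of _ "\<lambda>r. r \<in> {0<..<1::real}"])
        (auto simp: norm_mult norm_power intro!: mult_left_le power_le_one)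
  qed simp
  moreover have "\<forall>\<^sub>F r in at_left 1. (\<Sum>n. ?u n r) = circle_mean (\<lambda>z. f z * cnj (g z)) r"
    using eventually_at_left_real[of 0 1]
  proof (rule eventually_mono)
    fix r :: real assume "r \<in> {0<..<1}"
    then show "(\<Sum>n. ?u n r) = circle_mean (\<lambda>z. f z * cnj (g z)) r"
      using parseval_on_circle[OF hardy2_holomorphic[OF f] hardy2_holomorphic[OF g], of r] by (simp add: sums_iff)
  qed simp
  ultimately show ?thesis by (rule Lim_transform_eventually)
qed

lemma hardy2_inner_eq:
  assumes "f \<in> hardy2" "g \<in> hardy2"
  shows "hardy2_inner f g = (\<Sum>n. hcoef f n * cnj (hcoef g n))"
  unfolding hardy2_inner_def by (intro tendsto_Lim hardy2_inner_limit assms) simp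

section \<open>The Hardy space as a Hilbert space\<close>

lemma cmod_add_square_le: "(cmod (a + b))\<^sup>2 \<le> 2 * (cmod a)\<^sup>2 + 2 * (cmod b)\<^sup>2"
proof -
  have "(cmod (a + b))\<^sup>2 \<le> (cmod a + cmod b)\<^sup>2" by (intro power_mono norm_triangle_ineq) auto
  also have "\<dots> \<le> 2 * (cmod a)\<^sup>2 + 2 * (cmod b)\<^sup>2"
    using zero_le_power2[of "cmod a - cmod b"] by (simp add: power2_sum power2_diff)
  finally show ?thesis .
qed

lemma hcoef_add:
  assumes f: "f holomorphic_on ball 0 1" and g: "g holomorphic_on ball 0 1"
  shows "hcoef (f + g) n = hcoef f n + hcoef g n"
proof -
  have "(\<lambda>n. (hcoef f n + hcoef g n) * z ^ n) sums (f + g) z" if "cmod z < 1" for z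
    using sums_add[OF hcoef_sums[OF f that] hcoef_sums[OF g that]] by (simp add: distrib_right)
  from power_series_on_disc(2)[OF this] show ?thesis by metis
qed

lemma hcoef_scale:
  assumes f: "f holomorphic_on ball 0 1"
  shows "hcoef (\<lambda>z. c * f z) n = c * hcoef f n"
proof -
  have "(\<lambda>n. (c * hcoef f n) * z ^ n) sums (c * f z)" if "cmod z < 1" for z
    using sums_mult[OF hcoef_sums[OF f that], of c] by (simp add: mult.assoc)
  from power_series_on_disc(2)[OF this] show ?thesis by metis
qed

lemma hardy2_add: "\<lbrakk>f \<in> hardy2; g \<in> hardy2\<rbrakk> \<Longrightarrow> f + g \<in> hardy2"
proof -
  assume f: "f \<in> hardy2" and g: "g \<in> hardy2"
  have "(\<lambda>z. f z + g z) holomorphic_on ball 0 1"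
    using f g by (intro holomorphic_on_add hardy2_holomorphic)
  then have "f + g holomorphic_on ball 0 1" by (simp add: plus_fun_def)
  moreover have "summable (\<lambda>n. (cmod (hcoef (f + g) n))\<^sup>2)"
  proof (rule summable_comparison_test'[where N = 0])
    show "summable (\<lambda>n. 2 * (cmod (hcoef f n))\<^sup>2 + 2 * (cmod (hcoef g n))\<^sup>2)"
      by (intro summable_add summable_mult hardy2_square_summable f g)
  qed (use f g in \<open>simp add: hcoef_add hardy2_holomorphic cmod_add_square_le\<close>)
  ultimately show ?thesis using f g by (auto simp: hardy2_iff)
qed

lemma hardy2_scale: "f \<in> hardy2 \<Longrightarrow> (\<lambda>z. c * f z) \<in> hardy2"
proof -
  assume f: "f \<in> hardy2"
  have "summable (\<lambda>n. (cmod (hcoef (\<lambda>z. c * f z) n))\<^sup>2)"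
    using summable_mult[OF hardy2_square_summable[OF f], of "(cmod c)\<^sup>2"] f
    by (simp add: hcoef_scale hardy2_holomorphic norm_mult power_mult_distrib)
  then show ?thesis using f by (auto simp: hardy2_iff intro!: holomorphic_intros)
qed

lemma hardy2_zero: "(0 :: complex \<Rightarrow> complex) \<in> hardy2" and hcoef_zero: "hcoef 0 n = 0"
proof -
  have "(\<lambda>n. 0 * z ^ n) sums (0 :: complex \<Rightarrow> complex) z" for z by simp
  note ps = power_series_on_disc[OF this]
  show "hcoef 0 n = 0" using ps(2) by metis
  show "(0 :: complex \<Rightarrow> complex) \<in> hardy2" unfolding hardy2_iff using ps unfolding zero_fun_def by simp
qed

lemma summable_inner: "\<lbrakk>f \<in> hardy2; g \<in> hardy2\<rbrakk> \<Longrightarrow> summable (\<lambda>n. hcoef f n * cnj (hcoef g n))"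
  by (intro summable_norm_cancel[OF summable_coef_product] hardy2_square_summable)

lemma hardy2_inner_self:
  assumes f: "f \<in> hardy2"
  shows "hardy2_inner f f = of_real (\<Sum>n. (cmod (hcoef f n))\<^sup>2)"
  using hardy2_square_summable[OF f]
  by (simp add: hardy2_inner_eq[OF f f] complex_norm_square[symmetric] suminf_of_real flip: of_real_power)

interpretation H: inner_product_subspace "\<lambda>(c::complex) (f::complex \<Rightarrow> complex) z. c * f z" hardy2 hardy2_inner
proof unfold_locales
  show "cfun.subspace hardy2"
    unfolding cfun.subspace_def using hardy2_zero hardy2_add hardy2_scale by blast
next
  fix f g h assume V: "f \<in> hardy2" "g \<in> hardy2" "h \<in> hardy2"
  show "hardy2_inner (f + g) h = hardy2_inner f h + hardy2_inner g h"
    using V by (simp add: hardy2_inner_eq hardy2_add hcoef_add hardy2_holomorphic distrib_right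
        suminf_add[symmetric] summable_inner)
next
  fix c f g assume V: "f \<in> hardy2" "g \<in> hardy2"
  show "hardy2_inner (\<lambda>z. c * f z) g = c * hardy2_inner f g"
    using V by (simp add: hardy2_inner_eq hardy2_scale hcoef_scale hardy2_holomorphic mult.assoc
        suminf_mult summable_inner)
next
  fix f g assume V: "f \<in> hardy2" "g \<in> hardy2"
  have "(\<lambda>n. cnj (hcoef f n * cnj (hcoef g n))) sums cnj (hardy2_inner f g)"
    using V summable_sums[OF summable_inner[OF V]] by (subst sums_cnj) (simp add: hardy2_inner_eq)
  then show "hardy2_inner g f = cnj (hardy2_inner f g)"
    using V by (simp add: hardy2_inner_eq sums_iff mult.commute)
next
  fix f assume f: "f \<in> hardy2"
  then show "0 \<le> Re (hardy2_inner f f)"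
    by (simp add: hardy2_inner_self suminf_nonneg hardy2_square_summable)
  assume "hardy2_inner f f = 0"
  then have "(\<Sum>n. (cmod (hcoef f n))\<^sup>2) = 0" using f by (simp add: hardy2_inner_self flip: of_real_power)
  then have "\<forall>n. (cmod (hcoef f n))\<^sup>2 = 0"
    using suminf_eq_zero_iff[OF hardy2_square_summable[OF f]] by simp
  then show "f = 0" using f by (intro hardy2_eqI hardy2_zero) (auto simp: hcoef_zero)
qed

lemma nrm2_eq: "f \<in> hardy2 \<Longrightarrow> H.nrm2 f = (\<Sum>n. (cmod (hcoef f n))\<^sup>2)"
  by (simp add: H.nrm2_def hardy2_inner_self)

lemma hcoef_diff: "\<lbrakk>f \<in> hardy2; g \<in> hardy2\<rbrakk> \<Longrightarrow> hcoef (f - g) n = hcoef f n - hcoef g n"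
  using hcoef_add[of "f - g" g n] by (simp add: hardy2_holomorphic)

definition monomial :: "nat \<Rightarrow> complex \<Rightarrow> complex" where
  "monomial k = from_coef (\<lambda>n. if n = k then 1 else 0)"

lemma monomial_in [simp]: "monomial k \<in> hardy2"
  and hcoef_monomial: "hcoef (monomial k) = (\<lambda>n. if n = k then 1 else 0)"
proof -
  have "(\<lambda>n. (cmod (if n = k then 1 else 0))\<^sup>2) = (\<lambda>n. if n = k then (1::real) else 0)" by auto
  then have s: "summable (\<lambda>n. (cmod (if n = k then 1 else 0))\<^sup>2)"
    using sums_single[of k "\<lambda>_. 1::real"] by (simp add: sums_iff)
  show "monomial k \<in> hardy2" "hcoef (monomial k) = (\<lambda>n. if n = k then 1 else 0)"
    unfolding monomial_def using from_coef[OF s] by auto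
qed

lemma monomial_eq: "cmod z < 1 \<Longrightarrow> monomial k z = z ^ k"
proof -
  assume z: "cmod z < 1"
  have "(\<lambda>n. (if n = k then 1 else 0) * z ^ n) = (\<lambda>n. if n = k then z ^ n else 0)" by auto
  then show ?thesis using z sums_unique[OF sums_single[of k "\<lambda>n. z ^ n"]] by (simp add: monomial_def from_coef_def)
qed

lemma inner_monomial: "f \<in> hardy2 \<Longrightarrow> hardy2_inner f (monomial k) = hcoef f k"
proof -
  assume f: "f \<in> hardy2"
  have "(\<lambda>n. hcoef f n * cnj (hcoef (monomial k) n)) = (\<lambda>n. if n = k then hcoef f n else 0)"
    by (auto simp: hcoef_monomial)
  then show ?thesis using f sums_unique[OF sums_single[of k "hcoef f"]] by (simp add: hardy2_inner_eq)
qed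

lemma orthonormal_monomials: "H.orthonormal (monomial ` {..<N})" "card (monomial ` {..<N}) = N"
proof -
  have "inj monomial"
  proof (rule injI)
    fix j k assume "monomial j = monomial k"
    then show "j = k" using hcoef_monomial[of j] hcoef_monomial[of k] by (metis zero_neq_one)
  qed
  then show "card (monomial ` {..<N}) = N" by (simp add: card_image inj_on_subset)
  have "hardy2_inner (monomial j) (monomial k) = (if monomial j = monomial k then 1 else 0)" for j k
    using \<open>inj monomial\<close> by (simp add: inner_monomial hcoef_monomial inj_eq)
  then show "H.orthonormal (monomial ` {..<N})" by (auto simp: H.orthonormal_def)
qed

definition kernel :: "complex \<Rightarrow> complex \<Rightarrow> complex" where
  "kernel w = from_coef (\<lambda>n. cnj w ^ n)"

lemma kernel:
  assumes w: "cmod w < 1"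
  shows "kernel w \<in> hardy2" "H.nrm2 (kernel w) = 1 / (1 - (cmod w)\<^sup>2)"
    "f \<in> hardy2 \<Longrightarrow> hardy2_inner f (kernel w) = f w"
proof -
  have w2: "norm ((cmod w)\<^sup>2) < 1" using w by (simp add: abs_square_less_1)
  have sq: "(cmod (cnj w ^ n))\<^sup>2 = ((cmod w)\<^sup>2) ^ n" for n
    by (simp add: norm_power power_mult[symmetric] mult.commute)
  have s: "summable (\<lambda>n. (cmod (cnj w ^ n))\<^sup>2)" unfolding sq by (rule summable_geometric[OF w2])
  show k: "kernel w \<in> hardy2" using from_coef[OF s] by (simp add: kernel_def)
  have c: "hcoef (kernel w) = (\<lambda>n. cnj w ^ n)" using from_coef[OF s] by (simp add: kernel_def)
  show "H.nrm2 (kernel w) = 1 / (1 - (cmod w)\<^sup>2)"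
    unfolding nrm2_eq[OF k] c sq by (rule suminf_geometric[OF w2])
  show "hardy2_inner f (kernel w) = f w" if f: "f \<in> hardy2"
    using hcoef_sums[OF hardy2_holomorphic[OF f] w] by (simp add: hardy2_inner_eq[OF f k] c sums_iff)
qed

text \<open>Bessel's inequality for the reproducing kernel at \<open>w\<close>. It says that any finite orthonormal
  family, however large, has total mass at most \<open>1 / (1 - \<bar>w\<bar>\<^sup>2)\<close> at \<open>w\<close>; this turns an
  integral of \<open>1 / (1 - \<bar>\<phi>\<bar>\<^sup>2)\<close> into a bound on the number of vectors.\<close>

lemma orthonormal_pointwise_bound:
  assumes B: "H.orthonormal B" and w: "cmod w < 1"
  shows "(\<Sum>f\<in>B. (cmod (f w))\<^sup>2) \<le> 1 / (1 - (cmod w)\<^sup>2)"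
proof -
  have "(\<Sum>f\<in>B. (cmod (f w))\<^sup>2) = (\<Sum>f\<in>B. (cmod (hardy2_inner (kernel w) f))\<^sup>2)"
  proof (intro sum.cong refl)
    fix f assume "f \<in> B"
    then have f: "f \<in> hardy2" using B by (auto simp: H.orthonormal_def)
    show "(cmod (f w))\<^sup>2 = (cmod (hardy2_inner (kernel w) f))\<^sup>2"
      using kernel(3)[OF w f] H.ip_cnj[OF f kernel(1)[OF w]] by simp
  qed
  also have "\<dots> \<le> H.nrm2 (kernel w)" by (rule H.bessel[OF B kernel(1)[OF w]])
  finally show ?thesis using kernel(2)[OF w] by simp
qed

section \<open>Adjoints of bounded operators\<close>

definition truncation :: "(complex \<Rightarrow> complex) \<Rightarrow> nat \<Rightarrow> complex \<Rightarrow> complex" where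
  "truncation f N = (\<Sum>n<N. (\<lambda>z. hcoef f n * monomial n z))"

lemma truncation_in: "truncation f N \<in> hardy2"
  unfolding truncation_def by (intro H.V_sum hardy2_scale monomial_in)

lemma hcoef_truncation: "hcoef (truncation f N) n = (if n < N then hcoef f n else 0)"
proof (induction N)
  case 0
  have "truncation f 0 = 0" unfolding truncation_def by (rule sum.neutral) simp
  show ?case unfolding \<open>truncation f 0 = 0\<close> hcoef_zero by simp
next
  case (Suc N)
  have eq: "truncation f (Suc N) = truncation f N + (\<lambda>z. hcoef f N * monomial N z)" by (simp add: truncation_def)
  have "hcoef (truncation f (Suc N)) n = hcoef (truncation f N) n + hcoef f N * hcoef (monomial N) n"
    unfolding eq using truncation_in
    by (subst hcoef_add) (simp_all only: hcoef_scale hardy2_holomorphic hardy2_scale monomial_in)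
  then show ?case using Suc by (simp add: hcoef_monomial less_Suc_eq)
qed

lemma truncation_tendsto:
  assumes f: "f \<in> hardy2"
  shows "(\<lambda>N. H.nrm2 (f - truncation f N)) \<longlonglongrightarrow> 0"
proof -
  let ?a = "\<lambda>n. (cmod (hcoef f n))\<^sup>2"
  have s: "summable ?a" by (rule hardy2_square_summable[OF f])
  have "H.nrm2 (f - truncation f N) = (\<Sum>n. ?a n) - (\<Sum>n<N. ?a n)" for N
  proof -
    have "H.nrm2 (f - truncation f N) = (\<Sum>n. ?a n - (if n \<in> {..<N} then ?a n else 0))"
      using f truncation_in by (subst nrm2_eq) (auto simp: hcoef_diff hcoef_truncation intro!: suminf_cong)
    also have "\<dots> = (\<Sum>n. ?a n) - (\<Sum>n. if n \<in> {..<N} then ?a n else 0)"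
      by (intro suminf_diff[symmetric] s) (auto intro: summable_finite[of "{..<N}"])
    also have "(\<Sum>n. if n \<in> {..<N} then ?a n else 0) = (\<Sum>n<N. ?a n)"
      using sums_If_finite_set[of "{..<N}" ?a] by (simp add: sums_iff)
    finally show ?thesis .
  qed
  moreover have "(\<lambda>N. (\<Sum>n. ?a n) - (\<Sum>n<N. ?a n)) \<longlonglongrightarrow> (\<Sum>n. ?a n) - (\<Sum>n. ?a n)"
    by (intro tendsto_intros summable_LIMSEQ s)
  ultimately show ?thesis by simp
qed

lemma hardy2_linear_in: "\<lbrakk>hardy2_linear T; f \<in> hardy2\<rbrakk> \<Longrightarrow> T f \<in> hardy2"
  by (auto simp: hardy2_linear_def)

lemma hardy2_linear_add: "\<lbrakk>hardy2_linear T; f \<in> hardy2; g \<in> hardy2\<rbrakk> \<Longrightarrow> T (f + g) = T f + T g"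
  by (simp only: hardy2_linear_def)

lemma hardy2_linear_scale: "\<lbrakk>hardy2_linear T; f \<in> hardy2\<rbrakk> \<Longrightarrow> T (\<lambda>z. c * f z) = (\<lambda>z. c * T f z)"
  by (simp only: hardy2_linear_def)

lemma hardy2_linear_diff:
  assumes "hardy2_linear T" "f \<in> hardy2" "g \<in> hardy2"
  shows "T (f - g) = T f - T g"
proof -
  have "T (f - g + g) = T (f - g) + T g" using assms unfolding hardy2_linear_def by (metis H.V_closed(4))
  then show ?thesis by simp
qed

text \<open>The coefficients of the adjoint image of \<open>g\<close> must be the conjugates of the inner products of \<open>T\<close>
  applied to the monomials with \<open>g\<close>. They are square summable because \<open>T\<close> is bounded, and the
  adjoint identity passes from polynomials to the whole space.\<close>

lemma hardy2_adjoint: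
  assumes lin: "hardy2_linear T" and bdd: "\<And>f. f \<in> hardy2 \<Longrightarrow> H.nrm2 (T f) \<le> C * H.nrm2 f"
  shows "hardy2_adjoint T ` hardy2 \<subseteq> hardy2 \<and>
     (\<forall>f\<in>hardy2. \<forall>g\<in>hardy2. hardy2_inner (T f) g = hardy2_inner f (hardy2_adjoint T g))"
proof -
  have Tin: "T f \<in> hardy2" if "f \<in> hardy2" for f using lin that by (rule hardy2_linear_in)
  have expand: "hardy2_inner (T (truncation f N)) g = (\<Sum>n<N. hcoef f n * hardy2_inner (T (monomial n)) g)"
    if g: "g \<in> hardy2" for f g N
  proof (induction N)
    case 0
    have "T 0 = 0" using hardy2_linear_diff[OF lin hardy2_zero hardy2_zero] by simp
    moreover have "truncation f 0 = 0" unfolding truncation_def by (rule sum.neutral) simp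
    ultimately show ?case using H.ip_zero_left[OF g] by (simp only: sum.empty lessThan_0)
  next
    case (Suc N)
    have "truncation f (Suc N) = truncation f N + (\<lambda>z. hcoef f N * monomial N z)" by (simp add: truncation_def)
    then have "T (truncation f (Suc N)) = T (truncation f N) + (\<lambda>z. hcoef f N * T (monomial N) z)"
      using lin truncation_in[of f N] hardy2_scale[OF monomial_in, of "hcoef f N" N] monomial_in[of N]
      unfolding hardy2_linear_def by auto
    then have "hardy2_inner (T (truncation f (Suc N))) g
        = hardy2_inner (T (truncation f N)) g + hcoef f N * hardy2_inner (T (monomial N)) g"
      using g by (simp only: H.ip_add[OF Tin[OF truncation_in] hardy2_scale[OF Tin[OF monomial_in]]]
          H.ip_scale[OF Tin[OF monomial_in]])
    then show ?case using Suc by simp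
  qed
  define S where "S g = from_coef (\<lambda>n. cnj (hardy2_inner (T (monomial n)) g))" for g
  have S: "S g \<in> hardy2" "hcoef (S g) n = cnj (hardy2_inner (T (monomial n)) g)" if g: "g \<in> hardy2" for g n
  proof -
    let ?s = "\<lambda>n. cnj (hardy2_inner (T (monomial n)) g)"
    have part: "(\<Sum>n<N. (cmod (?s n))\<^sup>2) \<le> C * H.nrm2 g" for N
    proof -
      let ?Q = "\<Sum>n<N. (cmod (?s n))\<^sup>2"
      define x where "x = from_coef (\<lambda>n. if n < N then ?s n else 0)"
      have "summable (\<lambda>n. (cmod (if n < N then ?s n else 0))\<^sup>2)" by (rule summable_finite[of "{..<N}"]) auto
      from from_coef[OF this] have x: "x \<in> hardy2" "hcoef x = (\<lambda>n. if n < N then ?s n else 0)"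
        by (simp_all add: x_def)
      have "truncation x N = x" using x by (intro hardy2_eqI truncation_in) (auto simp: hcoef_truncation)
      then have "hardy2_inner (T x) g = (\<Sum>n<N. hcoef x n * hardy2_inner (T (monomial n)) g)"
        using expand[OF g, of x N] by simp
      also have "\<dots> = of_real ?Q"
        unfolding of_real_sum complex_norm_square by (intro sum.cong) (auto simp: x(2) mult.commute)
      finally have "?Q\<^sup>2 = (cmod (hardy2_inner (T x) g))\<^sup>2" by (simp del: of_real_sum)
      also have "\<dots> \<le> H.nrm2 (T x) * H.nrm2 g" using x g Tin by (intro H.cauchy_schwarz) auto
      also have "\<dots> \<le> (C * H.nrm2 x) * H.nrm2 g" using x g by (intro mult_right_mono bdd) auto
      also have "H.nrm2 x = ?Q"
      proof -
        have "(\<lambda>n. (cmod (hcoef x n))\<^sup>2) = (\<lambda>n. if n \<in> {..<N} then (cmod (?s n))\<^sup>2 else 0)"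
          unfolding x(2) by auto
        then show ?thesis
          using sums_If_finite_set[of "{..<N}" "\<lambda>n. (cmod (?s n))\<^sup>2"]
          unfolding nrm2_eq[OF x(1)] sums_iff by (simp only: finite_lessThan)
      qed
      finally have "?Q * ?Q \<le> ?Q * (C * H.nrm2 g)" by (simp add: power2_eq_square mult_ac)
      moreover have "0 \<le> ?Q" by (intro sum_nonneg) auto
      moreover have "0 \<le> C * H.nrm2 g"
        using bdd[OF g] H.nrm2_nonneg[OF Tin[OF g]] by linarith
      ultimately show ?thesis by (cases "?Q = 0") (auto simp: less_le)
    qed
    have "summable (\<lambda>n. (cmod (?s n))\<^sup>2)"
      using part by (intro bounded_imp_summable[of _ "C * H.nrm2 g"]) (auto simp only: lessThan_Suc_atMost[symmetric] zero_le_power2)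
    from from_coef[OF this] show "S g \<in> hardy2" "hcoef (S g) n = ?s n" by (simp_all add: S_def)
  qed
  have "hardy2_inner (T f) g = hardy2_inner f (S g)" if f: "f \<in> hardy2" and g: "g \<in> hardy2" for f g
  proof (rule LIMSEQ_unique)
    have "(\<lambda>N. \<Sum>n<N. hcoef f n * cnj (hcoef (S g) n)) \<longlonglongrightarrow> hardy2_inner f (S g)"
      using summable_LIMSEQ[OF summable_inner[OF f S(1)[OF g]]] hardy2_inner_eq[OF f S(1)[OF g]] by simp
    then show "(\<lambda>N. hardy2_inner (T (truncation f N)) g) \<longlonglongrightarrow> hardy2_inner f (S g)"
      using expand[OF g] S(2)[OF g] by simp
    show "(\<lambda>N. hardy2_inner (T (truncation f N)) g) \<longlonglongrightarrow> hardy2_inner (T f) g"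
    proof (rule Lim_null[THEN iffD2], rule tendsto_norm_zero_cancel)
      have le: "cmod (hardy2_inner (T (truncation f N)) g - hardy2_inner (T f) g)
          \<le> sqrt (C * H.nrm2 (f - truncation f N) * H.nrm2 g)" for N
      proof -
        let ?d = "f - truncation f N"
        have d: "?d \<in> hardy2" using f truncation_in by simp
        have "T ?d = T f - T (truncation f N)" by (rule hardy2_linear_diff[OF lin f truncation_in])
        then have "hardy2_inner (T ?d) g = hardy2_inner (T f) g - hardy2_inner (T (truncation f N)) g"
          using Tin f truncation_in g by (simp add: H.ip_diff)
        then have "cmod (hardy2_inner (T (truncation f N)) g - hardy2_inner (T f) g) = cmod (hardy2_inner (T ?d) g)"
          by (simp add: norm_minus_commute)
        also have "\<dots> \<le> sqrt (C * H.nrm2 ?d * H.nrm2 g)"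
        proof (rule real_le_rsqrt)
          have "(cmod (hardy2_inner (T ?d) g))\<^sup>2 \<le> H.nrm2 (T ?d) * H.nrm2 g"
            using d g Tin by (intro H.cauchy_schwarz) auto
          also have "\<dots> \<le> C * H.nrm2 ?d * H.nrm2 g" using d g by (intro mult_right_mono bdd) auto
          finally show "(cmod (hardy2_inner (T ?d) g))\<^sup>2 \<le> C * H.nrm2 ?d * H.nrm2 g" .
        qed
        finally show ?thesis .
      qed
      have "(\<lambda>N. sqrt (C * H.nrm2 (f - truncation f N) * H.nrm2 g)) \<longlonglongrightarrow> sqrt (C * 0 * H.nrm2 g)"
        by (intro tendsto_intros truncation_tendsto f)
      then have "(\<lambda>N. sqrt (C * H.nrm2 (f - truncation f N) * H.nrm2 g)) \<longlonglongrightarrow> 0" by simp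
      then show "(\<lambda>N. cmod (hardy2_inner (T (truncation f N)) g - hardy2_inner (T f) g)) \<longlonglongrightarrow> 0"
        by (rule tendsto_sandwich[OF _ _ tendsto_const, rotated 2]) (use le in auto)
    qed
  qed
  then have "S ` hardy2 \<subseteq> hardy2 \<and> (\<forall>f\<in>hardy2. \<forall>g\<in>hardy2. hardy2_inner (T f) g = hardy2_inner f (S g))"
    using S(1) by blast
  then show ?thesis
    unfolding hardy2_adjoint_def
    by (rule someI[of "\<lambda>S. S ` hardy2 \<subseteq> hardy2 \<and>
          (\<forall>f\<in>hardy2. \<forall>g\<in>hardy2. hardy2_inner (T f) g = hardy2_inner f (S g))"])
qed

section \<open>Weak compactness of bounded sequences\<close>

text \<open>A diagonal subsequence makes every coefficient converge; the limits are square summable with the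
  same bound, and convergence of coefficients of a bounded sequence is weak convergence.\<close>

lemma hardy2_bounded_sequence_weak_limit:
  fixes f :: "nat \<Rightarrow> complex \<Rightarrow> complex"
  assumes f: "\<And>n. f n \<in> hardy2" and B: "\<And>n. H.nrm2 (f n) \<le> B"
  shows "\<exists>r g. strict_mono r \<and> g \<in> hardy2 \<and> H.nrm2 g \<le> B \<and>
    (\<forall>h\<in>hardy2. (\<lambda>n. hardy2_inner (f (r n) - g) h) \<longlonglongrightarrow> 0)"
proof -
  have B0: "0 \<le> B" using H.nrm2_nonneg[OF f[of 0]] B[of 0] by linarith
  have part: "(\<Sum>k<N. (cmod (hcoef (f n) k))\<^sup>2) \<le> B" for n N
    using sum_le_suminf[OF hardy2_square_summable[OF f], of "{..<N}" n] B[of n] nrm2_eq[OF f[of n]] by simp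
  have "norm (hcoef (f n) k) \<le> sqrt B" if "k \<in> UNIV" for n k
  proof (rule real_le_rsqrt)
    show "(cmod (hcoef (f n) k))\<^sup>2 \<le> B"
      using part[of n "Suc k"] sum_nonneg[of "{..<k}" "\<lambda>k. (cmod (hcoef (f n) k))\<^sup>2"] by simp
  qed
  from function_convergent_subsequence[of UNIV "\<lambda>n. hcoef (f n)" "sqrt B", OF _ this]
  obtain r where r: "strict_mono r" and "\<And>k. \<exists>l. (\<lambda>n. hcoef (f (r n)) k) \<longlonglongrightarrow> l" by auto
  then obtain a where a: "\<And>k. (\<lambda>n. hcoef (f (r n)) k) \<longlonglongrightarrow> a k" by metis
  have aN: "(\<Sum>k<N. (cmod (a k))\<^sup>2) \<le> B" for N
  proof (rule tendsto_upperbound)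
    show "(\<lambda>n. \<Sum>k<N. (cmod (hcoef (f (r n)) k))\<^sup>2) \<longlonglongrightarrow> (\<Sum>k<N. (cmod (a k))\<^sup>2)"
      by (intro tendsto_intros a)
  qed (use part in auto)
  then have sa: "summable (\<lambda>k. (cmod (a k))\<^sup>2)"
    by (intro bounded_imp_summable[of _ B]) (auto simp only: lessThan_Suc_atMost[symmetric] zero_le_power2)
  define g where "g = from_coef a"
  have g: "g \<in> hardy2" "hcoef g = a" using from_coef[OF sa] by (simp_all add: g_def)
  have gB: "H.nrm2 g \<le> B" unfolding nrm2_eq[OF g(1)] g(2) by (intro suminf_le_const sa aN)
  have "(\<lambda>n. hardy2_inner (f (r n) - g) h) \<longlonglongrightarrow> 0" if h: "h \<in> hardy2" for h
  proof (rule LIMSEQ_I)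
    fix e :: real assume e: "0 < e"
    let ?d = "\<lambda>n. f (r n) - g"
    have d: "?d n \<in> hardy2" for n using f g by simp
    have dB: "H.nrm2 (?d n) \<le> 4 * B" for n using H.nrm2_diff_le[OF f g(1), of "r n"] B[of "r n"] gB by linarith
    have "(\<lambda>N. sqrt (4 * B * H.nrm2 (h - truncation h N))) \<longlonglongrightarrow> sqrt (4 * B * 0)"
      by (intro tendsto_intros truncation_tendsto h)
    from order_tendstoD(2)[OF this, of "e / 2"] obtain N where N: "sqrt (4 * B * H.nrm2 (h - truncation h N)) < e / 2"
      using e by (auto simp: eventually_sequentially)
    have split: "cmod (hardy2_inner (?d n) h) \<le> cmod (\<Sum>k<N. cnj (hcoef h k) * hcoef (?d n) k) + sqrt (4 * B * H.nrm2 (h - truncation h N))" for n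
    proof -
      have t: "hardy2_inner (?d n) (truncation h N) = (\<Sum>k<N. cnj (hcoef h k) * hcoef (?d n) k)"
      proof -
        have "hardy2_inner (truncation h N) (?d n) = (\<Sum>k<N. hcoef h k * hardy2_inner (monomial k) (?d n))"
          unfolding truncation_def using d[of n] by (subst H.ip_sum) (auto simp: H.ip_scale)
        moreover have "cnj (hardy2_inner (monomial k) (?d n)) = hcoef (?d n) k" for k
          using H.ip_cnj[OF monomial_in[of k] d[of n]] inner_monomial[OF d[of n], of k] by simp
        ultimately show ?thesis using H.ip_cnj[OF truncation_in[of h N] d[of n]] by simp
      qed
      have "hardy2_inner (?d n) h = hardy2_inner (?d n) (truncation h N) + hardy2_inner (?d n) (h - truncation h N)"
        using d[of n] h truncation_in by (simp add: H.ip_diff_right)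
      then have "cmod (hardy2_inner (?d n) h) \<le> cmod (hardy2_inner (?d n) (truncation h N)) + cmod (hardy2_inner (?d n) (h - truncation h N))"
        by (metis norm_triangle_ineq)
      moreover have "cmod (hardy2_inner (?d n) (h - truncation h N)) \<le> sqrt (4 * B * H.nrm2 (h - truncation h N))"
      proof (rule real_le_rsqrt)
        have ht: "h - truncation h N \<in> hardy2" using h truncation_in by simp
        show "(cmod (hardy2_inner (?d n) (h - truncation h N)))\<^sup>2 \<le> 4 * B * H.nrm2 (h - truncation h N)"
          using H.cauchy_schwarz[OF d ht, of n] mult_right_mono[OF dB[of n] H.nrm2_nonneg[OF ht]] by linarith
      qed
      ultimately show ?thesis using t by simp
    qed
    have "(\<lambda>n. cmod (\<Sum>k<N. cnj (hcoef h k) * hcoef (?d n) k)) \<longlonglongrightarrow> cmod (\<Sum>k<N. cnj (hcoef h k) * (a k - a k))"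
      unfolding hcoef_diff[OF f g(1)] g(2) by (intro tendsto_intros a)
    from order_tendstoD(2)[OF this, of "e / 2"] obtain n0 where
      n0: "\<And>n. n \<ge> n0 \<Longrightarrow> cmod (\<Sum>k<N. cnj (hcoef h k) * hcoef (?d n) k) < e / 2"
      using e by (auto simp: eventually_sequentially)
    have "norm (hardy2_inner (?d n) h - 0) < e" if "n \<ge> n0" for n
      using split[of n] n0[OF that] N by simp
    then show "\<exists>n0. \<forall>n\<ge>n0. norm (hardy2_inner (?d n) h - 0) < e" by blast
  qed
  then show ?thesis using r g(1) gB by blast
qed

lemma counting_imp_compact:
  fixes f :: "nat \<Rightarrow> complex \<Rightarrow> complex"
  assumes lin: "hardy2_linear T" and bdd: "\<And>f. f \<in> hardy2 \<Longrightarrow> H.nrm2 (T f) \<le> C * H.nrm2 f" and "0 \<le> C"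
    and counting: "\<And>\<epsilon>. 0 < \<epsilon> \<Longrightarrow> \<exists>N. \<forall>B. H.orthonormal B \<and> (\<forall>x\<in>B. \<epsilon> \<le> H.nrm2 (T x)) \<longrightarrow> card B \<le> N"
    and f: "\<And>n. f n \<in> hardy2" "\<And>n. H.nrm2 (f n) \<le> B"
  shows "\<exists>r g. strict_mono r \<and> g \<in> hardy2 \<and> (\<lambda>n. H.nrm2 (T (f (r n)) - g)) \<longlonglongrightarrow> 0"
proof -
  obtain r g where r: "strict_mono r" "g \<in> hardy2" "H.nrm2 g \<le> B"
    "\<forall>h\<in>hardy2. (\<lambda>n. hardy2_inner (f (r n) - g) h) \<longlonglongrightarrow> 0"
    using hardy2_bounded_sequence_weak_limit[of f B, OF f] by metis
  have "(\<lambda>n. H.nrm2 (T (f (r n) - g))) \<longlonglongrightarrow> 0"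
  proof (rule H.counting_imp_completely_continuous[where T = T and C = C and D = "4 * B"])
    show "H.nrm2 (f (r n) - g) \<le> 4 * B" for n using H.nrm2_diff_le[OF f(1) r(2), of "r n"] f(2)[of "r n"] r(3) by linarith
    show "f (r n) - g \<in> hardy2" for n using f r by simp
    show "\<exists>N. \<forall>B. H.orthonormal B \<and> (\<forall>x\<in>B. \<epsilon> \<le> H.nrm2 (T x)) \<longrightarrow> card B \<le> N" if "0 < \<epsilon>" for \<epsilon>
      by (rule counting[OF that])
  qed (use \<open>0 \<le> C\<close> in \<open>simp_all only: hardy2_linear_in[OF lin] hardy2_linear_add[OF lin] hardy2_linear_scale[OF lin] bdd r(4)[rule_format]\<close>)
  then have "(\<lambda>n. H.nrm2 (T (f (r n)) - T g)) \<longlonglongrightarrow> 0"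
    using hardy2_linear_diff[OF lin f(1) r(2)] by simp
  then show ?thesis using r hardy2_linear_in[OF lin r(2)] by blast
qed

section \<open>Poisson kernels and subordination\<close>

definition rmean :: "(complex \<Rightarrow> real) \<Rightarrow> real \<Rightarrow> real" where
  "rmean h r = integral {0..2*pi} (\<lambda>t. h (of_real r * cis t)) / (2*pi)"

lemma on_circle [simp]: "0 \<le> r \<Longrightarrow> of_real r * cis t \<in> sphere 0 r"
  by (simp add: norm_mult)

lemma circle_continuous:
  assumes "continuous_on (sphere 0 r) h" "0 \<le> r"
  shows "continuous_on {0..2*pi} (\<lambda>t. h (of_real r * cis t))"
  by (rule continuous_on_compose2[OF assms(1), of _ "\<lambda>t. of_real r * cis t"])
    (use assms(2) in \<open>auto intro!: continuous_intros simp: norm_mult\<close>)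

lemma circle_integrable:
  fixes h :: "complex \<Rightarrow> 'a::banach"
  assumes "continuous_on (sphere 0 r) h" "0 \<le> r"
  shows "(\<lambda>t. h (of_real r * cis t)) integrable_on {0..2*pi}"
  by (rule integrable_continuous_real[OF circle_continuous[OF assms]])

lemma Re_circle_mean:
  assumes "continuous_on (sphere 0 r) h" "0 \<le> r"
  shows "Re (circle_mean h r) = rmean (\<lambda>z. Re (h z)) r"
proof -
  have "circle_mean h r = integral {0..2*pi} (\<lambda>t. h (of_real r * cis t)) / of_real (2*pi)"
    by (simp add: circle_mean_def)
  then show ?thesis
    using integral_linear[OF circle_integrable[OF assms] bounded_linear_Re]
    by (simp only: Re_divide_of_real rmean_def o_def)
qed

lemma rmean_mono:
  assumes "continuous_on (sphere 0 r) g" "continuous_on (sphere 0 r) h" "0 \<le> r"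
    and "\<And>z. z \<in> sphere 0 r \<Longrightarrow> g z \<le> h z"
  shows "rmean g r \<le> rmean h r"
  unfolding rmean_def
  by (intro divide_right_mono integral_le circle_integrable assms on_circle) auto

lemma rmean_add:
  assumes "continuous_on (sphere 0 r) g" "continuous_on (sphere 0 r) h" "0 \<le> r"
  shows "rmean (\<lambda>z. g z + h z) r = rmean g r + rmean h r"
  unfolding rmean_def using assms
  by (subst Henstock_Kurzweil_Integration.integral_add) (auto intro: circle_integrable simp: add_divide_distrib)

lemma rmean_cmult: "rmean (\<lambda>z. c * h z) r = c * rmean h r"
  by (simp add: rmean_def integral_mult_right)

lemma rmean_const [simp]: "rmean (\<lambda>z. c) r = c"
  by (simp add: rmean_def)

lemma rmean_sum:
  assumes "\<And>b. b \<in> B \<Longrightarrow> continuous_on (sphere 0 r) (h b)" "finite B" "0 \<le> r"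
  shows "rmean (\<lambda>z. \<Sum>b\<in>B. h b z) r = (\<Sum>b\<in>B. rmean (h b) r)"
  unfolding rmean_def using assms
  by (subst integral_sum) (auto intro: circle_integrable simp: sum_divide_distrib)

lemma circle_mean_add:
  assumes "continuous_on (sphere 0 r) g" "continuous_on (sphere 0 r) h" "0 \<le> r"
  shows "circle_mean (\<lambda>z. g z + h z) r = circle_mean g r + circle_mean h r"
  unfolding circle_mean_def using assms
  by (subst Henstock_Kurzweil_Integration.integral_add) (auto intro: circle_integrable simp: add_divide_distrib)

lemma circle_mean_cmult: "circle_mean (\<lambda>z. c * h z) r = c * circle_mean h r"
  unfolding circle_mean_def by (simp only: integral_mult_right times_divide_eq_right)

lemma cmod_circle_mean_le:
  assumes "continuous_on (sphere 0 r) h" "0 \<le> r"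
  shows "cmod (circle_mean h r) \<le> rmean (\<lambda>z. cmod (h z)) r"
proof -
  have "cmod (integral {0..2*pi} (\<lambda>t. h (of_real r * cis t))) \<le> integral {0..2*pi} (\<lambda>t. cmod (h (of_real r * cis t)))"
    using assms by (intro integral_norm_bound_integral circle_integrable continuous_intros) auto
  then show ?thesis
    by (simp add: circle_mean_def rmean_def norm_divide norm_mult divide_right_mono)
qed

lemma circle_mean_holomorphic':
  assumes f: "f holomorphic_on ball 0 R" and r: "0 \<le> r" "r < R"
  shows "circle_mean f r = f 0"
proof -
  have R: "0 < R" using r by simp
  have "(\<lambda>z. f (of_real R * z)) holomorphic_on ball 0 1"
    by (rule holomorphic_on_compose_gen[OF _ f, unfolded o_def])
      (use R in \<open>auto intro!: holomorphic_intros simp: norm_mult\<close>)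
  from circle_mean_holomorphic[OF this, of "r / R"] R r
  show ?thesis by (simp add: circle_mean_def)
qed

text \<open>The Poisson kernel of the disc of radius \<open>r\<close>, for \<open>w\<close> inside the disc and \<open>z\<close> on its boundary
  circle.\<close>

definition poisson :: "real \<Rightarrow> complex \<Rightarrow> complex \<Rightarrow> real" where
  "poisson r w z = (r\<^sup>2 - (cmod w)\<^sup>2) / (cmod (z - w))\<^sup>2"

lemma poisson_Re:
  assumes "cmod z = r" "z \<noteq> w"
  shows "poisson r w z = Re ((z + w) / (z - w))"
proof -
  have "Re ((z + w) / (z - w)) = Re ((z + w) * cnj (z - w)) / (cmod (z - w))\<^sup>2"
    by (simp add: complex_div_cnj[of "z + w"] Re_divide_of_real)
  also have "Re ((z + w) * cnj (z - w)) = (cmod z)\<^sup>2 - (cmod w)\<^sup>2"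
    unfolding cmod_power2 by (simp add: algebra_simps power2_eq_square)
  finally show ?thesis using assms by (simp add: poisson_def)
qed

lemma poisson_nonneg: "cmod w < r \<Longrightarrow> 0 \<le> poisson r w z"
  by (auto simp: poisson_def intro!: divide_nonneg_nonneg power_mono)

lemma poisson_continuous:
  assumes "cmod w < r"
  shows "continuous_on (sphere 0 r) (poisson r w)"
  unfolding poisson_def using assms by (intro continuous_intros) auto

text \<open>The kernel is the sum of the Cauchy kernel and a function that is holomorphic in \<open>z\<close> and
  vanishes at \<open>0\<close>, which is why it reproduces holomorphic functions.\<close>

lemma poisson_split:
  assumes "cmod z = r" "cmod w < r"
  shows "of_real (poisson r w z) = z / (z - w) + cnj w * z / (of_real (r\<^sup>2) - cnj w * z)"
proof -
  have zz: "z * cnj z = of_real (r\<^sup>2)" using assms complex_norm_square[of z] by simp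
  have ww: "w * cnj w = of_real ((cmod w)\<^sup>2)" using complex_norm_square[of w] by simp
  have zw: "z \<noteq> w" and z0: "z \<noteq> 0" using assms by auto
  have cz: "cnj z - cnj w \<noteq> 0" using zw by (simp flip: complex_cnj_diff)
  have "of_real (r\<^sup>2) - cnj w * z = z * (cnj z - cnj w)" using zz by (simp add: algebra_simps)
  then have "cnj w * z / (of_real (r\<^sup>2) - cnj w * z) = cnj w / (cnj z - cnj w)" using z0 by simp
  moreover have "z / (z - w) + cnj w / (cnj z - cnj w) = (z * cnj z - w * cnj w) / ((z - w) * (cnj z - cnj w))"
  proof -
    have "z - w \<noteq> 0" using zw by simp
    show ?thesis unfolding add_frac_eq[OF \<open>z - w \<noteq> 0\<close> cz] by (simp add: algebra_simps)
  qed
  moreover have "(z - w) * (cnj z - cnj w) = of_real ((cmod (z - w))\<^sup>2)"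
    using complex_norm_square[of "z - w"] by simp
  ultimately show ?thesis by (simp add: poisson_def zz ww)
qed

lemma cnj_circle_mean: "cnj (circle_mean h r) = circle_mean (\<lambda>z. cnj (h z)) r"
  by (simp add: circle_mean_def integral_cnj)

theorem poisson_formula:
  assumes f: "f holomorphic_on ball 0 R" and r: "r < R" and w: "cmod w < r"
  shows "circle_mean (\<lambda>z. of_real (poisson r w z) * f z) r = f w"
proof -
  have r0: "0 < r" using w norm_ge_zero[of w] by linarith
  have sub: "sphere 0 r \<subseteq> ball (0::complex) R" using r by auto
  \<comment> \<open>The pole of the second summand lies at distance \<open>r\<^sup>2 / \<bar>w\<bar> > r\<close> from \<open>0\<close>.\<close>
  define R' where "R' = (if w = 0 then R else min R (r\<^sup>2 / cmod w))"
  have R': "r < R'" "R' \<le> R"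
    using r w r0 by (auto simp: R'_def power2_eq_square field_simps)
  have nz: "of_real (r\<^sup>2) - cnj w * z \<noteq> 0" if z: "z \<in> ball 0 R'" for z
  proof
    assume "of_real (r\<^sup>2) - cnj w * z = 0"
    then have eq: "of_real (r\<^sup>2) = cnj w * z" by simp
    have "r\<^sup>2 = cmod w * cmod z" using arg_cong[OF eq, of cmod] by (simp add: norm_mult norm_power)
    moreover have "cmod w * cmod z < r\<^sup>2"
      using z w r0 by (cases "w = 0") (auto simp: R'_def field_simps)
    ultimately show False by simp
  qed
  define g where "g z = (if z = w then deriv f w else (f z - f w) / (z - w))" for z
  have g: "g holomorphic_on ball 0 R" unfolding g_def by (rule pole_lemma_open[OF f open_ball])
  define h1 where "h1 z = z * g z + cnj w * z / (of_real (r\<^sup>2) - cnj w * z) * f z" for z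
  have h1: "h1 holomorphic_on ball 0 R'"
    unfolding h1_def using nz R' by (intro holomorphic_intros holomorphic_on_subset[OF g] holomorphic_on_subset[OF f]) auto
  have h2: "(\<lambda>z. of_real (r\<^sup>2) / (of_real (r\<^sup>2) - cnj w * z)) holomorphic_on ball 0 R'"
    using nz by (intro holomorphic_intros) auto
  have "circle_mean (\<lambda>z. z / (z - w)) r = cnj (circle_mean (\<lambda>z. of_real (r\<^sup>2) / (of_real (r\<^sup>2) - cnj w * z)) r)"
    unfolding cnj_circle_mean
    unfolding circle_mean_def
  proof (intro arg_cong2[where f = "(/)"] integral_cong refl)
    fix t
    let ?z = "of_real r * cis t"
    have z: "cmod ?z = r" using r0 by (simp add: norm_mult)
    then have zz: "?z * cnj ?z = of_real (r\<^sup>2)" using complex_norm_square[of ?z] by simp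
    have "?z \<noteq> 0" using r0 by simp
    have "cnj (of_real (r\<^sup>2) / (of_real (r\<^sup>2) - cnj w * ?z)) = of_real (r\<^sup>2) / (of_real (r\<^sup>2) - w * cnj ?z)" by simp
    also have "\<dots> = (cnj ?z * ?z) / (cnj ?z * (?z - w))" using zz by (simp add: algebra_simps)
    also have "\<dots> = ?z / (?z - w)" using \<open>?z \<noteq> 0\<close> by (subst mult_divide_mult_cancel_left) auto
    finally show "?z / (?z - w) = cnj (of_real (r\<^sup>2) / (of_real (r\<^sup>2) - cnj w * ?z))" by simp
  qed
  also have "\<dots> = 1" using circle_mean_holomorphic'[OF h2, of r] r0 R' by simp
  finally have m: "circle_mean (\<lambda>z. z / (z - w)) r = 1" .
  have h1m: "circle_mean h1 r = 0" using circle_mean_holomorphic'[OF h1, of r] r0 R' by (simp add: h1_def)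
  have "circle_mean (\<lambda>z. of_real (poisson r w z) * f z) r = circle_mean (\<lambda>z. h1 z + f w * (z / (z - w))) r"
    unfolding circle_mean_def
  proof (intro arg_cong2[where f = "(/)"] integral_cong refl)
    fix t
    let ?z = "of_real r * cis t"
    have z: "cmod ?z = r" using r0 by (simp add: norm_mult)
    then have zw: "?z \<noteq> w" using w by auto
    then have "f ?z * (?z / (?z - w)) = ?z * g ?z + f w * (?z / (?z - w))"
      by (simp add: g_def diff_divide_distrib algebra_simps add_divide_distrib)
    then show "of_real (poisson r w ?z) * f ?z = h1 ?z + f w * (?z / (?z - w))"
      unfolding poisson_split[OF z w] h1_def by (simp add: algebra_simps)
  qed
  also have "\<dots> = circle_mean h1 r + f w * circle_mean (\<lambda>z. z / (z - w)) r"
  proof -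
    have "continuous_on (sphere 0 r) h1"
      using h1 R' by (intro holomorphic_on_imp_continuous_on holomorphic_on_subset[OF h1]) auto
    moreover have "continuous_on (sphere 0 r) (\<lambda>z. f w * (z / (z - w)))"
      using w by (intro continuous_intros) auto
    ultimately show ?thesis using r0 by (simp only: circle_mean_add[OF _ _ less_imp_le] circle_mean_cmult)
  qed
  finally show ?thesis using m h1m by simp
qed

lemma rmean_poisson_Re:
  assumes f: "f holomorphic_on ball 0 R" and r: "r < R" and w: "cmod w < r"
  shows "rmean (\<lambda>z. poisson r w z * Re (f z)) r = Re (f w)"
proof -
  have c: "continuous_on (sphere 0 r) (\<lambda>z. of_real (poisson r w z) * f z)"
    using f w r by (intro continuous_intros poisson_continuous holomorphic_on_imp_continuous_on holomorphic_on_subset[OF f]) auto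
  have "0 \<le> r" using w norm_ge_zero[of w] by linarith
  from Re_circle_mean[OF c this] poisson_formula[OF assms] show ?thesis by simp
qed

text \<open>Subharmonicity of \<open>\<bar>f\<bar>\<^sup>2\<close>, obtained from the Poisson formula for the holomorphic function \<open>f\<^sup>2\<close>.\<close>

lemma square_le_poisson_mean:
  assumes f: "f holomorphic_on ball 0 R" and r: "r < R" and w: "cmod w < r"
  shows "(cmod (f w))\<^sup>2 \<le> rmean (\<lambda>z. poisson r w z * (cmod (f z))\<^sup>2) r"
proof -
  have f2: "(\<lambda>z. (f z)\<^sup>2) holomorphic_on ball 0 R" using f by (intro holomorphic_intros)
  have c: "continuous_on (sphere 0 r) (\<lambda>z. of_real (poisson r w z) * (f z)\<^sup>2)"
    using f w r by (intro continuous_intros poisson_continuous holomorphic_on_imp_continuous_on holomorphic_on_subset[OF f]) auto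
  have r0: "0 \<le> r" using w norm_ge_zero[of w] by linarith
  have "(cmod (f w))\<^sup>2 = cmod (circle_mean (\<lambda>z. of_real (poisson r w z) * (f z)\<^sup>2) r)"
    using poisson_formula[OF f2 r w] by (simp add: norm_power)
  also have "\<dots> \<le> rmean (\<lambda>z. cmod (of_real (poisson r w z) * (f z)\<^sup>2)) r"
    by (rule cmod_circle_mean_le[OF c r0])
  finally show ?thesis using poisson_nonneg[OF w] by (simp add: norm_mult norm_power)
qed

lemma poisson_le:
  assumes "cmod w < r" "cmod z = r"
  shows "poisson r w z \<le> (r + cmod w) / (r - cmod w)"
proof -
  have "r - cmod w \<le> cmod (z - w)" using assms norm_triangle_ineq2[of z w] by simp
  then have "(r - cmod w)\<^sup>2 \<le> (cmod (z - w))\<^sup>2" using assms by (intro power_mono) auto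
  then have "poisson r w z \<le> (r\<^sup>2 - (cmod w)\<^sup>2) / (r - cmod w)\<^sup>2"
    unfolding poisson_def using assms by (intro divide_left_mono) (auto intro!: power_mono mult_pos_pos zero_less_power)
  also have "\<dots> = (r + cmod w) / (r - cmod w)"
  proof -
    have "r\<^sup>2 - (cmod w)\<^sup>2 = (r + cmod w) * (r - cmod w)" by (simp add: power2_eq_square algebra_simps)
    moreover have "r - cmod w \<noteq> 0" using assms by simp
    ultimately show ?thesis by (simp add: power2_eq_square)
  qed
  finally show ?thesis .
qed

text \<open>A form of Littlewood's subordination principle that keeps track of the base point. By
  subharmonicity \<open>\<bar>f\<bar>\<^sup>2\<close> is dominated by the Poisson integral of its values on a circle of radius
  \<open>\<rho>\<close> near \<open>1\<close>. Composed with \<open>\<phi>\<close> this majorant is still harmonic, so its Poisson mean with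
  respect to \<open>w\<close> is its value at \<open>\<phi> w\<close>, and the kernel there is at most
  \<open>(\<rho> + \<bar>\<phi> w\<bar>) / (\<rho> - \<bar>\<phi> w\<bar>)\<close>. With \<open>w = 0\<close> this is boundedness of the composition
  operator; with \<open>w\<close> close to the circle it is a Carleson estimate on a small arc.\<close>

theorem poisson_mean_composition_le:
  assumes f: "f \<in> hardy2" and \<phi>: "\<phi> holomorphic_on ball 0 1" "\<phi> ` ball 0 1 \<subseteq> ball 0 1"
    and r: "r < 1" and w: "cmod w < r"
  shows "rmean (\<lambda>z. poisson r w z * (cmod (f (\<phi> z)))\<^sup>2) r
          \<le> (1 + cmod (\<phi> w)) / (1 - cmod (\<phi> w)) * H.nrm2 f"
proof -
  have r0: "0 < r" using w norm_ge_zero[of w] by linarith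
  define R where "R = (r + 1) / 2"
  have R: "r < R" "R < 1" using r by (auto simp: R_def)
  have cb: "cball 0 R \<subseteq> ball (0::complex) 1" using R by auto
  note fh = hardy2_holomorphic[OF f]
  have c\<phi>: "continuous_on (cball 0 R) \<phi>"
    using \<phi> cb holomorphic_on_imp_continuous_on holomorphic_on_subset by blast
  have "compact (\<phi> ` cball 0 R)" using c\<phi> by (intro compact_continuous_image) auto
  moreover have "\<phi> ` cball 0 R \<noteq> {}" using R r0 by auto
  ultimately obtain u where u: "u \<in> \<phi> ` cball 0 R" "\<And>v. v \<in> \<phi> ` cball 0 R \<Longrightarrow> cmod v \<le> cmod u"
    using continuous_attains_sup[of "\<phi> ` cball 0 R" cmod] continuous_on_norm_id by blast
  define M where "M = cmod u"
  have "u \<in> ball 0 1" using image_mono[OF cb, of \<phi>] \<phi>(2) u(1) by blast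
  then have M: "M < 1" "0 \<le> M" by (simp_all add: M_def)
  have \<phi>M: "cmod (\<phi> z) \<le> M" if "cmod z \<le> R" for z using u(2)[of "\<phi> z"] that by (auto simp: M_def)
  have bM: "cmod (\<phi> w) \<le> M" using \<phi>M[of w] w R by simp
  have main: "rmean (\<lambda>z. poisson r w z * (cmod (f (\<phi> z)))\<^sup>2) r
      \<le> (\<rho> + cmod (\<phi> w)) / (\<rho> - cmod (\<phi> w)) * H.nrm2 f" if \<rho>: "M < \<rho>" "\<rho> < 1" for \<rho>
  proof -
    have \<rho>0: "0 < \<rho>" using \<rho> M by linarith
    let ?z = "\<lambda>t. of_real r * cis t" and ?x = "\<lambda>s. of_real \<rho> * cis s"
    have zr: "cmod (?z t) = r" and xr: "cmod (?x t) = \<rho>" for t using r0 \<rho>0 by (simp_all add: norm_mult)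
    have \<phi>z: "cmod (\<phi> (?z t)) < \<rho>" for t using \<phi>M[of "?z t"] zr[of t] R \<rho> by simp
    have cf: "continuous_on (sphere 0 \<rho>) f"
      using \<rho> by (intro holomorphic_on_imp_continuous_on holomorphic_on_subset[OF fh]) auto
    have cfx: "continuous_on UNIV (\<lambda>s. f (?x s))"
      by (rule continuous_on_compose2[OF cf, of _ ?x]) (use xr in \<open>auto intro!: continuous_intros\<close>)
    have cpz: "continuous_on UNIV (\<lambda>t. \<phi> (?z t))"
      by (rule continuous_on_compose2[OF c\<phi>, of _ ?z]) (use zr R in \<open>auto intro!: continuous_intros\<close>)
    let ?K = "\<lambda>t s. poisson r w (?z t) * (poisson \<rho> (\<phi> (?z t)) (?x s) * (cmod (f (?x s)))\<^sup>2)"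
    have cp1: "continuous_on UNIV (\<lambda>t. poisson r w (?z t))"
      by (rule continuous_on_compose2[OF poisson_continuous[OF w], of _ ?z]) (use zr in \<open>auto intro!: continuous_intros\<close>)
    have cK: "continuous_on UNIV (\<lambda>(t, s). ?K t s)"
    proof -
      have "cmod (?x s - \<phi> (?z t)) \<noteq> 0" for s t
        using \<phi>z[of t] xr[of s] by auto
      then show ?thesis unfolding poisson_def[of \<rho>] case_prod_unfold
        by (intro continuous_intros continuous_on_compose2[OF cp1] continuous_on_compose2[OF cpz] continuous_on_compose2[OF cfx]) auto
    qed
    have "rmean (\<lambda>z. poisson r w z * (cmod (f (\<phi> z)))\<^sup>2) r
        \<le> rmean (\<lambda>z. poisson r w z * rmean (\<lambda>x. poisson \<rho> (\<phi> z) x * (cmod (f x))\<^sup>2) \<rho>) r"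
      unfolding rmean_def[of _ r]
    proof (intro divide_right_mono integral_le)
      show "(\<lambda>t. poisson r w (?z t) * (cmod (f (\<phi> (?z t))))\<^sup>2) integrable_on {0..2*pi}"
      proof (intro integrable_continuous_real continuous_intros continuous_on_subset[OF cp1])
        show "continuous_on {0..2*pi} (\<lambda>t. f (\<phi> (?z t)))"
          by (rule continuous_on_compose2[OF holomorphic_on_imp_continuous_on[OF fh] continuous_on_subset[OF cpz]])
            (use less_trans[OF \<phi>z \<rho>(2)] in auto)
      qed auto
      have "continuous_on (cbox 0 (2*pi)) (\<lambda>t. integral (cbox 0 (2*pi)) (?K t))"
        by (rule integral_continuous_on_param) (rule continuous_on_subset[OF cK], auto)
      then show "(\<lambda>t. poisson r w (?z t) * rmean (\<lambda>x. poisson \<rho> (\<phi> (?z t)) x * (cmod (f x))\<^sup>2) \<rho>) integrable_on {0..2*pi}"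
        unfolding rmean_def by (simp add: integrable_continuous_real integrable_divide flip: integral_mult_right)
      fix t
      show "poisson r w (?z t) * (cmod (f (\<phi> (?z t))))\<^sup>2
          \<le> poisson r w (?z t) * rmean (\<lambda>x. poisson \<rho> (\<phi> (?z t)) x * (cmod (f x))\<^sup>2) \<rho>"
        by (intro mult_left_mono square_le_poisson_mean[OF fh \<rho>(2) \<phi>z] poisson_nonneg w)
    qed simp
    also have "\<dots> = integral {0..2*pi} (\<lambda>t. integral {0..2*pi} (?K t)) / (2*pi) / (2*pi)"
      unfolding rmean_def by (simp flip: integral_mult_right)
    also have "integral {0..2*pi} (\<lambda>t. integral {0..2*pi} (?K t)) = integral {0..2*pi} (\<lambda>s. integral {0..2*pi} (\<lambda>t. ?K t s))"
    proof -
      have "continuous_on (cbox (0, 0) (2*pi, 2*pi)) (\<lambda>(t, s). ?K t s)"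
        by (rule continuous_on_subset[OF cK]) auto
      from integral_swap_continuous[OF this] show ?thesis by simp
    qed
    also have "\<dots> = integral {0..2*pi} (\<lambda>s. (cmod (f (?x s)))\<^sup>2 * (2*pi * poisson \<rho> (\<phi> w) (?x s)))"
    proof (intro integral_cong)
      fix s
      let ?q = "\<lambda>z. (?x s + \<phi> z) / (?x s - \<phi> z)"
      have ne: "?x s \<noteq> \<phi> z" if "cmod z \<le> R" for z using \<phi>M[OF that] xr[of s] \<rho> by auto
      have q: "?q holomorphic_on ball 0 R"
        using ne R by (intro holomorphic_intros holomorphic_on_subset[OF \<phi>(1)]) auto
      have "rmean (\<lambda>z. poisson r w z * Re (?q z)) r = Re (?q w)"
        by (rule rmean_poisson_Re[OF q R(1) w])
      also have "Re (?q w) = poisson \<rho> (\<phi> w) (?x s)"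
        using ne[of w] w R by (intro poisson_Re[symmetric] xr) auto
      finally have "integral {0..2*pi} (\<lambda>t. poisson r w (?z t) * Re (?q (?z t))) = 2*pi * poisson \<rho> (\<phi> w) (?x s)"
        unfolding rmean_def by (simp add: field_simps)
      moreover have "Re (?q (?z t)) = poisson \<rho> (\<phi> (?z t)) (?x s)" for t
        using ne[of "?z t"] zr[of t] R by (intro poisson_Re[symmetric] xr) auto
      ultimately have eq: "integral {0..2*pi} (\<lambda>t. poisson r w (?z t) * poisson \<rho> (\<phi> (?z t)) (?x s)) = 2*pi * poisson \<rho> (\<phi> w) (?x s)"
        by simp
      have "integral {0..2*pi} (\<lambda>t. ?K t s) = integral {0..2*pi} (\<lambda>t. (cmod (f (?x s)))\<^sup>2 * (poisson r w (?z t) * poisson \<rho> (\<phi> (?z t)) (?x s)))"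
        by (simp add: mult_ac)
      then show "integral {0..2*pi} (\<lambda>t. ?K t s) = (cmod (f (?x s)))\<^sup>2 * (2*pi * poisson \<rho> (\<phi> w) (?x s))"
        using eq by simp
    qed
    also have "\<dots> / (2*pi) / (2*pi) = rmean (\<lambda>x. (cmod (f x))\<^sup>2 * poisson \<rho> (\<phi> w) x) \<rho>"
      unfolding rmean_def by (simp add: mult.left_commute[of _ "2*pi"])
    also have "\<dots> \<le> rmean (\<lambda>x. (\<rho> + cmod (\<phi> w)) / (\<rho> - cmod (\<phi> w)) * (cmod (f x))\<^sup>2) \<rho>"
    proof (rule rmean_mono)
      have b: "cmod (\<phi> w) < \<rho>" using bM \<rho> by simp
      show "continuous_on (sphere 0 \<rho>) (\<lambda>x. (cmod (f x))\<^sup>2 * poisson \<rho> (\<phi> w) x)"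
        by (intro continuous_intros cf poisson_continuous b)
      show "(cmod (f z))\<^sup>2 * poisson \<rho> (\<phi> w) z \<le> (\<rho> + cmod (\<phi> w)) / (\<rho> - cmod (\<phi> w)) * (cmod (f z))\<^sup>2"
        if "z \<in> sphere 0 \<rho>" for z
        using mult_right_mono[OF poisson_le[OF b, of z], of "(cmod (f z))\<^sup>2"] that by (simp add: mult.commute)
    qed (use cf \<rho>0 bM \<rho> in \<open>auto intro!: continuous_intros\<close>)
    also have "\<dots> = (\<rho> + cmod (\<phi> w)) / (\<rho> - cmod (\<phi> w)) * rmean (\<lambda>x. (cmod (f x))\<^sup>2) \<rho>" by (rule rmean_cmult)
    also have "\<dots> \<le> (\<rho> + cmod (\<phi> w)) / (\<rho> - cmod (\<phi> w)) * H.nrm2 f"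
    proof (rule mult_left_mono)
      show "rmean (\<lambda>x. (cmod (f x))\<^sup>2) \<rho> \<le> H.nrm2 f"
        using circle_mean_le_coefficients[OF fh hardy2_square_summable[OF f], of \<rho>] \<rho> \<rho>0
          Re_circle_mean[of \<rho> "\<lambda>z. of_real ((cmod (f z))\<^sup>2)"] cf nrm2_eq[OF f]
        by (simp add: continuous_intros)
      show "0 \<le> (\<rho> + cmod (\<phi> w)) / (\<rho> - cmod (\<phi> w))" using \<rho> bM \<rho>0 by (intro divide_nonneg_nonneg) auto
    qed
    finally show ?thesis .
  qed
  have lim: "((\<lambda>\<rho>. (\<rho> + cmod (\<phi> w)) / (\<rho> - cmod (\<phi> w)) * H.nrm2 f) \<longlongrightarrow>
      (1 + cmod (\<phi> w)) / (1 - cmod (\<phi> w)) * H.nrm2 f) (at_left 1)"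
    using bM M by (intro tendsto_intros) auto
  show ?thesis
    by (rule tendsto_lowerbound[OF lim]) (use eventually_at_left_real[OF M(1)] main in \<open>auto elim: eventually_mono\<close>)
qed

section \<open>Composition operators\<close>

lemma hardy2_norm_mean_le:
  assumes f: "f \<in> hardy2" and r: "0 \<le> r" "r < 1"
  shows "rmean (\<lambda>z. (cmod (f z))\<^sup>2) r \<le> H.nrm2 f"
proof -
  have "continuous_on (sphere 0 r) f"
    using r by (intro holomorphic_on_imp_continuous_on holomorphic_on_subset[OF hardy2_holomorphic[OF f]]) auto
  then show ?thesis
    using circle_mean_le_coefficients[OF hardy2_holomorphic[OF f] hardy2_square_summable[OF f] r] r
      Re_circle_mean[of r "\<lambda>z. of_real ((cmod (f z))\<^sup>2)"] nrm2_eq[OF f]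
    by (simp add: continuous_intros)
qed

lemma hardy2_norm_mean_tendsto:
  assumes f: "f \<in> hardy2"
  shows "((\<lambda>r. rmean (\<lambda>z. (cmod (f z))\<^sup>2) r) \<longlongrightarrow> H.nrm2 f) (at_left 1)"
proof -
  have A: "((\<lambda>r. Re (circle_mean (\<lambda>z. f z * cnj (f z)) r)) \<longlongrightarrow> Re (\<Sum>n. hcoef f n * cnj (hcoef f n))) (at_left 1)"
    by (intro tendsto_Re hardy2_inner_limit f)
  have B: "Re (\<Sum>n. hcoef f n * cnj (hcoef f n)) = H.nrm2 f"
    by (simp add: H.nrm2_def hardy2_inner_eq f)
  have C: "\<forall>\<^sub>F r in at_left 1. Re (circle_mean (\<lambda>z. f z * cnj (f z)) r) = rmean (\<lambda>z. (cmod (f z))\<^sup>2) r"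
    using eventually_at_left_real[of 0 1]
  proof (rule eventually_mono)
    fix r :: real assume r: "r \<in> {0<..<1}"
    then have "continuous_on (sphere 0 r) f"
      by (intro holomorphic_on_imp_continuous_on holomorphic_on_subset[OF hardy2_holomorphic[OF f]]) auto
    then show "Re (circle_mean (\<lambda>z. f z * cnj (f z)) r) = rmean (\<lambda>z. (cmod (f z))\<^sup>2) r"
      unfolding complex_norm_square[symmetric] using r
      by (subst Re_circle_mean) (auto intro!: continuous_intros)
  qed simp
  show ?thesis using Lim_transform_eventually[OF A C] unfolding B .
qed

context
  fixes \<phi> :: "complex \<Rightarrow> complex"
  assumes \<phi>: "\<phi> holomorphic_on ball 0 1" "\<phi> ` ball 0 1 \<subseteq> ball 0 1"
begin

lemma composition_mean_bound:
  assumes f: "f \<in> hardy2" and r: "0 \<le> r" "r < 1"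
  shows "rmean (\<lambda>z. (cmod (f (\<phi> z)))\<^sup>2) r \<le> (1 + cmod (\<phi> 0)) / (1 - cmod (\<phi> 0)) * H.nrm2 f"
proof -
  have \<phi>0: "cmod (\<phi> 0) < 1" using \<phi>(2) by (auto simp: image_subset_iff)
  show ?thesis
  proof (cases "r = 0")
    case True
    have "(cmod (f (\<phi> 0)))\<^sup>2 \<le> rmean (\<lambda>z. poisson (1/2) 0 z * (cmod (f (\<phi> z)))\<^sup>2) (1/2)"
      by (rule square_le_poisson_mean[of _ 1])
        (use \<phi> in \<open>auto intro!: holomorphic_on_compose_gen[OF \<phi>(1) hardy2_holomorphic[OF f], unfolded o_def]\<close>)
    also have "\<dots> \<le> (1 + cmod (\<phi> 0)) / (1 - cmod (\<phi> 0)) * H.nrm2 f"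
      by (rule poisson_mean_composition_le[OF f \<phi>]) auto
    finally show ?thesis using True by (simp add: rmean_def)
  next
    case False
    then have "rmean (\<lambda>z. poisson r 0 z * (cmod (f (\<phi> z)))\<^sup>2) r = rmean (\<lambda>z. (cmod (f (\<phi> z)))\<^sup>2) r"
      unfolding rmean_def poisson_def using r by (simp add: norm_mult)
    then show ?thesis using poisson_mean_composition_le[OF f \<phi>, of r 0] False r by simp
  qed
qed

lemma composition_op_in:
  assumes f: "f \<in> hardy2"
  shows "composition_op \<phi> f \<in> hardy2"
    and "H.nrm2 (composition_op \<phi> f) \<le> (1 + cmod (\<phi> 0)) / (1 - cmod (\<phi> 0)) * H.nrm2 f"
proof -
  let ?g = "composition_op \<phi> f" and ?B = "(1 + cmod (\<phi> 0)) / (1 - cmod (\<phi> 0)) * H.nrm2 f"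
  have "(\<lambda>z. f (\<phi> z)) holomorphic_on ball 0 1"
    by (rule holomorphic_on_compose_gen[OF \<phi>(1) hardy2_holomorphic[OF f] \<phi>(2), unfolded o_def])
  then have gh: "?g holomorphic_on ball 0 1"
    by (rule holomorphic_transform) (simp add: composition_op_def)
  have means: "Re (circle_mean (\<lambda>z. of_real ((cmod (?g z))\<^sup>2)) r) \<le> ?B" if r: "0 \<le> r" "r < 1" for r
  proof -
    have "continuous_on (sphere 0 r) ?g"
      using r by (intro holomorphic_on_imp_continuous_on holomorphic_on_subset[OF gh]) auto
    then have "Re (circle_mean (\<lambda>z. of_real ((cmod (?g z))\<^sup>2)) r) = rmean (\<lambda>z. (cmod (?g z))\<^sup>2) r"
      using r by (subst Re_circle_mean) (auto intro!: continuous_intros)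
    also have "\<dots> = rmean (\<lambda>z. (cmod (f (\<phi> z)))\<^sup>2) r"
      unfolding rmean_def using r by (simp add: composition_op_def norm_mult)
    finally show ?thesis using composition_mean_bound[OF f r] by simp
  qed
  note sq = square_summable_if_means_bounded[OF gh means]
  show g: "?g \<in> hardy2" unfolding hardy2_iff using gh sq by (auto simp: composition_op_def)
  show "H.nrm2 ?g \<le> ?B" using sq(2) nrm2_eq[OF g] by simp
qed

lemma composition_op_linear: "hardy2_linear (composition_op \<phi>)"
  unfolding hardy2_linear_def using composition_op_in(1)
  by (auto simp: composition_op_def fun_eq_iff)

lemma composition_op_mean_tendsto:
  assumes f: "f \<in> hardy2"
  shows "((\<lambda>r. rmean (\<lambda>z. (cmod (f (\<phi> z)))\<^sup>2) r) \<longlongrightarrow> H.nrm2 (composition_op \<phi> f)) (at_left 1)"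
    and "0 \<le> r \<Longrightarrow> r < 1 \<Longrightarrow> rmean (\<lambda>z. (cmod (f (\<phi> z)))\<^sup>2) r \<le> H.nrm2 (composition_op \<phi> f)"
proof -
  have eq: "rmean (\<lambda>z. (cmod (composition_op \<phi> f z))\<^sup>2) r = rmean (\<lambda>z. (cmod (f (\<phi> z)))\<^sup>2) r"
    if "0 \<le> r" "r < 1" for r
    unfolding rmean_def using that by (simp add: composition_op_def norm_mult)
  show "0 \<le> r \<Longrightarrow> r < 1 \<Longrightarrow> rmean (\<lambda>z. (cmod (f (\<phi> z)))\<^sup>2) r \<le> H.nrm2 (composition_op \<phi> f)"
    using hardy2_norm_mean_le[OF composition_op_in(1)[OF f]] eq by metis
  have "\<forall>\<^sub>F r in at_left 1. rmean (\<lambda>z. (cmod (composition_op \<phi> f z))\<^sup>2) r = rmean (\<lambda>z. (cmod (f (\<phi> z)))\<^sup>2) r"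
    using eventually_at_left_real[of 0 1] by (rule eventually_mono) (use eq in auto)
  with hardy2_norm_mean_tendsto[OF composition_op_in(1)[OF f]]
  show "((\<lambda>r. rmean (\<lambda>z. (cmod (f (\<phi> z)))\<^sup>2) r) \<longlongrightarrow> H.nrm2 (composition_op \<phi> f)) (at_left 1)"
    by (rule Lim_transform_eventually)
qed

end

section \<open>Schatten class membership by counting\<close>

lemma hardy2_compact_adjoint_pair:
  assumes lin: "hardy2_linear T" and bdd: "\<And>f. f \<in> hardy2 \<Longrightarrow> H.nrm2 (T f) \<le> C * H.nrm2 f" and C: "0 \<le> C"
    and counting: "\<And>\<epsilon>. 0 < \<epsilon> \<Longrightarrow> \<exists>N. \<forall>B. H.orthonormal B \<and> (\<forall>x\<in>B. \<epsilon> \<le> H.nrm2 (T x)) \<longrightarrow> card B \<le> N"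
  shows "compact_adjoint_pair (\<lambda>(c::complex) (f::complex \<Rightarrow> complex) z. c * f z) hardy2 hardy2_inner T (hardy2_adjoint T)"
proof -
  note adj = hardy2_adjoint[OF lin bdd]
  show ?thesis
  proof (intro compact_adjoint_pair.intro compact_adjoint_pair_axioms.intro H.inner_product_subspace_axioms)
    show "hardy2_adjoint T x \<in> hardy2" if "x \<in> hardy2" for x using adj that by blast
    show "hardy2_inner (T x) y = hardy2_inner x (hardy2_adjoint T y)" if "x \<in> hardy2" "y \<in> hardy2" for x y
      using adj that by blast
    show "\<exists>C. \<forall>x\<in>hardy2. H.nrm2 (T x) \<le> C * H.nrm2 x" using bdd by blast
    show "\<exists>r g. strict_mono r \<and> g \<in> hardy2 \<and> (\<lambda>n. H.nrm2 (T (x (r n)) - g)) \<longlonglongrightarrow> 0"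
      if "\<forall>n. x n \<in> hardy2 \<and> H.nrm2 (x n) \<le> 1" for x :: "nat \<Rightarrow> complex \<Rightarrow> complex"
      using that by (intro counting_imp_compact[OF lin bdd C counting, of x 1]) auto
    show "\<exists>N. \<forall>B. H.orthonormal B \<and> (\<forall>x\<in>B. \<epsilon> \<le> H.nrm2 (T x)) \<longrightarrow> card B \<le> N" if "0 < \<epsilon>" for \<epsilon>
      by (rule counting[OF that])
  qed (simp_all only: hardy2_linear_in[OF lin] hardy2_linear_add[OF lin] hardy2_linear_scale[OF lin])
qed

lemma hardy2_compact_if_counting:
  assumes lin: "hardy2_linear T" and bdd: "\<And>f. f \<in> hardy2 \<Longrightarrow> H.nrm2 (T f) \<le> C * H.nrm2 f" and C: "0 \<le> C"
    and counting: "\<And>\<epsilon>. 0 < \<epsilon> \<Longrightarrow> \<exists>N. \<forall>B. H.orthonormal B \<and> (\<forall>x\<in>B. \<epsilon> \<le> H.nrm2 (T x)) \<longrightarrow> card B \<le> N"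
  shows "hardy2_compact T"
  unfolding hardy2_compact_def
proof (intro conjI lin allI impI)
  fix f :: "nat \<Rightarrow> complex \<Rightarrow> complex"
  assume f: "(\<forall>n. f n \<in> hardy2) \<and> (\<exists>B. \<forall>n. hardy2_norm (f n) \<le> B)"
  then obtain B where B: "\<And>n. hardy2_norm (f n) \<le> B" by blast
  have norm: "hardy2_norm h = sqrt (H.nrm2 h)" for h by (simp add: hardy2_norm_def H.nrm2_def)
  have "H.nrm2 (f n) \<le> B\<^sup>2" for n
    using B[of n] f unfolding norm by (simp add: real_sqrt_le_iff sqrt_le_D)
  then obtain r g where r: "strict_mono r" "g \<in> hardy2" "(\<lambda>n. H.nrm2 (T (f (r n)) - g)) \<longlonglongrightarrow> 0"
    using counting_imp_compact[OF lin bdd C counting, of f "B\<^sup>2"] f by blast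
  have "(\<lambda>n. hardy2_norm (T (f (r n)) - g)) \<longlonglongrightarrow> 0"
    unfolding norm using tendsto_real_sqrt[OF r(3)] by simp
  then show "\<exists>r g. strict_mono r \<and> g \<in> hardy2 \<and> (\<lambda>n. hardy2_norm (T (f (r n)) - g)) \<longlonglongrightarrow> 0"
    using r by blast
qed

lemma finite_counting_from_power_bound:
  assumes \<epsilon>0: "0 < \<epsilon>0" and count: "\<And>\<epsilon> B. \<lbrakk>0 < \<epsilon>; \<epsilon> \<le> \<epsilon>0; H.orthonormal B; \<forall>x\<in>B. \<epsilon> \<le> H.nrm2 (T x)\<rbrakk>
                   \<Longrightarrow> real (card B) \<le> K * \<epsilon> powr - \<beta>"
    and \<epsilon>: "0 < \<epsilon>"
  shows "\<exists>N. \<forall>B. H.orthonormal B \<and> (\<forall>x\<in>B. \<epsilon> \<le> H.nrm2 (T x)) \<longrightarrow> card B \<le> N"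
proof (intro exI allI impI)
  fix B assume "H.orthonormal B \<and> (\<forall>x\<in>B. \<epsilon> \<le> H.nrm2 (T x))"
  then have "real (card B) \<le> K * (min \<epsilon> \<epsilon>0) powr - \<beta>" using \<epsilon> \<epsilon>0 by (intro count) auto
  then show "card B \<le> nat \<lfloor>K * (min \<epsilon> \<epsilon>0) powr - \<beta>\<rfloor>" by (simp add: le_nat_floor)
qed

theorem schatten_if_counting:
  assumes lin: "hardy2_linear T" and bdd: "\<And>f. f \<in> hardy2 \<Longrightarrow> H.nrm2 (T f) \<le> C * H.nrm2 f" and C: "0 \<le> C"
    and \<epsilon>0: "0 < \<epsilon>0" and K: "0 < K" and \<beta>: "0 < \<beta>" "2 * \<beta> < p"
    and count: "\<And>\<epsilon> B. \<lbrakk>0 < \<epsilon>; \<epsilon> \<le> \<epsilon>0; H.orthonormal B; \<forall>x\<in>B. \<epsilon> \<le> H.nrm2 (T x)\<rbrakk>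
                   \<Longrightarrow> real (card B) \<le> K * \<epsilon> powr - \<beta>"
  shows "T \<in> schatten p"
proof -
  note fin = finite_counting_from_power_bound[OF \<epsilon>0 count]
  interpret P: compact_adjoint_pair "\<lambda>(c::complex) (f::complex \<Rightarrow> complex) z. c * f z" hardy2 hardy2_inner T "hardy2_adjoint T"
    by (rule hardy2_compact_adjoint_pair[OF lin bdd C fin])
  obtain s :: "nat \<Rightarrow> real" where s: "decseq s" "\<And>n. 0 \<le> s n"
    "\<And>\<sigma>. 0 < \<sigma> \<Longrightarrow> finite {n. s n = \<sigma>} \<and> card {n. s n = \<sigma>} = cfun.dim (P.eigenspace \<sigma>)"
    "summable (\<lambda>n. s n powr p)"
    using P.singular_numbers_from_counting[OF \<epsilon>0 K \<beta> count] by blast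
  then have "singular_numbers T s" unfolding singular_numbers_def P.eigenspace_def by blast
  moreover have "hardy2_compact T" by (rule hardy2_compact_if_counting[OF lin bdd C fin])
  ultimately show ?thesis using s(4) by (auto simp: schatten_def)
qed

text \<open>The monomials form an orthonormal system, so an infinite sum of the \<open>\<parallel>T e\<parallel>\<^sup>2\<close> over it
  contradicts square summable singular numbers.\<close>

theorem not_schatten_2_if_trace_infinite:
  assumes lin: "hardy2_linear T" and bdd: "\<And>f. f \<in> hardy2 \<Longrightarrow> H.nrm2 (T f) \<le> C * H.nrm2 f" and C: "0 \<le> C"
    and counting: "\<And>\<epsilon>. 0 < \<epsilon> \<Longrightarrow> \<exists>N. \<forall>B. H.orthonormal B \<and> (\<forall>x\<in>B. \<epsilon> \<le> H.nrm2 (T x)) \<longrightarrow> card B \<le> N"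
    and inf: "\<And>D. \<exists>N. D < (\<Sum>k<N. H.nrm2 (T (monomial k)))"
  shows "T \<notin> schatten 2"
proof
  interpret P: compact_adjoint_pair "\<lambda>(c::complex) (f::complex \<Rightarrow> complex) z. c * f z" hardy2 hardy2_inner T "hardy2_adjoint T"
    by (rule hardy2_compact_adjoint_pair[OF lin bdd C counting])
  assume "T \<in> schatten 2"
  then obtain s where s: "singular_numbers T s" "summable (\<lambda>n. s n powr 2)" by (auto simp: schatten_def)
  have nn: "0 \<le> s n" for n using s(1) by (simp add: singular_numbers_def)
  have "summable (\<lambda>n. (s n)\<^sup>2)" using s(2) nn by simp
  have le: "(\<Sum>k<N. H.nrm2 (T (monomial k))) \<le> (\<Sum>n. (s n)\<^sup>2)" for N
  proof -
    have inj: "inj_on monomial {..<N}" by (rule eq_card_imp_inj_on) (use orthonormal_monomials(2)[of N] in auto)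
    have "(\<Sum>k<N. H.nrm2 (T (monomial k))) = (\<Sum>e\<in>monomial ` {..<N}. H.nrm2 (T e))"
      using sum.reindex[OF inj, of "\<lambda>e. H.nrm2 (T e)"] by simp
    also have "\<dots> \<le> (\<Sum>n. (s n)\<^sup>2)"
    proof (rule P.trace_le_square_sum_of_singular_numbers)
      show "finite {n. s n = \<sigma>} \<and> card {n. s n = \<sigma>} = cfun.dim (P.eigenspace \<sigma>)" if "0 < \<sigma>" for \<sigma>
        using s(1) that unfolding singular_numbers_def P.eigenspace_def by blast
    qed (fact \<open>summable (\<lambda>n. (s n)\<^sup>2)\<close> orthonormal_monomials(1))+
    finally show ?thesis .
  qed
  then show False using inf[of "\<Sum>n. (s n)\<^sup>2"] by (meson not_less)
qed

section \<open>Hausdorff dimension of subsets of the circle\<close>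

lemma arc_content_mono:
  assumes "E \<subseteq> F" "\<epsilon>' \<le> \<epsilon>"
  shows "arc_content \<alpha> \<epsilon> E \<le> arc_content \<alpha> \<epsilon>' F"
  unfolding arc_content_def
proof (rule Inf_superset_mono, rule subsetI)
  fix x assume "x \<in> {(\<Sum>i. ennreal ((b i - a i) powr \<alpha>)) | a b :: nat \<Rightarrow> real.
     (\<forall>i. a i \<le> b i \<and> b i - a i \<le> 2*pi \<and> b i - a i < \<epsilon>') \<and> F \<subseteq> (\<Union>i. cis ` {a i<..<b i})}"
  then obtain a b :: "nat \<Rightarrow> real" where x: "x = (\<Sum>i. ennreal ((b i - a i) powr \<alpha>))"
    and ab: "\<forall>i. a i \<le> b i \<and> b i - a i \<le> 2*pi \<and> b i - a i < \<epsilon>'" and "F \<subseteq> (\<Union>i. cis ` {a i<..<b i})"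
    by blast
  then have "\<forall>i. a i \<le> b i \<and> b i - a i \<le> 2*pi \<and> b i - a i < \<epsilon>" "E \<subseteq> (\<Union>i. cis ` {a i<..<b i})"
    using assms less_le_trans by blast+
  then show "x \<in> {(\<Sum>i. ennreal ((b i - a i) powr \<alpha>)) | a b :: nat \<Rightarrow> real.
     (\<forall>i. a i \<le> b i \<and> b i - a i \<le> 2*pi \<and> b i - a i < \<epsilon>) \<and> E \<subseteq> (\<Union>i. cis ` {a i<..<b i})}"
    using x by blast
qed

lemma hausdorff_measure_SUP:
  "hausdorff_measure \<alpha> E = (SUP \<epsilon>\<in>{0<..}. arc_content \<alpha> \<epsilon> E)"
  unfolding hausdorff_measure_def
proof (rule tendsto_Lim)
  let ?f = "\<lambda>\<epsilon>. arc_content \<alpha> \<epsilon> E"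
  show "(?f \<longlongrightarrow> (SUP \<epsilon>\<in>{0<..}. ?f \<epsilon>)) (at_right 0)"
  proof (rule order_tendstoI)
    fix c assume "c < (SUP \<epsilon>\<in>{0<..}. ?f \<epsilon>)"
    then obtain \<epsilon> where \<epsilon>: "0 < \<epsilon>" "c < ?f \<epsilon>" by (auto simp: less_SUP_iff)
    have "\<forall>\<^sub>F x in at_right 0. x \<in> {0<..<\<epsilon>}" using \<epsilon>(1) by (rule eventually_at_right_real)
    then show "\<forall>\<^sub>F x in at_right 0. c < ?f x"
    proof (rule eventually_mono)
      fix x assume "x \<in> {0<..<\<epsilon>}"
      then show "c < ?f x" using less_le_trans[OF \<epsilon>(2) arc_content_mono[OF subset_refl, of x \<epsilon> \<alpha> E]] by simp
    qed
  next
    fix c assume c: "(SUP \<epsilon>\<in>{0<..}. ?f \<epsilon>) < c"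
    have "\<forall>\<^sub>F x::real in at_right 0. 0 < x" by (rule eventually_at_right_less)
    then show "\<forall>\<^sub>F x in at_right 0. ?f x < c"
    proof (rule eventually_mono)
      fix x :: real assume "0 < x"
      then have "?f x \<le> (SUP \<epsilon>\<in>{0<..}. ?f \<epsilon>)" by (intro SUP_upper) auto
      then show "?f x < c" using c by (rule le_less_trans)
    qed
  qed
qed simp

text \<open>Covering the circle by \<open>n\<close> arcs of length \<open>4\<pi>/n\<close> costs a multiple of \<open>n powr (1 - \<alpha>)\<close>, which
  tends to \<open>0\<close>.\<close>

lemma arc_content_eq_0:
  assumes E: "E \<subseteq> sphere 0 1" and \<alpha>: "1 < \<alpha>" and \<epsilon>: "0 < \<epsilon>"
  shows "arc_content \<alpha> \<epsilon> E = 0"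
proof -
  have lim: "(\<lambda>n. (4 * pi) powr \<alpha> * (real n powr (1 - \<alpha>))) \<longlonglongrightarrow> (4 * pi) powr \<alpha> * 0"
    using \<alpha> by (intro tendsto_intros tendsto_neg_powr filterlim_real_sequentially) auto
  have le: "arc_content \<alpha> \<epsilon> E \<le> ennreal e" if e: "0 < e" for e
  proof -
    have "\<forall>\<^sub>F n in sequentially. (4 * pi) powr \<alpha> * (real n powr (1 - \<alpha>)) < e"
      using order_tendstoD(2)[OF lim, of e] e by simp
    moreover have "\<forall>\<^sub>F n in sequentially. 2 < n" by (rule eventually_gt_at_top)
    moreover have "\<forall>\<^sub>F n in sequentially. 4 * pi / real n < \<epsilon>"
    proof -
      have "(\<lambda>n. 4 * pi / real n) \<longlonglongrightarrow> 0" by (rule lim_const_over_n)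
      from order_tendstoD(2)[OF this \<epsilon>] show ?thesis .
    qed
    ultimately have "\<forall>\<^sub>F n in sequentially. (4 * pi) powr \<alpha> * (real n powr (1 - \<alpha>)) < e \<and> 2 < n \<and> 4 * pi / real n < \<epsilon>"
      by eventually_elim auto
    then obtain n where n: "(4 * pi) powr \<alpha> * (real n powr (1 - \<alpha>)) < e" "2 < n" "4 * pi / real n < \<epsilon>"
      by (auto simp: eventually_sequentially)
    define a where "a i = (if i < n then 2*pi*real i/n - 2*pi/n else 0)" for i
    define b where "b i = (if i < n then 2*pi*real i/n + 2*pi/n else 0)" for i
    have len: "b i - a i = (if i < n then 4 * pi / n else 0)" for i by (simp add: a_def b_def)
    have ab: "a i \<le> b i" for i by (simp add: a_def b_def)
    have small: "4 * pi / real n \<le> 2 * pi" using n(2) by (simp add: field_simps)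
    have cover: "E \<subseteq> (\<Union>i. cis ` {a i<..<b i})"
    proof
      fix z assume "z \<in> E"
      then have "cmod z = 1" using E by auto
      then obtain t where t: "0 \<le> t" "t < 2*pi" "z = cis t"
      proof -
        have "z = cis (Arg2pi z)" using \<open>cmod z = 1\<close> Arg2pi_eq[of z] by (simp add: cis_conv_exp)
        then show ?thesis using that[of "Arg2pi z"] Arg2pi_ge_0[of z] Arg2pi_lt_2pi[of z] by blast
      qed
      define i where "i = nat \<lfloor>t * n / (2*pi)\<rfloor>"
      have u0: "0 \<le> t * n / (2*pi)" using t by simp
      have i: "real i \<le> t * n / (2*pi)" "t * n / (2*pi) < real i + 1"
        using u0 unfolding i_def by linarith+
      have "t * n / (2*pi) < n" using t n(2) by (simp add: field_simps)
      then have "i < n" using i(1) by linarith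
      moreover have "2*pi*real i/n \<le> t" "t < 2*pi*real i/n + 2*pi/n"
        using i n(2) by (auto simp: field_simps)
      moreover have "0 < 2*pi/n" using n(2) by simp
      moreover have "a i = 2*pi*real i/n - 2*pi/n" "b i = 2*pi*real i/n + 2*pi/n"
        using \<open>i < n\<close> by (simp_all add: a_def b_def)
      ultimately have "a i < t" "t < b i" by linarith+
      then have "t \<in> {a i<..<b i}" by simp
      then show "z \<in> (\<Union>i. cis ` {a i<..<b i})" using t(3) by blast
    qed
    have "arc_content \<alpha> \<epsilon> E \<le> (\<Sum>i. ennreal ((b i - a i) powr \<alpha>))"
      unfolding arc_content_def
    proof (rule Inf_lower, rule CollectI, intro exI conjI allI)
      show "E \<subseteq> (\<Union>i. cis ` {a i<..<b i})" by (rule cover)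
    qed (use len small n \<epsilon> ab in auto)
    also have "\<dots> = (\<Sum>i<n. ennreal ((b i - a i) powr \<alpha>))"
      by (rule suminf_finite) (auto simp: len)
    also have "\<dots> = ennreal (\<Sum>i<n. (b i - a i) powr \<alpha>)" by (rule sum_ennreal) simp
    also have "(\<Sum>i<n. (b i - a i) powr \<alpha>) = real n * (4 * pi / n) powr \<alpha>" by (simp add: len)
    also have "\<dots> = (4 * pi) powr \<alpha> * (real n powr (1 - \<alpha>))"
      using n(2) by (simp add: powr_divide powr_diff)
    finally show ?thesis using n(1) by (metis ennreal_leI less_imp_le order_trans)
  qed
  show ?thesis
  proof (rule antisym)
    show "arc_content \<alpha> \<epsilon> E \<le> 0" by (rule ennreal_le_epsilon) (use le in simp)
  qed simp
qed

lemma hausdorff_dim_eq_1: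
  assumes E: "E \<subseteq> sphere 0 1"
    and lower: "\<And>\<alpha>. 0 < \<alpha> \<Longrightarrow> \<alpha> < 1 \<Longrightarrow> 0 < arc_content \<alpha> 1 E"
  shows "hausdorff_dim E = 1"
  unfolding hausdorff_dim_def
proof (rule cInf_eq_non_empty)
  have big: "\<alpha> \<in> {\<alpha>. 0 < \<alpha> \<and> hausdorff_measure \<alpha> E = 0}" if "1 < \<alpha>" for \<alpha>
    using arc_content_eq_0[OF E that] that by (auto simp: hausdorff_measure_SUP SUP_eq_iff)
  show "{\<alpha>. 0 < \<alpha> \<and> hausdorff_measure \<alpha> E = 0} \<noteq> {}"
  proof -
    have "(2::real) \<in> {\<alpha>. 0 < \<alpha> \<and> hausdorff_measure \<alpha> E = 0}" by (rule big) simp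
    then show ?thesis by blast
  qed
  show "1 \<le> \<alpha>" if "\<alpha> \<in> {\<alpha>. 0 < \<alpha> \<and> hausdorff_measure \<alpha> E = 0}" for \<alpha>
  proof (rule ccontr)
    assume "\<not> 1 \<le> \<alpha>"
    then have "0 < arc_content \<alpha> 1 E" using lower that by auto
    also have "\<dots> \<le> hausdorff_measure \<alpha> E" unfolding hausdorff_measure_SUP by (intro SUP_upper) simp
    finally show False using that by simp
  qed
  show "y \<le> 1" if "\<And>x. x \<in> {\<alpha>. 0 < \<alpha> \<and> hausdorff_measure \<alpha> E = 0} \<Longrightarrow> y \<le> x" for y
    by (rule dense_ge) (use that big in blast)
qed

section \<open>A Cantor set of measure zero and dimension one\<close>

text \<open>The set is the intersection over \<open>k\<close> of unions of \<open>2 ^ k\<close> intervals of length \<open>radius k\<close>,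
  each of which contains two intervals of the next stage, at its two ends. The total length
  \<open>1 / (k + 1)\<close> tends to \<open>0\<close>, but slower than any power of the length of the intervals; hence
  measure zero and dimension one.\<close>

definition radius :: "nat \<Rightarrow> real" where "radius k = 1 / (2 ^ k * (real k + 1))"

definition shift :: "nat \<Rightarrow> real" where "shift k = radius k - radius (Suc k)"

fun level :: "nat \<Rightarrow> real set" where
  "level 0 = {0}"
| "level (Suc k) = level k \<union> (\<lambda>x. x + shift k) ` level k"

definition cantor :: "real set" where
  "cantor = (\<Inter>k. \<Union>x\<in>level k. {x..x + radius k})"

lemma radius_pos [simp]: "0 < radius k" by (simp add: radius_def)

lemma gap: "shift k - radius (Suc k) = 1 / (2 ^ k * ((real k + 1) * (real k + 2)))"
proof -
  have "shift k - radius (Suc k) = (1 / (real k + 1) - 1 / (real k + 2)) / 2 ^ k"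
  proof -
    have eq: "radius k = 1 / (real k + 1) / 2 ^ k" "radius (Suc k) = 1 / (real k + 2) / 2 ^ k / 2"
      by (simp_all add: radius_def add.commute mult.commute)
    have "shift k - radius (Suc k) = radius k - 2 * radius (Suc k)" by (simp add: shift_def)
    also have "2 * radius (Suc k) = 1 / (real k + 2) / 2 ^ k" unfolding eq(2) by (simp only: times_divide_eq_right) simp
    finally show ?thesis unfolding eq(1) diff_divide_distrib .
  qed
  also have "1 / (real k + 1) - 1 / (real k + 2) = 1 / ((real k + 1) * (real k + 2))" by (simp add: field_simps)
  finally show ?thesis by simp
qed

lemma shift_pos: "radius (Suc k) < shift k"
proof -
  have "0 < shift k - radius (Suc k)" unfolding gap by simp
  then show ?thesis by simp
qed

lemma level_finite: "finite (level k)" and level_card: "card (level k) \<le> 2 ^ k"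
proof (induction k)
  case (Suc k)
  { case 1 then show ?case using Suc by simp }
  { case 2
    have "card (level (Suc k)) \<le> card (level k) + card ((\<lambda>x. x + shift k) ` level k)" by (simp add: card_Un_le)
    also have "\<dots> \<le> card (level k) + card (level k)" using Suc by (simp add: card_image_le)
    finally show ?case using Suc by simp }
qed auto

lemma level_mono: "j \<le> k \<Longrightarrow> level j \<subseteq> level k"
  by (induction k) (auto simp: le_Suc_eq)

lemma level_nested: "j \<le> k \<Longrightarrow> x \<in> level k \<Longrightarrow> \<exists>y\<in>level j. y \<le> x \<and> x + radius k \<le> y + radius j"
proof (induction k arbitrary: x)
  case (Suc k)
  show ?case
  proof (cases "j = Suc k")
    case True then show ?thesis using Suc.prems by auto
  next
    case False
    obtain x' where x': "x' \<in> level k" "x' \<le> x" "x + radius (Suc k) \<le> x' + radius k"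
    proof (cases "x \<in> level k")
      case True
      moreover have "radius (Suc k) \<le> radius k"
        using shift_pos[of k] radius_pos[of "Suc k"] unfolding shift_def by linarith
      ultimately show ?thesis using that[of x] by simp
    next
      case False
      then obtain x'' where x'': "x'' \<in> level k" "x = x'' + shift k" using Suc.prems(2) by auto
      have "0 < shift k" using shift_pos[of k] radius_pos[of "Suc k"] by linarith
      then show ?thesis using x'' by (intro that[of x'']) (auto simp: shift_def)
    qed
    from Suc.IH[OF _ x'(1)] False Suc.prems(1) obtain y where "y \<in> level j" "y \<le> x'" "x' + radius k \<le> y + radius j" by auto
    then show ?thesis using x' by (intro bexI[of _ y]) linarith+
  qed
qed auto

lemma level_subset_cantor: "level k \<subseteq> cantor"
proof
  fix x assume x: "x \<in> level k"
  have "\<exists>y\<in>level j. x \<in> {y..y + radius j}" for j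
  proof (cases "j \<le> k")
    case True
    then obtain y where "y \<in> level j" "y \<le> x" "x + radius k \<le> y + radius j" using level_nested x by blast
    moreover have "x \<le> y + radius j" using calculation radius_pos[of k] by linarith
    ultimately show ?thesis by (intro bexI[of _ y]) auto
  next
    case False
    then have "x \<in> level j" using level_mono[of k j] x by auto
    then show ?thesis using radius_pos[of j] by (intro bexI[of _ x]) (auto intro: less_imp_le)
  qed
  then show "x \<in> cantor" by (auto simp: cantor_def)
qed

lemma cantor_subset: "cantor \<subseteq> {0..1}"
proof -
  have "cantor \<subseteq> (\<Union>x\<in>level 0. {x..x + radius 0})" unfolding cantor_def by blast
  then show ?thesis by (simp add: radius_def)
qed

lemma compact_cantor: "compact cantor"
proof -
  have "closed cantor" unfolding cantor_def by (intro closed_INT ballI closed_UN level_finite) auto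
  then show ?thesis using cantor_subset compact_Int_closed[of "{0..1}" cantor] by (simp add: Int_absorb1)
qed

subsection \<open>The inverse of a surjection onto the unit interval\<close>

text \<open>The point \<open>place y\<close> has the binary digits of \<open>y\<close> as its address in the Cantor set. Its inverse
  maps a subset of the Cantor set onto \<open>[0, 1)\<close> and is Hoelder continuous of every order below
  one, which bounds the content of the Cantor set from below.\<close>

definition digit :: "real \<Rightarrow> nat \<Rightarrow> bool" where "digit y k \<longleftrightarrow> odd \<lfloor>2 ^ Suc k * y\<rfloor>"

definition place :: "real \<Rightarrow> real" where "place y = (\<Sum>k. if digit y k then shift k else 0)"

lemma radius_tendsto: "radius \<longlonglongrightarrow> 0"
proof (rule tendsto_sandwich[OF _ _ tendsto_const])
  show "(\<lambda>k. (1/2) ^ k :: real) \<longlonglongrightarrow> 0" by (rule LIMSEQ_power_zero) simp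
  show "\<forall>\<^sub>F k in sequentially. radius k \<le> (1/2) ^ k"
  proof (intro always_eventually allI)
    fix k
    have "radius k \<le> 1 / 2 ^ k" unfolding radius_def by (rule divide_left_mono) auto
    then show "radius k \<le> (1/2) ^ k" by (simp add: power_one_over)
  qed
qed (auto intro!: always_eventually less_imp_le[OF radius_pos])

lemma shift_sums: "(\<lambda>k. shift (k + n)) sums radius n"
proof -
  have "(\<lambda>k. radius (k + n)) \<longlonglongrightarrow> 0" using LIMSEQ_ignore_initial_segment[OF radius_tendsto] .
  from telescope_sums'[OF this] show ?thesis by (simp add: shift_def)
qed

lemma digit_summable: "summable (\<lambda>k. if digit y k then shift k else 0)"
proof (rule summable_comparison_test'[where N = 0 and g = shift])
  show "summable shift" using sums_summable[OF shift_sums[of 0]] by simp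
  show "norm (if digit y k then shift k else 0) \<le> shift k" for k
  proof -
    have "0 < shift k" using radius_pos[of "Suc k"] shift_pos[of k] by linarith
    then show ?thesis by simp
  qed
qed

lemma place_split:
  "\<exists>u. 0 \<le> u \<and> u \<le> radius n \<and> place y = (\<Sum>k<n. if digit y k then shift k else 0) + u"
proof -
  let ?d = "\<lambda>k. if digit y k then shift k else 0"
  have pos: "0 \<le> ?d k" "?d k \<le> shift k" for k
  proof -
    have "0 < shift k" using radius_pos[of "Suc k"] shift_pos[of k] by linarith
    then show "0 \<le> ?d k" "?d k \<le> shift k" by auto
  qed
  have "place y = (\<Sum>k. ?d (k + n)) + (\<Sum>k<n. ?d k)"
    unfolding place_def by (rule suminf_split_initial_segment[OF digit_summable])
  moreover have s: "summable (\<lambda>k. ?d (k + n))" using digit_summable summable_iff_shift[of ?d n] by simp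
  moreover have "0 \<le> (\<Sum>k. ?d (k + n))" by (intro suminf_nonneg s pos)
  moreover have "(\<Sum>k. ?d (k + n)) \<le> radius n"
    by (rule sums_le[OF pos(2) summable_sums[OF s] shift_sums[of n]])
  ultimately show ?thesis by (intro exI[of _ "\<Sum>k. ?d (k + n)"]) auto
qed

lemma place_in_cantor: "place y \<in> cantor"
proof -
  have part: "(\<Sum>k<n. if digit y k then shift k else 0) \<in> level n" for n
    by (induction n) auto
  have "\<exists>x\<in>level n. place y \<in> {x..x + radius n}" for n
    using place_split[of n y] part[of n] by (intro bexI[of _ "\<Sum>k<n. if digit y k then shift k else 0"]) auto
  then show ?thesis by (auto simp: cantor_def)
qed

lemma floor_double: "\<lfloor>2 * u\<rfloor> = 2 * \<lfloor>u\<rfloor> + (if odd \<lfloor>2 * u\<rfloor> then 1 else 0)" for u :: real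
proof -
  have "\<lfloor>2 * u\<rfloor> = 2 * \<lfloor>u\<rfloor> \<or> \<lfloor>2 * u\<rfloor> = 2 * \<lfloor>u\<rfloor> + 1" by linarith
  then show ?thesis by auto
qed

lemma same_digits_imp_same_floor:
  assumes "0 \<le> y" "y < 1" "0 \<le> y'" "y' < 1" and "\<And>j. j < k \<Longrightarrow> digit y j = digit y' j"
  shows "\<lfloor>2 ^ k * y\<rfloor> = \<lfloor>2 ^ k * y'\<rfloor>"
  using assms(5)
proof (induction k)
  case 0
  have "\<lfloor>y\<rfloor> = 0" "\<lfloor>y'\<rfloor> = 0" using assms(1-4) by (auto simp: floor_eq_iff)
  then show ?case by simp
next
  case (Suc k)
  then have "\<lfloor>2 ^ k * y\<rfloor> = \<lfloor>2 ^ k * y'\<rfloor>" "digit y k = digit y' k" by auto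
  then show ?case using floor_double[of "2 ^ k * y"] floor_double[of "2 ^ k * y'"]
    by (simp add: digit_def mult.assoc)
qed

lemma same_floor_close: "\<lfloor>2 ^ k * y\<rfloor> = \<lfloor>2 ^ k * y'\<rfloor> \<Longrightarrow> \<bar>y - y'\<bar> \<le> 1 / 2 ^ k" for y y' :: real
proof -
  assume "\<lfloor>2 ^ k * y\<rfloor> = \<lfloor>2 ^ k * y'\<rfloor>"
  then have "\<bar>2 ^ k * y - 2 ^ k * y'\<bar> \<le> 1" by linarith
  moreover have "\<bar>2 ^ k * y - 2 ^ k * y'\<bar> = 2 ^ k * \<bar>y - y'\<bar>"
    by (simp add: abs_mult right_diff_distrib[symmetric])
  ultimately show ?thesis by (simp add: field_simps)
qed

text \<open>At the first digit \<open>k\<close> in which the addresses differ the two points lie in different intervals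
  of stage \<open>k + 1\<close>, which are separated by the gap between these intervals, whereas \<open>y\<close> and \<open>y'\<close>
  have the same first \<open>k\<close> binary digits.\<close>

lemma place_separation:
  assumes y: "0 \<le> y" "y < 1" "0 \<le> y'" "y' < 1" and ne: "y \<noteq> y'"
  shows "\<exists>k. \<bar>y - y'\<bar> \<le> 1 / 2 ^ k \<and> 1 / (2 ^ k * ((real k + 1) * (real k + 2))) \<le> \<bar>place y - place y'\<bar>"
proof -
  have "\<exists>k. digit y k \<noteq> digit y' k"
  proof (rule ccontr)
    assume "\<nexists>k. digit y k \<noteq> digit y' k"
    then have close: "\<bar>y - y'\<bar> \<le> (1/2) ^ k" for k
      using same_floor_close[OF same_digits_imp_same_floor[OF y, of k]] by (simp add: power_divide)
    have "(\<lambda>k. (1/2) ^ k :: real) \<longlonglongrightarrow> 0" by (rule LIMSEQ_power_zero) simp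
    then have "\<bar>y - y'\<bar> \<le> 0" by (rule tendsto_lowerbound) (use close in auto)
    then show False using ne by simp
  qed
  then obtain k where k: "digit y k \<noteq> digit y' k" "\<And>j. j < k \<Longrightarrow> digit y j = digit y' j"
    using exists_least_iff[of "\<lambda>k. digit y k \<noteq> digit y' k"] by auto
  have close: "\<bar>y - y'\<bar> \<le> 1 / 2 ^ k" by (rule same_floor_close[OF same_digits_imp_same_floor[OF y k(2)]])
  obtain u u' where u: "0 \<le> u" "u \<le> radius (Suc k)" "place y = (\<Sum>j<Suc k. if digit y j then shift j else 0) + u"
    and u': "0 \<le> u'" "u' \<le> radius (Suc k)" "place y' = (\<Sum>j<Suc k. if digit y' j then shift j else 0) + u'"
    using place_split[of "Suc k" y] place_split[of "Suc k" y'] by blast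
  have "(\<Sum>j<k. if digit y j then shift j else 0) = (\<Sum>j<k. if digit y' j then shift j else 0)"
    using k(2) by (intro sum.cong) auto
  then have "shift k - radius (Suc k) \<le> \<bar>place y - place y'\<bar>"
    using u u' k(1) by (cases "digit y k") auto
  then show ?thesis using close unfolding gap by blast
qed

text \<open>The gap at stage \<open>k\<close> is \<open>1 / 2 ^ k\<close> up to a polynomial factor in \<open>k\<close>, which any exponent
  \<open>\<alpha> < 1\<close> absorbs.\<close>

lemma place_hoelder:
  assumes \<alpha>: "0 < \<alpha>" "\<alpha> < 1"
  obtains C where "0 < C" "\<And>y y'. \<lbrakk>0 \<le> y; y < 1; 0 \<le> y'; y' < 1\<rbrakk> \<Longrightarrow> \<bar>y - y'\<bar> \<le> C * \<bar>place y - place y'\<bar> powr \<alpha>"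
proof -
  \<comment> \<open>The square of \<open>s ^ k\<close> is the factor \<open>(2 ^ k) powr (\<alpha> - 1)\<close>, and \<open>k * s ^ k\<close> is
    bounded, so this factor absorbs a quadratic polynomial in \<open>k\<close>.\<close>
  define s where "s = 2 powr (- (1 - \<alpha>) / 2)"
  have s: "0 < s" "s < 1" using \<alpha> by (auto simp: s_def powr_less_one)
  have "(\<lambda>n. of_nat n * s ^ n + 2 * s ^ n) \<longlonglongrightarrow> 0 + 2 * 0"
    using s by (intro tendsto_intros powser_times_n_limit_0 LIMSEQ_power_zero) auto
  then have "Bseq (\<lambda>n. of_nat n * s ^ n + 2 * s ^ n)" by (intro convergent_imp_Bseq convergentI)
  then obtain A where A: "0 < A" "\<And>n. \<bar>real n * s ^ n + 2 * s ^ n\<bar> \<le> A" by (auto simp: Bseq_def)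
  have key: "1 / 2 ^ k \<le> A\<^sup>2 * (1 / (2 ^ k * ((real k + 1) * (real k + 2)))) powr \<alpha>" for k
  proof -
    let ?m = "(real k + 1) * (real k + 2)"
    have "?m powr \<alpha> \<le> ?m powr 1" using \<alpha> by (intro powr_mono) (auto simp: algebra_simps)
    also have "\<dots> \<le> (real k + 2)\<^sup>2" by (simp add: power2_eq_square mult_right_mono)
    finally have m: "?m powr \<alpha> \<le> (real k + 2)\<^sup>2" .
    have "(2 ^ k) powr (\<alpha> - 1) = (s ^ k)\<^sup>2"
      by (simp add: s_def powr_realpow[symmetric] powr_powr powr_powr_swap power_mult[symmetric] flip: powr_numeral) (simp add: algebra_simps)
    then have "(2 ^ k) powr (\<alpha> - 1) * ?m powr \<alpha> \<le> (s ^ k)\<^sup>2 * (real k + 2)\<^sup>2"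
      using m by (simp add: mult_left_mono)
    also have "\<dots> = (real k * s ^ k + 2 * s ^ k)\<^sup>2" by (simp add: power_mult_distrib[symmetric] algebra_simps)
    also have "\<dots> \<le> A\<^sup>2" using A by (simp add: abs_le_square_iff[symmetric])
    finally have "(2 ^ k) powr \<alpha> * ?m powr \<alpha> \<le> A\<^sup>2 * 2 ^ k" by (simp add: powr_diff field_simps)
    moreover have "(1 / (2 ^ k * ?m)) powr \<alpha> = 1 / ((2 ^ k) powr \<alpha> * ?m powr \<alpha>)"
      by (simp add: powr_divide powr_mult)
    moreover have "1 / q \<le> B * (1 / P)" if "0 < P" "0 < q" "P \<le> B * q" for P q B :: real
      using that by (simp add: field_simps)
    moreover have "0 < (2 ^ k) powr \<alpha> * ?m powr \<alpha>" by (simp add: add_pos_pos)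
    ultimately show ?thesis by simp
  qed
  show ?thesis
  proof (rule that[of "A\<^sup>2"])
    show "0 < A\<^sup>2" using A by simp
    fix y y' :: real assume y: "0 \<le> y" "y < 1" "0 \<le> y'" "y' < 1"
    show "\<bar>y - y'\<bar> \<le> A\<^sup>2 * \<bar>place y - place y'\<bar> powr \<alpha>"
    proof (cases "y = y'")
      case False
      from place_separation[OF y False] obtain k where k: "\<bar>y - y'\<bar> \<le> 1 / 2 ^ k"
        "1 / (2 ^ k * ((real k + 1) * (real k + 2))) \<le> \<bar>place y - place y'\<bar>" by blast
      have "\<bar>y - y'\<bar> \<le> A\<^sup>2 * (1 / (2 ^ k * ((real k + 1) * (real k + 2)))) powr \<alpha>" using k(1) key[of k] by linarith
      also have "\<dots> \<le> A\<^sup>2 * \<bar>place y - place y'\<bar> powr \<alpha>"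
        using k(2) \<alpha> by (intro mult_left_mono powr_mono2) auto
      finally show ?thesis .
    qed simp
  qed
qed

text \<open>The Cantor set is moved to the arc between the angles \<open>2\<close> and \<open>3\<close>, inside the left half plane
  and so away from the point \<open>1\<close>.\<close>

definition cantor_arc :: "complex set" where
  "cantor_arc = (\<lambda>x. cis (2 + x)) ` cantor"

text \<open>The preimages under \<open>place\<close> of the arcs of a cover have diameter at most \<open>C\<close> times the \<open>\<alpha>\<close>-th
  power of the length of the arc and cover \<open>[0, 1)\<close>, so countable subadditivity of Lebesgue
  measure bounds the sum from below. Arcs shorter than \<open>1\<close> cannot wrap around the circle, so that
  distances of angles and of points of the Cantor set agree.\<close>

lemma arc_content_cantor_arc:
  assumes \<alpha>: "0 < \<alpha>" "\<alpha> < 1"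
  shows "0 < arc_content \<alpha> 1 cantor_arc"
proof -
  obtain C where C: "0 < C" "\<And>y y'. \<lbrakk>0 \<le> y; y < 1; 0 \<le> y'; y' < 1\<rbrakk> \<Longrightarrow> \<bar>y - y'\<bar> \<le> C * \<bar>place y - place y'\<bar> powr \<alpha>"
    using place_hoelder[OF \<alpha>] by blast
  have "ennreal (1 / (2 * C)) \<le> arc_content \<alpha> 1 cantor_arc"
    unfolding arc_content_def
  proof (rule Inf_greatest, clarify)
    fix a b :: "nat \<Rightarrow> real"
    assume ab: "\<forall>i. a i \<le> b i \<and> b i - a i \<le> 2 * pi \<and> b i - a i < 1" and cover: "cantor_arc \<subseteq> (\<Union>i. cis ` {a i<..<b i})"
    define D where "D i = {y\<in>{0..<1}. cis (2 + place y) \<in> cis ` {a i<..<b i}}" for i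
    define L where "L i = C * (b i - a i) powr \<alpha>" for i
    have L0: "0 \<le> L i" for i using C by (simp add: L_def)
    have near: "\<bar>y - y'\<bar> \<le> L i" if y: "y \<in> D i" and y': "y' \<in> D i" for y y' i
    proof -
      obtain s s' where s: "s \<in> {a i<..<b i}" "cis (2 + place y) = cis s"
        and s': "s' \<in> {a i<..<b i}" "cis (2 + place y') = cis s'" using y y' by (auto simp: D_def)
      obtain m m' :: int where m: "2 + place y = s + 2 * pi * m" and m': "2 + place y' = s' + 2 * pi * m'"
        using sin_cos_eq_iff[of "2 + place y" s] sin_cos_eq_iff[of "2 + place y'" s'] s(2) s'(2)
        by (auto simp: complex_eq_iff)
      have p: "place y \<in> {0..1}" "place y' \<in> {0..1}" using place_in_cantor cantor_subset by blast+
      have ss: "\<bar>s - s'\<bar> < b i - a i" "b i - a i < 1" using s s' ab by auto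
      have "\<bar>2 * pi * (real_of_int m - m')\<bar> = \<bar>(place y - place y') - (s - s')\<bar>"
        using m m' by (simp add: algebra_simps)
      also have "\<dots> < 2 * pi" using p ss pi_gt3 by auto
      finally have "\<bar>real_of_int m - m'\<bar> < 1" by (simp add: abs_mult)
      then have "m = m'" by linarith
      then have "\<bar>place y - place y'\<bar> \<le> b i - a i" using m m' ss by simp
      then have "C * \<bar>place y - place y'\<bar> powr \<alpha> \<le> L i"
        unfolding L_def using \<alpha> C by (intro mult_left_mono powr_mono2) auto
      then show ?thesis using C(2)[of y y'] y y' by (auto simp: D_def)
    qed
    define y0 where "y0 i = (SOME y. y \<in> D i)" for i
    have DI: "D i \<subseteq> {y0 i - L i..y0 i + L i}" for i
    proof
      fix y assume y: "y \<in> D i"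
      then have "y0 i \<in> D i" unfolding y0_def by (rule someI)
      from near[OF y this] show "y \<in> {y0 i - L i..y0 i + L i}" by auto
    qed
    have "{0..<1} \<subseteq> (\<Union>i. {y0 i - L i..y0 i + L i})"
    proof
      fix y :: real assume y: "y \<in> {0..<1}"
      have "cis (2 + place y) \<in> cantor_arc" unfolding cantor_arc_def using place_in_cantor by blast
      then obtain i where "cis (2 + place y) \<in> cis ` {a i<..<b i}" using cover by blast
      then have "y \<in> D i" using y by (simp add: D_def)
      then show "y \<in> (\<Union>i. {y0 i - L i..y0 i + L i})" using DI by blast
    qed
    then have "emeasure lborel {0..<1::real} \<le> emeasure lborel (\<Union>i. {y0 i - L i..y0 i + L i})"
      by (intro emeasure_mono) auto
    also have "\<dots> \<le> (\<Sum>i. emeasure lborel {y0 i - L i..y0 i + L i})"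
      by (rule emeasure_subadditive_countably) auto
    also have "\<dots> = (\<Sum>i. ennreal (2 * C) * ennreal ((b i - a i) powr \<alpha>))"
      using L0 C by (intro suminf_cong) (simp add: L_def ennreal_mult[symmetric])
    also have "\<dots> = ennreal (2 * C) * (\<Sum>i. ennreal ((b i - a i) powr \<alpha>))" by simp
    finally have one: "1 \<le> ennreal (2 * C) * (\<Sum>i. ennreal ((b i - a i) powr \<alpha>))" by simp
    have "ennreal (1 / (2 * C)) * 1 \<le> ennreal (1 / (2 * C)) * (ennreal (2 * C) * (\<Sum>i. ennreal ((b i - a i) powr \<alpha>)))"
      by (intro mult_left_mono one) simp
    also have "\<dots> = (\<Sum>i. ennreal ((b i - a i) powr \<alpha>))"
      using C by (simp add: mult.assoc[symmetric] ennreal_mult[symmetric])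
    finally show "ennreal (1 / (2 * C)) \<le> (\<Sum>i. ennreal ((b i - a i) powr \<alpha>))" by simp
  qed
  moreover have "0 < ennreal (1 / (2 * C))" using C by simp
  ultimately show ?thesis by (rule less_le_trans[rotated])
qed

lemma compact_cantor_arc: "compact cantor_arc"
  unfolding cantor_arc_def by (intro compact_continuous_image compact_cantor continuous_intros)

lemma cantor_arc_subset: "cantor_arc \<subseteq> sphere 0 1"
  by (auto simp: cantor_arc_def)

section \<open>A function tending to infinity at one point\<close>

text \<open>The function \<open>H0 z = (1 - z) (4 - Ln (1 - z))\<^sup>2\<close> has positive real part; near \<open>1\<close> on
  the circle, with \<open>d = \<bar>1 - z\<bar>\<close>, its modulus is of order \<open>d log\<^sup>2 (1/d)\<close> and its real part
  only of order \<open>d log (1/d)\<close>. On the radius \<open>H0\<close> is real and equal to its modulus, which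
  decides how fast the symbol approaches the circle there; on the boundary \<open>1 - \<bar>\<phi>\<bar>\<^sup>2\<close> is
  comparable with the real part. The constant \<open>4\<close> makes \<open>logR d \<ge> 3\<close> for all distances
  \<open>d \<le> 2\<close> that occur.\<close>

definition logfac :: "complex \<Rightarrow> complex" where "logfac z = 4 - Ln (1 - z)"

definition H0 :: "complex \<Rightarrow> complex" where "H0 z = (1 - z) * (logfac z)\<^sup>2"

definition logR :: "real \<Rightarrow> real" where "logR d = 4 - ln d"

lemma Re_one_minus:
  assumes "z \<in> cball 0 1" "z \<noteq> 1"
  shows "0 < Re (1 - z)"
proof -
  have "cmod z \<le> 1" using assms by simp
  then have "Re z \<le> 1" using complex_Re_le_cmod[of z] by linarith
  moreover have "Re z \<noteq> 1"
  proof
    assume "Re z = 1"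
    then have "(Im z)\<^sup>2 \<le> 0" using \<open>cmod z \<le> 1\<close> cmod_power2[of z] power_mono[of "cmod z" 1 2] by simp
    then show False using \<open>Re z = 1\<close> assms(2) by (auto simp: complex_eq_iff)
  qed
  ultimately show ?thesis by simp
qed

lemma dist_one_le: "z \<in> cball 0 1 \<Longrightarrow> cmod (1 - z) \<le> 2"
  using norm_triangle_ineq4[of 1 z] by simp

lemma logR_ge: "0 < d \<Longrightarrow> d \<le> 2 \<Longrightarrow> 3 \<le> logR d"
  using ln_le_minus_one[of d] by (simp add: logR_def)

lemma logfac_parts:
  assumes "z \<in> cball 0 1" "z \<noteq> 1"
  shows "Re (logfac z) = logR (cmod (1 - z))" "\<bar>Im (logfac z)\<bar> \<le> pi / 2"
    "Im (1 - z) = - (cmod (1 - z) * sin (Im (logfac z)))"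
proof -
  have ne: "1 - z \<noteq> 0" using assms by simp
  show "Re (logfac z) = logR (cmod (1 - z))" using ne by (simp add: logfac_def logR_def)
  have I: "Im (logfac z) = - Im (Ln (1 - z))" by (simp add: logfac_def)
  have "\<bar>Im (Ln (1 - z))\<bar> < pi / 2" using Re_Ln_pos_lt[OF ne] Re_one_minus[OF assms] by simp
  then show "\<bar>Im (logfac z)\<bar> \<le> pi / 2" unfolding I by simp
  have "1 - z = exp (Ln (1 - z))" using ne by simp
  then have "Im (1 - z) = exp (Re (Ln (1 - z))) * sin (Im (Ln (1 - z)))" by (metis Im_exp)
  also have "exp (Re (Ln (1 - z))) = cmod (1 - z)" using ne by simp
  finally show "Im (1 - z) = - (cmod (1 - z) * sin (Im (logfac z)))" unfolding I by simp
qed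

text \<open>With \<open>1 - z = x + i y\<close> and \<open>logfac z = R - i \<alpha>\<close>, where \<open>\<alpha>\<close> is the argument of
  \<open>1 - z\<close>, the real part is \<open>x (R\<^sup>2 - \<alpha>\<^sup>2) + 2 R \<alpha> y\<close>. The numbers \<open>\<alpha>\<close> and \<open>y\<close> have the
  same sign and \<open>\<bar>\<alpha>\<bar> \<le> \<pi>/2\<close>, so both terms are nonnegative, and on the circle, where \<open>x\<close> is
  negligible, the second one dominates.\<close>

lemma H0_bounds:
  assumes z: "z \<in> cball 0 1" "z \<noteq> 1"
  defines "d \<equiv> cmod (1 - z)"
  shows "logR d * d \<le> Re (H0 z)" "cmod (H0 z) \<le> 2 * d * (logR d)\<^sup>2"
    "Re (H0 z) \<le> Re (1 - z) * (logR d)\<^sup>2 + pi * logR d * d"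
proof -
  define x where "x = Re (1 - z)"
  define y where "y = Im (1 - z)"
  define R where "R = logR d"
  define \<alpha> where "\<alpha> = - Im (logfac z)"
  have d: "0 < d" "d \<le> 2" using z dist_one_le[OF z(1)] by (auto simp: d_def)
  have R3: "3 \<le> R" unfolding R_def by (rule logR_ge[OF d])
  have lp: "Re (logfac z) = R" "\<bar>\<alpha>\<bar> \<le> pi / 2" "y = d * sin \<alpha>"
    using logfac_parts[OF z] by (simp_all add: R_def d_def \<alpha>_def y_def)
  have x0: "0 < x" using Re_one_minus[OF z] by (simp add: x_def)
  have d2: "d\<^sup>2 = x\<^sup>2 + y\<^sup>2" unfolding d_def x_def y_def by (rule cmod_power2)
  have ReH: "Re (H0 z) = x * (R\<^sup>2 - \<alpha>\<^sup>2) + 2 * R * (\<alpha> * y)"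
    unfolding H0_def by (simp add: x_def y_def lp(1)[symmetric] \<alpha>_def power2_eq_square algebra_simps)
  have pi2: "(pi / 2)\<^sup>2 \<le> 4" using pi_less_4 pi_gt_zero power_mono[of "pi/2" 2 2] by simp
  have \<alpha>2: "\<alpha>\<^sup>2 \<le> 4" using power_mono[OF lp(2), of 2] pi2 by simp
  have \<alpha>y: "y\<^sup>2 / d \<le> \<alpha> * y" "\<alpha> * y \<le> pi / 2 * d"
  proof -
    have s: "(sin \<alpha>)\<^sup>2 \<le> \<alpha> * sin \<alpha>"
    proof (cases "0 \<le> \<alpha>")
      case True
      then have "0 \<le> sin \<alpha>" using lp(2) by (intro sin_ge_zero) auto
      then show ?thesis using sin_x_le_x[OF True] by (simp add: power2_eq_square mult_right_mono)
    next
      case False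
      then have "0 \<le> sin (- \<alpha>)" using lp(2) by (intro sin_ge_zero) auto
      moreover have "sin (- \<alpha>) \<le> - \<alpha>" using False by (intro sin_x_le_x) auto
      ultimately have "sin (- \<alpha>) * sin (- \<alpha>) \<le> (- \<alpha>) * sin (- \<alpha>)" by (intro mult_right_mono)
      then show ?thesis by (simp add: power2_eq_square)
    qed
    have "y\<^sup>2 / d = d * (sin \<alpha>)\<^sup>2" using d unfolding lp(3) by (simp add: power2_eq_square)
    also have "\<dots> \<le> d * (\<alpha> * sin \<alpha>)" using s d by (intro mult_left_mono) auto
    finally show "y\<^sup>2 / d \<le> \<alpha> * y" by (simp add: lp(3) mult_ac)
    have "\<alpha> * y \<le> \<bar>\<alpha>\<bar> * \<bar>y\<bar>" by (metis abs_ge_self abs_mult)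
    also have "\<dots> \<le> pi / 2 * d"
      using lp(2) abs_Im_le_cmod[of "1 - z"] d by (intro mult_mono) (auto simp: y_def d_def)
    finally show "\<alpha> * y \<le> pi / 2 * d" .
  qed
  have xd: "x\<^sup>2 / d \<le> x"
    using complex_Re_le_cmod[of "1 - z"] x0 d by (simp add: x_def d_def power2_eq_square divide_le_eq mult_left_mono)
  have RR: "3 * R \<le> R\<^sup>2" using R3 by (simp add: power2_eq_square mult_right_mono)
  have "R * d = R * (x\<^sup>2 / d) + R * (y\<^sup>2 / d)"
  proof -
    have "d = x\<^sup>2 / d + y\<^sup>2 / d"
      using d(1) unfolding add_divide_distrib[symmetric] d2[symmetric] by (simp add: power2_eq_square)
    then show ?thesis by (metis distrib_left)
  qed
  also have "\<dots> \<le> R * x + 2 * R * (\<alpha> * y)"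
  proof -
    have "0 \<le> y\<^sup>2 / d" using d by simp
    then have "R * (y\<^sup>2 / d) \<le> R * (2 * (\<alpha> * y))" using \<alpha>y(1) R3 by (intro mult_left_mono) auto
    moreover have "R * (x\<^sup>2 / d) \<le> R * x" using xd R3 by (intro mult_left_mono) auto
    ultimately show ?thesis by simp
  qed
  also have "R * x \<le> x * (R\<^sup>2 - \<alpha>\<^sup>2)"
    using mult_left_mono[of R "R\<^sup>2 - \<alpha>\<^sup>2" x] x0 RR R3 \<alpha>2 by (simp add: mult.commute)
  finally show "logR d * d \<le> Re (H0 z)" unfolding ReH R_def[symmetric] by simp
  have "(cmod (logfac z))\<^sup>2 = R\<^sup>2 + \<alpha>\<^sup>2" unfolding cmod_power2 lp(1) by (simp add: \<alpha>_def)
  also have "\<dots> \<le> 2 * R\<^sup>2" using \<alpha>2 RR R3 by linarith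
  finally have "(cmod (logfac z))\<^sup>2 \<le> 2 * R\<^sup>2" .
  then have "d * (cmod (logfac z))\<^sup>2 \<le> d * (2 * R\<^sup>2)" using d by (intro mult_left_mono) auto
  then show "cmod (H0 z) \<le> 2 * d * (logR d)\<^sup>2"
    by (simp add: H0_def norm_mult norm_power d_def R_def mult_ac)
  have "x * (R\<^sup>2 - \<alpha>\<^sup>2) \<le> x * R\<^sup>2" using x0 by (intro mult_left_mono) auto
  moreover have "2 * R * (\<alpha> * y) \<le> 2 * R * (pi / 2 * d)" using \<alpha>y(2) R3 by (intro mult_left_mono) auto
  ultimately show "Re (H0 z) \<le> Re (1 - z) * (logR d)\<^sup>2 + pi * logR d * d"
    unfolding ReH R_def[symmetric] x_def[symmetric] by (simp add: algebra_simps)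
qed

definition F0 :: "complex \<Rightarrow> complex" where "F0 z = 1 / H0 z"

lemma Re_inverse: "Re (1 / w) = Re w / (cmod w)\<^sup>2"
  by (simp add: Re_divide cmod_power2)

lemma F0_bounds:
  assumes z: "z \<in> cball 0 1" "z \<noteq> 1"
  defines "d \<equiv> cmod (1 - z)"
  shows "1 / (4 * d * (logR d) ^ 3) \<le> Re (F0 z)" "0 < Re (F0 z)"
    "(cmod (F0 z))\<^sup>2 / Re (F0 z) \<le> 1 / (logR d * d)" "H0 z \<noteq> 0"
    "Re (F0 z) = Re (H0 z) * (cmod (F0 z))\<^sup>2"
proof -
  have d: "0 < d" "d \<le> 2" using z dist_one_le[OF z(1)] by (auto simp: d_def)
  have R3: "3 \<le> logR d" by (rule logR_ge[OF d])
  note b = H0_bounds[OF z, folded d_def]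
  have Rd: "0 < logR d * d" using R3 d by simp
  then have ReH: "0 < Re (H0 z)" using b(1) by linarith
  then show ne: "H0 z \<noteq> 0" by auto
  then have n0: "0 < cmod (H0 z)" by simp
  have Re: "Re (F0 z) = Re (H0 z) / (cmod (H0 z))\<^sup>2" unfolding F0_def by (rule Re_inverse)
  then show "0 < Re (F0 z)" using ReH n0 by simp
  show "Re (F0 z) = Re (H0 z) * (cmod (F0 z))\<^sup>2" unfolding Re by (simp add: F0_def norm_divide power_divide)
  have "(cmod (F0 z))\<^sup>2 / Re (F0 z) = 1 / Re (H0 z)"
    unfolding Re using ReH n0 by (simp add: F0_def norm_divide power_divide)
  also have "\<dots> \<le> 1 / (logR d * d)" using b(1) Rd by (intro divide_left_mono) auto
  finally show "(cmod (F0 z))\<^sup>2 / Re (F0 z) \<le> 1 / (logR d * d)" .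
  have "1 / (4 * d * (logR d) ^ 3) = (logR d * d) / (2 * d * (logR d)\<^sup>2)\<^sup>2"
  proof -
    have "(2 * d * (logR d)\<^sup>2)\<^sup>2 = (logR d * d) * (4 * d * (logR d) ^ 3)"
      by (simp add: power2_eq_square power3_eq_cube)
    then show ?thesis using Rd by simp
  qed
  also have "\<dots> \<le> Re (H0 z) / (cmod (H0 z))\<^sup>2"
    using b Rd ReH n0 by (intro frac_le power_mono) auto
  finally show "1 / (4 * d * (logR d) ^ 3) \<le> Re (F0 z)" unfolding Re .
qed

lemma logfac_holomorphic: "logfac holomorphic_on {z. 0 < Re (1 - z)}"
  unfolding logfac_def by (intro holomorphic_intros) (auto simp: complex_nonpos_Reals_iff)

lemma F0_holomorphic: "F0 holomorphic_on ball 0 1"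
proof -
  have "ball 0 1 \<subseteq> {z. 0 < Re (1 - z)}"
  proof
    fix z :: complex assume "z \<in> ball 0 1"
    then have "z \<in> cball 0 1" "z \<noteq> 1" by auto
    then show "z \<in> {z. 0 < Re (1 - z)}" using Re_one_minus by blast
  qed
  then have "logfac holomorphic_on ball 0 1" using logfac_holomorphic holomorphic_on_subset by blast
  then have "H0 holomorphic_on ball 0 1" unfolding H0_def by (intro holomorphic_intros)
  moreover have "H0 z \<noteq> 0" if "z \<in> ball 0 1" for z using F0_bounds(4)[of z] that by force
  ultimately show ?thesis unfolding F0_def by (intro holomorphic_intros)
qed

lemma F0_continuous: "continuous_on (cball 0 1 - {1}) F0"
proof -
  have "cball 0 1 - {1} \<subseteq> {z. 0 < Re (1 - z)}" using Re_one_minus by blast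
  then have "continuous_on (cball 0 1 - {1}) logfac"
    using logfac_holomorphic holomorphic_on_subset holomorphic_on_imp_continuous_on by blast
  then show ?thesis unfolding F0_def H0_def
    by (intro continuous_intros) (use F0_bounds(4) in \<open>auto simp: H0_def\<close>)
qed

section \<open>A function tending to infinity on the Cantor set\<close>

text \<open>A bump has positive real part on the closed disc, real part at least \<open>1/9\<close> near its centre, and
  is at most \<open>radius k / D\<close> at distance \<open>D\<close>. Stage \<open>k\<close> has at most \<open>2 ^ k\<close> bumps, so with
  weight \<open>1 / (k + 1)\<close> its total size at distance \<open>D\<close> is at most \<open>1 / (D (k + 1)\<^sup>2)\<close>, a
  convergent series, while at a point of the Cantor set the real parts add up like the harmonic
  series.\<close>

definition bump :: "nat \<Rightarrow> real \<Rightarrow> complex \<Rightarrow> complex" where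
  "bump k x z = of_real (radius k) / (of_real (radius k) + (1 - z * cis (- (2 + x))))"

definition bumps :: "nat \<Rightarrow> complex \<Rightarrow> complex" where
  "bumps k z = (\<Sum>x\<in>level k. bump k x z) / of_nat (Suc k)"

definition G :: "complex \<Rightarrow> complex" where "G z = (\<Sum>k. bumps k z)"

lemma bump_argument:
  assumes z: "z \<in> cball 0 1"
  shows "0 \<le> Re (1 - z * cis (- (2 + x)))" "cmod (1 - z * cis (- (2 + x))) = cmod (z - cis (2 + x))"
proof -
  have "cmod (z * cis (- (2 + x))) \<le> 1" using z by (simp add: norm_mult)
  then show "0 \<le> Re (1 - z * cis (- (2 + x)))"
    using complex_Re_le_cmod[of "z * cis (- (2 + x))"] by simp
  have "cis (2 + x) * (1 - z * cis (- (2 + x))) = cis (2 + x) - z * (cis (2 + x) * cis (- (2 + x)))"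
    by (simp add: algebra_simps)
  also have "\<dots> = cis (2 + x) - z" by (simp add: cis_mult)
  finally have "cmod (1 - z * cis (- (2 + x))) = cmod (cis (2 + x) - z)"
    by (metis norm_mult norm_cis mult_1)
  then show "cmod (1 - z * cis (- (2 + x))) = cmod (z - cis (2 + x))" by (simp add: norm_minus_commute)
qed

lemma bump_parts:
  assumes z: "z \<in> cball 0 1"
  shows "0 < Re (bump k x z)" "of_real (radius k) + (1 - z * cis (- (2 + x))) \<noteq> 0"
    "cmod (bump k x z) * cmod (z - cis (2 + x)) \<le> radius k"
    "cmod (z - cis (2 + x)) \<le> 2 * radius k \<Longrightarrow> 1 / 9 \<le> Re (bump k x z)"
proof -
  define v where "v = 1 - z * cis (- (2 + x))"
  define r where "r = radius k"
  have r: "0 < r" by (simp add: r_def)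
  have v: "0 \<le> Re v" "cmod v = cmod (z - cis (2 + x))" unfolding v_def by (rule bump_argument[OF z])+
  have ne: "of_real r + v \<noteq> 0" using v r by (metis Re_complex_of_real add_pos_nonneg less_irrefl plus_complex.sel(1) zero_complex.sel(1))
  then show "of_real (radius k) + (1 - z * cis (- (2 + x))) \<noteq> 0" by (simp add: v_def r_def)
  have b: "bump k x z = of_real r * (1 / (of_real r + v))" by (simp add: bump_def v_def r_def)
  have Re: "Re (bump k x z) = r * (r + Re v) / (cmod (of_real r + v))\<^sup>2"
  proof -
    have "Re (of_real r * u) = r * Re u" for u by simp
    then have "Re (bump k x z) = r * Re (1 / (of_real r + v))" unfolding b by blast
    then show ?thesis unfolding Re_inverse by simp
  qed
  then show "0 < Re (bump k x z)" using r v ne by simp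
  have "cmod v \<le> cmod (of_real r + v)"
  proof (rule power2_le_imp_le)
    have "(cmod (of_real r + v))\<^sup>2 = (cmod v)\<^sup>2 + (2 * r * Re v + r\<^sup>2)"
      unfolding cmod_power2 by (simp add: power2_sum)
    then show "(cmod v)\<^sup>2 \<le> (cmod (of_real r + v))\<^sup>2" using r v by simp
  qed simp
  then have "r * cmod v / cmod (of_real r + v) \<le> r * cmod (of_real r + v) / cmod (of_real r + v)"
    using r by (intro divide_right_mono mult_left_mono) auto
  then show "cmod (bump k x z) * cmod (z - cis (2 + x)) \<le> radius k"
    unfolding b v(2)[symmetric] r_def[symmetric] using ne r by (simp add: norm_mult norm_divide)
  show "1 / 9 \<le> Re (bump k x z)" if "cmod (z - cis (2 + x)) \<le> 2 * radius k"
  proof -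
    have "cmod (of_real r + v) \<le> r + cmod v" using norm_triangle_ineq[of "of_real r" v] r by simp
    then have "cmod (of_real r + v) \<le> 3 * r" using that v(2) by (simp add: r_def)
    then have "(cmod (of_real r + v))\<^sup>2 \<le> (3 * r)\<^sup>2" by (intro power_mono) auto
    then have "(r * r) / (3 * r)\<^sup>2 \<le> r * (r + Re v) / (cmod (of_real r + v))\<^sup>2"
      using r v ne by (intro frac_le mult_left_mono) auto
    then show ?thesis unfolding Re using r by (simp add: power2_eq_square)
  qed
qed

lemma bumps_Re_nonneg: "z \<in> cball 0 1 \<Longrightarrow> 0 \<le> Re (bumps k z)"
  unfolding bumps_def Re_divide_of_nat Re_sum
  by (intro divide_nonneg_nonneg sum_nonneg less_imp_le bump_parts) auto

lemma bumps_bound: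
  assumes z: "z \<in> cball 0 1" and D: "0 < D" "\<And>\<xi>. \<xi> \<in> cantor_arc \<Longrightarrow> D \<le> cmod (z - \<xi>)"
  shows "cmod (bumps k z) \<le> 1 / D * (1 / (real (Suc k))\<^sup>2)"
proof -
  have each: "cmod (bump k x z) \<le> radius k / D" if x: "x \<in> level k" for x
  proof -
    have "cis (2 + x) \<in> cantor_arc" using x level_subset_cantor by (auto simp: cantor_arc_def)
    then have "cmod (bump k x z) * D \<le> cmod (bump k x z) * cmod (z - cis (2 + x))"
      by (intro mult_left_mono D) auto
    also have "\<dots> \<le> radius k" by (rule bump_parts(3)[OF z])
    finally show ?thesis using D by (simp add: field_simps)
  qed
  have "cmod (\<Sum>x\<in>level k. bump k x z) \<le> real (card (level k)) * (radius k / D)"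
    by (rule sum_norm_bound) (rule each)
  also have "\<dots> \<le> 2 ^ k * (radius k / D)"
  proof (rule mult_right_mono)
    show "real (card (level k)) \<le> 2 ^ k" using level_card[of k] by (metis of_nat_le_iff of_nat_numeral of_nat_power)
  qed (use D in \<open>simp add: less_imp_le\<close>)
  also have "\<dots> = 1 / D * (1 / real (Suc k))" by (simp add: radius_def add.commute)
  finally have "cmod (\<Sum>x\<in>level k. bump k x z) / real (Suc k) \<le> 1 / D * (1 / real (Suc k)) / real (Suc k)"
    by (rule divide_right_mono) simp
  then show ?thesis unfolding bumps_def norm_divide norm_of_nat by (simp add: power2_eq_square mult.assoc)
qed

lemma summable_inverse_squares: "summable (\<lambda>k. c * (1 / (real (Suc k))\<^sup>2))"
  using inverse_power_summable[of 2, where 'a = real] summable_Suc_iff[of "\<lambda>n. inverse (real n ^ 2)"]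
  by (intro summable_mult) (simp add: inverse_eq_divide)

lemma bumps_continuous: "continuous_on (cball 0 1) (bumps k)"
  unfolding bumps_def bump_def using bump_parts(2) by (intro continuous_intros) (auto simp del: of_nat_Suc)

lemma bumps_holomorphic: "bumps k holomorphic_on ball 0 1"
  unfolding bumps_def bump_def using bump_parts(2) by (intro holomorphic_intros) (auto simp del: of_nat_Suc)

lemma G_uniform_limit:
  assumes "0 < D"
  shows "uniform_limit {z\<in>cball 0 1. \<forall>\<xi>\<in>cantor_arc. D \<le> cmod (z - \<xi>)} (\<lambda>n z. \<Sum>k<n. bumps k z) G sequentially"
  unfolding G_def using assms bumps_bound[of _ D]
  by (intro Weierstrass_m_test[OF _ summable_inverse_squares[of "1 / D"]]) auto

lemma G_continuous: "continuous_on (cball 0 1 - cantor_arc) G"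
  unfolding continuous_on_eq_continuous_within
proof
  fix z0 assume z0: "z0 \<in> cball 0 1 - cantor_arc"
  obtain D where D: "0 < D" "\<And>\<xi>. \<xi> \<in> cantor_arc \<Longrightarrow> D \<le> dist z0 \<xi>"
    using separate_point_closed[OF compact_imp_closed[OF compact_cantor_arc], of z0] z0 by blast
  let ?U = "{z\<in>cball 0 1. \<forall>\<xi>\<in>cantor_arc. D / 2 \<le> cmod (z - \<xi>)}"
  have "continuous_on ?U G"
  proof (rule uniform_limit_theorem[OF _ G_uniform_limit])
    show "\<forall>\<^sub>F n in sequentially. continuous_on ?U (\<lambda>z. \<Sum>k<n. bumps k z)"
      by (intro always_eventually allI continuous_on_sum continuous_on_subset[OF bumps_continuous]) auto
  qed (use D in auto)
  moreover have sub: "(cball 0 1 - cantor_arc) \<inter> ball z0 (D / 2) \<subseteq> ?U"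
  proof
    fix z assume z: "z \<in> (cball 0 1 - cantor_arc) \<inter> ball z0 (D / 2)"
    have "D / 2 \<le> cmod (z - \<xi>)" if "\<xi> \<in> cantor_arc" for \<xi>
      using D(2)[OF that] z dist_triangle[of z0 \<xi> z] by (simp add: dist_norm)
    then show "z \<in> ?U" using z by auto
  qed
  ultimately have "continuous_on ((cball 0 1 - cantor_arc) \<inter> ball z0 (D / 2)) G" by (rule continuous_on_subset)
  then have "continuous (at z0 within (cball 0 1 - cantor_arc) \<inter> ball z0 (D / 2)) G"
    using z0 D(1) by (simp add: continuous_on_eq_continuous_within)
  moreover have "at z0 within (cball 0 1 - cantor_arc) \<inter> ball z0 (D / 2) = at z0 within (cball 0 1 - cantor_arc)"
    by (rule at_within_nhd[of _ "ball z0 (D / 2)"]) (use D in auto)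
  ultimately show "continuous (at z0 within cball 0 1 - cantor_arc) G" by simp
qed

lemma G_holomorphic: "G holomorphic_on ball 0 1"
proof (rule holomorphic_uniform_sequence[where f = "\<lambda>n z. \<Sum>k<n. bumps k z"])
  fix z :: complex assume z: "z \<in> ball 0 1"
  define D where "D = (1 - cmod z) / 2"
  have D: "0 < D" using z by (simp add: D_def)
  have sub: "cball z D \<subseteq> {w\<in>cball 0 1. \<forall>\<xi>\<in>cantor_arc. D \<le> cmod (w - \<xi>)}"
  proof
    fix w assume w: "w \<in> cball z D"
    have "cmod w \<le> cmod z + cmod (w - z)" using norm_triangle_ineq[of z "w - z"] by simp
    then have w1: "cmod w \<le> 1 - D" using w unfolding mem_cball dist_norm D_def
      by (simp add: norm_minus_commute field_simps)
    have "D \<le> cmod (w - \<xi>)" if "\<xi> \<in> cantor_arc" for \<xi>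
      using norm_triangle_ineq2[of \<xi> w] w1 that cantor_arc_subset by (auto simp: norm_minus_commute)
    then show "w \<in> {w\<in>cball 0 1. \<forall>\<xi>\<in>cantor_arc. D \<le> cmod (w - \<xi>)}" using w1 D by auto
  qed
  have "cball z D \<subseteq> ball 0 1"
  proof
    fix w assume w: "w \<in> cball z D"
    have "cmod w \<le> cmod z + cmod (w - z)" using norm_triangle_ineq[of z "w - z"] by simp
    then show "w \<in> ball 0 1" using w D unfolding mem_cball dist_norm D_def
      by (simp add: norm_minus_commute field_simps)
  qed
  then show "\<exists>d>0. cball z d \<subseteq> ball 0 1 \<and> uniform_limit (cball z d) (\<lambda>n z. \<Sum>k<n. bumps k z) G sequentially"
    using uniform_limit_on_subset[OF G_uniform_limit[OF D] sub] D by blast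
qed (auto intro!: holomorphic_intros bumps_holomorphic)

lemma bumps_summable:
  assumes "z \<in> cball 0 1 - cantor_arc"
  shows "summable (\<lambda>k. bumps k z)"
proof -
  obtain D where D: "0 < D" "\<And>\<xi>. \<xi> \<in> cantor_arc \<Longrightarrow> D \<le> dist z \<xi>"
    using separate_point_closed[OF compact_imp_closed[OF compact_cantor_arc], of z] assms by blast
  show ?thesis
    by (rule summable_comparison_test'[where N = 0, OF summable_inverse_squares[of "1 / D"]])
      (use bumps_bound[of z D] D assms in \<open>auto simp: dist_norm\<close>)
qed

lemma G_Re_ge:
  assumes z: "z \<in> cball 0 1 - cantor_arc"
  shows "(\<Sum>k<n. Re (bumps k z)) \<le> Re (G z)"
proof -
  have s: "summable (\<lambda>k. Re (bumps k z))" "Re (G z) = (\<Sum>k. Re (bumps k z))"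
    using sums_Re[OF summable_sums[OF bumps_summable[OF z]]] by (auto simp: sums_iff G_def)
  show ?thesis unfolding s(2) using z by (intro sum_le_suminf s bumps_Re_nonneg) auto
qed

lemma G_Re_lower:
  assumes z: "z \<in> cball 0 1 - cantor_arc"
  shows "1 / 9 \<le> Re (G z)"
proof -
  have "1 / 9 \<le> Re (bump 0 0 z)"
  proof (rule bump_parts(4))
    show "cmod (z - cis (2 + 0)) \<le> 2 * radius 0"
      using norm_triangle_ineq4[of z "cis 2"] z by (simp add: radius_def)
  qed (use z in auto)
  also have "\<dots> = (\<Sum>k<1. Re (bumps k z))" by (simp add: bumps_def)
  also have "\<dots> \<le> Re (G z)" by (rule G_Re_ge[OF z])
  finally show ?thesis .
qed

lemma cis_dist_le: "cmod (cis a - cis b) \<le> \<bar>a - b\<bar>"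
proof -
  have "cis a - cis b = cis b * (cis (a - b) - 1)" by (simp add: right_diff_distrib cis_mult)
  then have "cmod (cis a - cis b) = cmod (exp (\<i> * of_real (a - b)) - 1)" by (simp add: norm_mult cis_conv_exp)
  also have "\<dots> = \<bar>2 * sin ((a - b) / 2)\<bar>" unfolding dist_exp_i_1 by (simp add: abs_mult)
  also have "\<dots> \<le> \<bar>a - b\<bar>" using abs_sin_x_le_abs_x[of "(a - b) / 2"] by (simp add: abs_mult)
  finally show ?thesis .
qed

lemma G_Re_large_near_cantor:
  assumes \<xi>: "\<xi> \<in> cantor_arc"
  shows "\<exists>\<delta>>0. \<forall>z\<in>cball 0 1 - cantor_arc. cmod (z - \<xi>) < \<delta> \<longrightarrow> M \<le> Re (G z)"
proof -
  obtain t where t: "t \<in> cantor" "\<xi> = cis (2 + t)" using \<xi> by (auto simp: cantor_arc_def)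
  have "filterlim (\<lambda>n. \<Sum>k<n. 1 / real (Suc k)) at_top sequentially"
  proof -
    have "harm n = (\<Sum>k<n. 1 / real (Suc k))" for n
      by (induction n) (simp_all add: harm_Suc harm_def inverse_eq_divide)
    then have "harm = (\<lambda>n. \<Sum>k<n. 1 / real (Suc k))" by (rule ext)
    then show ?thesis using harm_at_top by simp
  qed
  then have "\<forall>\<^sub>F n in sequentially. 9 * M \<le> (\<Sum>k<n. 1 / real (Suc k))" by (simp add: filterlim_at_top)
  then obtain n where n: "9 * M \<le> (\<Sum>k<n. 1 / real (Suc k))" by (auto simp: eventually_sequentially)
  have "M \<le> Re (G z)" if z: "z \<in> cball 0 1 - cantor_arc" "cmod (z - \<xi>) < radius n" for z
  proof -
    have "1 / 9 * (1 / real (Suc k)) \<le> Re (bumps k z)" if k: "k < n" for k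
    proof -
      obtain x where x: "x \<in> level k" "t \<in> {x..x + radius k}" using t(1) by (auto simp: cantor_def)
      have "radius n \<le> radius k" unfolding radius_def using k
        by (intro divide_left_mono mult_mono power_increasing) auto
      moreover have "cmod (z - cis (2 + x)) \<le> cmod (z - \<xi>) + cmod (\<xi> - cis (2 + x))"
        using norm_triangle_ineq[of "z - \<xi>" "\<xi> - cis (2 + x)"] by simp
      moreover have "cmod (\<xi> - cis (2 + x)) \<le> radius k" using cis_dist_le[of "2 + t" "2 + x"] x t by simp
      ultimately have "1 / 9 \<le> Re (bump k x z)" using z by (intro bump_parts(4)) auto
      also have "\<dots> \<le> (\<Sum>x\<in>level k. Re (bump k x z))"
        using x z by (intro member_le_sum level_finite less_imp_le bump_parts(1)) auto
      finally have "1 / 9 / real (Suc k) \<le> (\<Sum>x\<in>level k. Re (bump k x z)) / real (Suc k)"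
        by (intro divide_right_mono) auto
      then show ?thesis unfolding bumps_def Re_divide_of_nat by simp
    qed
    then have "(\<Sum>k<n. 1 / 9 * (1 / real (Suc k))) \<le> (\<Sum>k<n. Re (bumps k z))" by (intro sum_mono) auto
    also have "\<dots> \<le> Re (G z)" by (rule G_Re_ge[OF z(1)])
    finally have "1 / 9 * (\<Sum>k<n. 1 / real (Suc k)) \<le> Re (G z)" by (simp only: sum_distrib_left)
    then show ?thesis using n by linarith
  qed
  then show ?thesis using radius_pos[of n] by blast
qed

text \<open>The square root takes values in the sector \<open>\<bar>Im w\<bar> \<le> Re w\<close>. There \<open>\<bar>w\<bar>\<^sup>2 / Re w\<close> is
  comparable with \<open>Re w\<close>, whose means over circles are all equal to the value at \<open>0\<close>.\<close>

definition F1 :: "complex \<Rightarrow> complex" where "F1 z = csqrt (G z)"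

lemma F1_bounds:
  assumes z: "z \<in> cball 0 1 - cantor_arc"
  shows "1 / 3 \<le> Re (F1 z)" "Re (G z) \<le> (Re (F1 z))\<^sup>2" "(cmod (F1 z))\<^sup>2 \<le> 2 * (Re (F1 z))\<^sup>2"
proof -
  have g: "1 / 9 \<le> Re (G z)" by (rule G_Re_lower[OF z])
  have sq: "(F1 z)\<^sup>2 = G z" by (simp add: F1_def)
  have Re: "Re (G z) = (Re (F1 z))\<^sup>2 - (Im (F1 z))\<^sup>2" unfolding sq[symmetric] by (simp add: power2_eq_square)
  then show b: "Re (G z) \<le> (Re (F1 z))\<^sup>2" by simp
  have "0 \<le> Re (F1 z)" using csqrt_principal[of "G z"] by (auto simp: F1_def)
  moreover have "(1/3)\<^sup>2 \<le> (Re (F1 z))\<^sup>2" using g b by (simp add: power_divide)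
  ultimately show "1 / 3 \<le> Re (F1 z)" by (rule power2_le_imp_le[rotated])
  show "(cmod (F1 z))\<^sup>2 \<le> 2 * (Re (F1 z))\<^sup>2" unfolding cmod_power2 using Re g by simp
qed

lemma F1_continuous: "continuous_on (cball 0 1 - cantor_arc) F1"
proof -
  have "G z \<notin> \<real>\<^sub>\<le>\<^sub>0" if "z \<in> cball 0 1 - cantor_arc" for z
    using G_Re_lower[OF that] by (auto simp: complex_nonpos_Reals_iff)
  then show ?thesis unfolding F1_def by (intro continuous_on_compose2[OF continuous_on_csqrt G_continuous]) auto
qed

lemma ball_minus_cantor: "ball 0 1 \<subseteq> cball 0 1 - cantor_arc"
  using cantor_arc_subset by auto

lemma F1_holomorphic: "F1 holomorphic_on ball 0 1"
proof -
  have "G z \<notin> \<real>\<^sub>\<le>\<^sub>0" if "z \<in> ball 0 1" for z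
    using G_Re_lower[of z] that ball_minus_cantor by (auto simp: complex_nonpos_Reals_iff)
  then show ?thesis unfolding F1_def
    by (intro holomorphic_on_csqrt' G_holomorphic)
qed

section \<open>The symbol\<close>

definition contact :: "complex set" where "contact = insert 1 cantor_arc"

definition F :: "complex \<Rightarrow> complex" where "F z = F0 z + F1 z"

text \<open>The Cayley transform maps the right half plane to the disc and infinity to \<open>1\<close>.\<close>

definition symbol :: "complex \<Rightarrow> complex" where
  "symbol z = (if z \<in> contact then 1 else (F z - 1) / (F z + 1))"

lemma contact_subset: "contact \<subseteq> sphere 0 1"
  using cantor_arc_subset by (auto simp: contact_def)

lemma compact_contact: "compact contact"
  unfolding contact_def by (intro compact_insert compact_cantor_arc)

lemma Re_F:
  assumes "z \<in> cball 0 1 - contact"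
  shows "Re (F0 z) \<le> Re (F z)" "Re (F1 z) \<le> Re (F z)" "1 / 3 \<le> Re (F z)" "0 < Re (F0 z)" "1 / 3 \<le> Re (F1 z)"
  using assms F0_bounds(2)[of z] F1_bounds(1)[of z] by (auto simp: contact_def F_def)

lemma symbol_modulus:
  assumes "z \<in> cball 0 1 - contact"
  shows "1 - (cmod (symbol z))\<^sup>2 = 4 * Re (F z) / (cmod (F z + 1))\<^sup>2" "F z + 1 \<noteq> 0" "cmod (symbol z) < 1"
proof -
  have Re: "0 < Re (F z)" using Re_F(3)[OF assms] by linarith
  then show ne: "F z + 1 \<noteq> 0" by (metis Re_complex_of_real add_pos_pos less_irrefl of_real_1 plus_complex.sel(1) zero_complex.sel(1) zero_less_one)
  have "(cmod (F z + 1))\<^sup>2 - (cmod (F z - 1))\<^sup>2 = 4 * Re (F z)"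
    unfolding cmod_power2 by (simp add: power2_eq_square algebra_simps)
  moreover have "(cmod (symbol z))\<^sup>2 = (cmod (F z - 1))\<^sup>2 / (cmod (F z + 1))\<^sup>2"
    using assms by (simp add: symbol_def norm_divide power_divide)
  moreover have "1 - a / b = (b - a) / b" if "b \<noteq> 0" for a b :: real using that by (simp add: diff_divide_distrib)
  moreover have "(cmod (F z + 1))\<^sup>2 \<noteq> 0" using ne by simp
  ultimately have eq: "1 - (cmod (symbol z))\<^sup>2 = 4 * Re (F z) / (cmod (F z + 1))\<^sup>2" by metis
  then show "1 - (cmod (symbol z))\<^sup>2 = 4 * Re (F z) / (cmod (F z + 1))\<^sup>2" .
  have "0 < 4 * Re (F z) / (cmod (F z + 1))\<^sup>2" using Re ne by simp
  then have "(cmod (symbol z))\<^sup>2 < 1\<^sup>2" using eq by simp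
  then show "cmod (symbol z) < 1" by (rule power2_less_imp_less) simp
qed

lemma ball_minus_contact: "ball 0 1 \<subseteq> cball 0 1 - contact"
  using contact_subset by auto

lemma symbol_self_map: "symbol ` ball 0 1 \<subseteq> ball 0 1"
  using symbol_modulus(3) ball_minus_contact by (auto simp: image_subset_iff subset_iff)

lemma symbol_holomorphic: "symbol holomorphic_on ball 0 1"
proof -
  have "(\<lambda>z. (F z - 1) / (F z + 1)) holomorphic_on ball 0 1"
    unfolding F_def using symbol_modulus(2)[unfolded F_def] ball_minus_contact
    by (intro holomorphic_intros F0_holomorphic F1_holomorphic) (auto simp: subset_iff)
  then show ?thesis
    by (rule holomorphic_transform) (use ball_minus_contact in \<open>auto simp: symbol_def subset_iff\<close>)
qed

lemma contact_set_symbol: "contact_set symbol = contact"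
proof -
  have "1 \<le> cmod (symbol z) \<longleftrightarrow> z \<in> contact" if "z \<in> sphere 0 1" for z
    using symbol_modulus(3)[of z] that by (auto simp: symbol_def)
  then show ?thesis using contact_subset by (auto simp: contact_set_def)
qed

lemma F0_Re_large_near_1: "\<exists>\<delta>>0. \<forall>z\<in>cball 0 1 - {1}. cmod (z - 1) < \<delta> \<longrightarrow> M \<le> Re (F0 z)"
proof -
  have "filterlim (\<lambda>d. 1 / (4 * d * (4 - ln d) ^ 3) :: real) at_top (at_right 0)" by real_asymp
  then have "\<forall>\<^sub>F d in at_right 0. M \<le> 1 / (4 * d * logR d ^ 3)" by (simp add: filterlim_at_top logR_def)
  then obtain \<delta> where \<delta>: "0 < \<delta>" "\<And>d. 0 < d \<Longrightarrow> d < \<delta> \<Longrightarrow> M \<le> 1 / (4 * d * logR d ^ 3)"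
    by (auto simp: eventually_at_right_field)
  have "M \<le> Re (F0 z)" if "z \<in> cball 0 1 - {1}" "cmod (z - 1) < \<delta>" for z
    using \<delta>(2)[of "cmod (1 - z)"] F0_bounds(1)[of z] that by (auto simp: norm_minus_commute)
  then show ?thesis using \<delta>(1) by blast
qed

lemma symbol_continuous: "continuous_on (cball 0 1) symbol"
  unfolding continuous_on_eq_continuous_within
proof
  fix z0 :: complex assume z0: "z0 \<in> cball 0 1"
  show "continuous (at z0 within cball 0 1) symbol"
  proof (cases "z0 \<in> contact")
    case False
    have "continuous_on (cball 0 1 - contact) (\<lambda>z. (F z - 1) / (F z + 1))"
      unfolding F_def using symbol_modulus(2)[unfolded F_def]
      by (intro continuous_intros continuous_on_subset[OF F0_continuous] continuous_on_subset[OF F1_continuous]) (auto simp: contact_def)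
    then have "continuous_on (cball 0 1 - contact) symbol"
      by (rule continuous_on_eq) (auto simp: symbol_def)
    then have "continuous (at z0 within cball 0 1 - contact) symbol"
      using z0 False by (simp add: continuous_on_eq_continuous_within)
    moreover have "at z0 within cball 0 1 - contact = at z0 within cball 0 1"
      by (rule at_within_nhd[of _ "- contact"])
        (use False compact_imp_closed[OF compact_contact] in auto)
    ultimately show ?thesis by simp
  next
    case True
    have large: "\<exists>\<delta>>0. \<forall>z\<in>cball 0 1 - contact. cmod (z - z0) < \<delta> \<longrightarrow> M \<le> Re (F z)" for M
    proof (cases "z0 = 1")
      case True
      obtain \<delta> where "\<delta> > 0" "\<forall>z\<in>cball 0 1 - {1}. cmod (z - 1) < \<delta> \<longrightarrow> M \<le> Re (F0 z)"
        using F0_Re_large_near_1 by blast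
      then show ?thesis using True Re_F(1) by (intro exI[of _ \<delta>]) (force simp: contact_def)
    next
      case False
      then have "z0 \<in> cantor_arc" using True by (simp add: contact_def)
      then obtain \<delta> where \<delta>: "\<delta> > 0" "\<forall>z\<in>cball 0 1 - cantor_arc. cmod (z - z0) < \<delta> \<longrightarrow> M\<^sup>2 \<le> Re (G z)"
        using G_Re_large_near_cantor by blast
      have "M \<le> Re (F z)" if z: "z \<in> cball 0 1 - contact" "cmod (z - z0) < \<delta>" for z
      proof -
        have z': "z \<in> cball 0 1 - cantor_arc" using z by (auto simp: contact_def)
        have "M\<^sup>2 \<le> (Re (F1 z))\<^sup>2" using \<delta>(2) z z' F1_bounds(2)[OF z'] by force
        then have "M \<le> Re (F1 z)" by (rule power2_le_imp_le) (use F1_bounds(1)[OF z'] in simp)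
        then show ?thesis using Re_F(2)[OF z(1)] by linarith
      qed
      then show ?thesis using \<delta>(1) by blast
    qed
    show ?thesis
      unfolding continuous_within_eps_delta
    proof (intro allI impI)
      fix e :: real assume e: "0 < e"
      obtain \<delta> where \<delta>: "\<delta> > 0" "\<forall>z\<in>cball 0 1 - contact. cmod (z - z0) < \<delta> \<longrightarrow> 2 / e \<le> Re (F z)"
        using large by blast
      have "dist (symbol z) (symbol z0) < e" if z: "z \<in> cball 0 1" "dist z z0 < \<delta>" for z
      proof (cases "z \<in> contact")
        case True then show ?thesis using \<open>z0 \<in> contact\<close> e by (simp add: symbol_def)
      next
        case False
        then have zc: "z \<in> cball 0 1 - contact" using z by simp
        have "symbol z - 1 = - 2 / (F z + 1)"
          using False symbol_modulus(2)[OF zc] by (simp add: symbol_def field_simps)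
        then have "dist (symbol z) (symbol z0) = 2 / cmod (F z + 1)"
          using True by (simp add: symbol_def[of z0] dist_norm norm_divide)
        also have "\<dots> < e"
        proof -
          have "2 / e \<le> Re (F z)" using \<delta>(2) zc z by (simp add: dist_norm)
          also have "\<dots> < Re (F z + 1)" by simp
          also have "\<dots> \<le> cmod (F z + 1)" by (rule complex_Re_le_cmod)
          finally have "2 / e < cmod (F z + 1)" .
          moreover have "0 < 2 / e" using e by simp
          ultimately have "0 < cmod (F z + 1)" by linarith
          then show ?thesis using \<open>2 / e < cmod (F z + 1)\<close> e by (simp add: field_simps)
        qed
        finally show ?thesis .
      qed
      then show "\<exists>d>0. \<forall>z\<in>cball 0 1. dist z z0 < d \<longrightarrow> dist (symbol z) (symbol z0) < e"
        using \<delta>(1) by blast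
    qed
  qed
qed

lemma symbol_disc_algebra: "symbol \<in> disc_algebra"
  by (simp add: disc_algebra_def symbol_holomorphic symbol_continuous)

lemma hausdorff_dim_contact: "hausdorff_dim (contact_set symbol) = 1"
  unfolding contact_set_symbol
proof (rule hausdorff_dim_eq_1[OF contact_subset])
  fix \<alpha> :: real assume "0 < \<alpha>" "\<alpha> < 1"
  then have "0 < arc_content \<alpha> 1 cantor_arc" by (rule arc_content_cantor_arc)
  also have "\<dots> \<le> arc_content \<alpha> 1 contact" by (intro arc_content_mono) (auto simp: contact_def)
  finally show "0 < arc_content \<alpha> 1 contact" .
qed

section \<open>Counting estimate for the symbol\<close>

lemma dist_one_pos: "z \<in> ball 0 1 \<Longrightarrow> 0 < cmod (1 - z) \<and> cmod (1 - z) \<le> 2"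
  using dist_one_le[of z] by auto

text \<open>Use \<open>1 - \<bar>\<phi>\<bar>\<^sup>2 = 4 Re F / \<bar>F + 1\<bar>\<^sup>2\<close> and estimate the contributions of \<open>F0\<close> and
  \<open>F1 + 1\<close> to the numerator separately, each against its own real part: the first is
  \<open>1 / Re H0\<close> up to a factor, the second is bounded by a harmonic function.\<close>

lemma inverse_defect_le:
  assumes z: "z \<in> ball 0 1"
  shows "1 / (1 - (cmod (symbol z))\<^sup>2) \<le> 1 / (2 * (logR (cmod (1 - z)) * cmod (1 - z))) + (2 * Re (F1 z) + 3)"
proof -
  let ?d = "cmod (1 - z)"
  have zc: "z \<in> cball 0 1 - contact" using z ball_minus_contact by blast
  have z': "z \<in> cball 0 1" "z \<noteq> 1" "z \<in> cball 0 1 - cantor_arc" using zc by (auto simp: contact_def)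
  define a where "a = Re (F0 z)"
  define b where "b = Re (F1 z)"
  have a: "0 < a" and b: "1 / 3 \<le> b" using Re_F(4,5)[OF zc] by (simp_all add: a_def b_def)
  have ab: "Re (F z) = a + b" by (simp add: F_def a_def b_def)
  have sq: "(cmod (u + v))\<^sup>2 \<le> 2 * (cmod u)\<^sup>2 + 2 * (cmod v)\<^sup>2" for u v by (rule cmod_add_square_le)
  have "1 / (1 - (cmod (symbol z))\<^sup>2) = (cmod (F z + 1))\<^sup>2 / (4 * (a + b))"
    unfolding symbol_modulus(1)[OF zc] ab by simp
  also have "\<dots> \<le> (2 * (cmod (F0 z))\<^sup>2 + 2 * (4 * b\<^sup>2 + 2)) / (4 * (a + b))"
  proof (intro divide_right_mono)
    have "(cmod (F1 z + 1))\<^sup>2 \<le> 2 * (cmod (F1 z))\<^sup>2 + 2" using sq[of "F1 z" 1] by simp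
    also have "\<dots> \<le> 4 * b\<^sup>2 + 2" using F1_bounds(3)[OF z'(3)] by (simp add: b_def)
    finally show "(cmod (F z + 1))\<^sup>2 \<le> 2 * (cmod (F0 z))\<^sup>2 + 2 * (4 * b\<^sup>2 + 2)"
      using sq[of "F0 z" "F1 z + 1"] by (simp add: F_def add.assoc)
  qed (use a b in simp)
  also have "\<dots> = 2 * (cmod (F0 z))\<^sup>2 / (4 * (a + b)) + 2 * (4 * b\<^sup>2 + 2) / (4 * (a + b))"
    by (rule add_divide_distrib)
  also have "\<dots> \<le> 2 * (cmod (F0 z))\<^sup>2 / (4 * a) + 2 * (4 * b\<^sup>2 + 2) / (4 * b)"
    using a b by (intro add_mono divide_left_mono) auto
  also have "2 * (4 * b\<^sup>2 + 2) / (4 * b) = 2 * b + 1 / b" using b by (simp add: power2_eq_square field_simps)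
  also have "1 / b \<le> 3" using b by (simp add: field_simps)
  also have "2 * (cmod (F0 z))\<^sup>2 / (4 * a) = (cmod (F0 z))\<^sup>2 / a / 2" by simp
  also have "(cmod (F0 z))\<^sup>2 / a \<le> 1 / (logR ?d * ?d)" unfolding a_def by (rule F0_bounds(3)[OF z'(1,2)])
  finally show ?thesis by (simp add: b_def)
qed

lemma sin_ge_third:
  assumes "0 \<le> x" "x \<le> pi / 2"
  shows "x / 3 \<le> sin x"
proof -
  have "\<bar>sin x - (\<Sum>m<3. sin_coeff m * x ^ m)\<bar> \<le> inverse (fact 3) * \<bar>x\<bar> ^ 3" by (rule Maclaurin_sin_bound)
  moreover have "(\<Sum>m<3. sin_coeff m * x ^ m) = x" by (simp add: eval_nat_numeral sin_coeff_def)
  moreover have "x ^ 3 \<le> 4 * x"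
  proof -
    have "x \<le> 2" using assms pi_less_4 by linarith
    then have "x * x \<le> 2 * 2" using assms by (intro mult_mono) auto
    then have "x * x * x \<le> 4 * x" using assms by (intro mult_right_mono) auto
    then show ?thesis by (simp add: power3_eq_cube)
  qed
  moreover have "\<bar>x\<bar> = x" using assms by simp
  moreover have "inverse (fact 3) = (1 / 6 :: real)" by (simp add: fact_numeral)
  ultimately have "\<bar>sin x - x\<bar> \<le> 1 / 6 * (4 * x)" by simp
  then show ?thesis unfolding abs_le_iff by linarith
qed

lemma dist_cis_one:
  assumes "0 \<le> t" "t \<le> 2 * pi"
  shows "min t (2 * pi - t) / 3 \<le> cmod (cis t - 1)"
proof -
  have eq: "cmod (cis t - 1) = 2 * \<bar>sin (t / 2)\<bar>"
    using dist_exp_i_1[of t] by (simp add: cis_conv_exp)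
  show ?thesis
  proof (cases "t \<le> pi")
    case True
    then show ?thesis using sin_ge_third[of "t / 2"] assms unfolding eq by auto
  next
    case False
    have "sin (t / 2) = sin ((2 * pi - t) / 2)" using sin_pi_minus[of "t / 2"] by (simp add: diff_divide_distrib)
    then show ?thesis using sin_ge_third[of "(2 * pi - t) / 2"] assms False unfolding eq by auto
  qed
qed

lemma times_logR_mono:
  assumes "0 < x" "x \<le> y" "y \<le> 2"
  shows "x * logR x \<le> y * logR y"
proof -
  have y: "0 < y" using assms by simp
  have "ln (y / x) \<le> y / x - 1" using assms y by (intro ln_le_minus_one) auto
  then have "x * (ln y - ln x) \<le> x * (y / x - 1)" using assms y by (intro mult_left_mono) (auto simp: ln_div)
  also have "\<dots> = y - x" using assms by (simp add: field_simps)
  also have "\<dots> \<le> (y - x) * logR y" using logR_ge[of y] assms y by (simp add: mult_le_cancel_left1)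
  finally show ?thesis by (simp add: logR_def algebra_simps)
qed

text \<open>A continuous cutoff: \<open>1 \<le> 4 \<tau> P + off_window\<close> on the circle of radius \<open>r\<close>, where \<open>P\<close> is
  the Poisson kernel for the point \<open>r (1 - \<tau>)\<close>, and \<open>off_window\<close> vanishes on the arc of points
  at distance at most \<open>r \<tau>\<close> from \<open>r\<close>.\<close>

definition off_window :: "real \<Rightarrow> real \<Rightarrow> complex \<Rightarrow> real" where
  "off_window \<tau> r z = max 0 (1 - 4 * \<tau> * poisson r (of_real (r * (1 - \<tau>))) z)"

lemma poisson_window:
  assumes \<tau>: "0 < \<tau>" "\<tau> \<le> 1" and r: "0 < r" and z: "cmod z = r" "cmod (z - of_real r) \<le> r * \<tau>"
  shows "1 \<le> 4 * \<tau> * poisson r (of_real (r * (1 - \<tau>))) z"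
proof -
  let ?w = "of_real (r * (1 - \<tau>)) :: complex"
  have cw: "cmod ?w = r * (1 - \<tau>)" unfolding norm_of_real using r \<tau> by simp
  have ne: "z \<noteq> ?w"
  proof
    assume "z = ?w"
    then have "r = r * (1 - \<tau>)" using z(1) cw by simp
    then show False using r \<tau> by simp
  qed
  have "z - ?w = (z - of_real r) + of_real (r * \<tau>)" by (simp add: algebra_simps)
  then have "cmod (z - ?w) \<le> cmod (z - of_real r) + cmod (of_real (r * \<tau>))" by (metis norm_triangle_ineq)
  also have "cmod (of_real (r * \<tau>)) = r * \<tau>" unfolding norm_of_real using r \<tau> by simp
  finally have le: "cmod (z - ?w) \<le> 2 * r * \<tau>" using z(2) by simp
  have "(cmod (z - ?w))\<^sup>2 \<le> (2 * r * \<tau>)\<^sup>2" by (intro power_mono le) simp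
  also have "\<dots> = 4 * \<tau> * (r\<^sup>2 * \<tau>)" by (simp add: power2_eq_square)
  also have "\<dots> \<le> 4 * \<tau> * (r\<^sup>2 - (r * (1 - \<tau>))\<^sup>2)"
  proof (rule mult_left_mono)
    have "r\<^sup>2 - (r * (1 - \<tau>))\<^sup>2 - r\<^sup>2 * \<tau> = r\<^sup>2 * (\<tau> * (1 - \<tau>))" by (simp add: power2_eq_square algebra_simps)
    also have "\<dots> \<ge> 0" using \<tau> by simp
    finally show "r\<^sup>2 * \<tau> \<le> r\<^sup>2 - (r * (1 - \<tau>))\<^sup>2" by simp
  qed (use \<tau> in simp)
  finally show ?thesis unfolding poisson_def cw using ne by (simp add: field_simps)
qed

text \<open>Off the window the distance \<open>d\<close> from \<open>1\<close> to the point of the circle with angle \<open>u \<le> \<pi>\<close> is at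
  least \<open>(u + \<tau>) / 12\<close>, for every radius. The resulting upper bound for \<open>1 / (d logR d)\<close>
  has the primitive \<open>- 12 ln (logR ((u + \<tau>) / 12))\<close>.\<close>

definition majorant :: "real \<Rightarrow> real \<Rightarrow> real" where
  "majorant \<tau> u = 1 / (((u + \<tau>) / 12) * logR ((u + \<tau>) / 12))"

lemma majorant_arg:
  assumes "0 < \<tau>" "\<tau> \<le> 1" "0 \<le> u" "u \<le> 2 * pi"
  shows "0 < (u + \<tau>) / 12" "(u + \<tau>) / 12 \<le> 2" "3 \<le> logR ((u + \<tau>) / 12)"
proof -
  show a: "0 < (u + \<tau>) / 12" "(u + \<tau>) / 12 \<le> 2" using assms pi_less_4 by auto
  show "3 \<le> logR ((u + \<tau>) / 12)" by (rule logR_ge[OF a])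
qed

lemma off_window_le_majorant:
  assumes \<tau>: "0 < \<tau>" "\<tau> \<le> 1" and r: "0 < r" "r < 1" and t: "0 \<le> t" "t \<le> 2 * pi"
  defines "z \<equiv> of_real r * cis t"
  defines "d \<equiv> cmod (1 - z)"
  shows "off_window \<tau> r z / (logR d * d) \<le> majorant \<tau> t + majorant \<tau> (2 * pi - t)"
proof -
  have zr: "cmod z = r" using r by (simp add: z_def norm_mult)
  have zb: "z \<in> ball 0 1" using zr r by simp
  have d: "0 < d" "d \<le> 2" using dist_one_pos[OF zb] by (auto simp: d_def)
  have Rd: "0 < logR d * d" using logR_ge[OF d] d by simp
  have maj: "0 \<le> majorant \<tau> u" if "0 \<le> u" "u \<le> 2 * pi" for u
    unfolding majorant_def using majorant_arg[OF \<tau> that] by (intro divide_nonneg_nonneg mult_nonneg_nonneg) auto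
  have maj_t: "0 \<le> majorant \<tau> t" "0 \<le> majorant \<tau> (2 * pi - t)" using t by (auto intro!: maj)
  show ?thesis
  proof (cases "off_window \<tau> r z = 0")
    case True then show ?thesis using maj_t by simp
  next
    case False
    have cw: "cmod (of_real (r * (1 - \<tau>)) :: complex) < r" unfolding norm_of_real using r \<tau> by simp
    have "off_window \<tau> r z \<le> 1" using poisson_nonneg[OF cw, of z] \<tau> by (simp add: off_window_def)
    then have "off_window \<tau> r z / (logR d * d) \<le> 1 / (logR d * d)" using Rd by (intro divide_right_mono) auto
    also have "\<dots> \<le> majorant \<tau> t + majorant \<tau> (2 * pi - t)"
    proof -
      have "1 > 4 * \<tau> * poisson r (of_real (r * (1 - \<tau>))) z" using False by (auto simp: off_window_def max_def split: if_splits)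
      then have "r * \<tau> < cmod (z - of_real r)" using poisson_window[OF \<tau> r(1) zr] by linarith
      also have "z - of_real r = of_real r * (cis t - 1)" by (simp add: z_def algebra_simps)
      also have "cmod (of_real r * (cis t - 1)) = r * cmod (cis t - 1)" using r by (simp add: norm_mult)
      finally have far: "\<tau> < cmod (cis t - 1)" using r by simp
      have "cmod (cis t - 1) \<le> cmod (cis t - z) + cmod (z - 1)" using norm_triangle_ineq[of "cis t - z" "z - 1"] by simp
      also have "cis t - z = of_real (1 - r) * cis t" by (simp add: z_def algebra_simps)
      also have "cmod (of_real (1 - r) * cis t) = 1 - r" using r by (simp add: norm_mult del: of_real_diff)
      also have "1 - r \<le> d" using norm_triangle_ineq2[of 1 z] zr by (simp add: d_def)
      finally have c: "cmod (cis t - 1) \<le> 2 * d" by (simp add: d_def norm_minus_commute)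
      define m where "m = min t (2 * pi - t)"
      have m: "0 \<le> m" "m \<le> 2 * pi" "m = t \<or> m = 2 * pi - t" using t by (auto simp: m_def)
      \<comment> \<open>Here \<open>d \<ge> m/6\<close> by the chord estimate and \<open>d > \<tau>/2\<close> off the window.\<close>
      have "(m + \<tau>) / 12 \<le> d" using dist_cis_one[OF t] far c d(1) by (simp add: m_def[symmetric])
      then have "(m + \<tau>) / 12 * logR ((m + \<tau>) / 12) \<le> d * logR d"
        using majorant_arg[OF \<tau> m(1,2)] d by (intro times_logR_mono) auto
      then have "1 / (logR d * d) \<le> majorant \<tau> m"
        unfolding majorant_def mult.commute[of "logR d"]
        by (rule frac_le[rotated 3]) (use majorant_arg[OF \<tau> m(1,2)] in auto)
      then show ?thesis using m(3) maj_t by auto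
    qed
    finally show ?thesis .
  qed
qed

lemma majorant_integral:
  assumes \<tau>: "0 < \<tau>" "\<tau> \<le> 1"
  shows "((\<lambda>t. majorant \<tau> t + majorant \<tau> (2 * pi - t)) has_integral
      24 * (ln (logR (\<tau> / 12)) - ln (logR ((2 * pi + \<tau>) / 12)))) {0..2*pi}"
proof -
  let ?A = "\<lambda>u. - 12 * ln (logR ((u + \<tau>) / 12))"
  have der: "(?A has_real_derivative majorant \<tau> u) (at u)" if u: "0 \<le> u" "u \<le> 2 * pi" for u
    using majorant_arg[OF \<tau> u] unfolding majorant_def logR_def
    by (auto intro!: derivative_eq_intros simp: field_simps)
  have "((\<lambda>t. majorant \<tau> t + majorant \<tau> (2 * pi - t)) has_integral
      ((?A (2*pi) - ?A (2 * pi - 2 * pi)) - (?A 0 - ?A (2 * pi - 0)))) {0..2*pi}"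
  proof (rule fundamental_theorem_of_calculus)
    fix t assume t: "t \<in> {0..2*pi}"
    have "((\<lambda>t. ?A t - ?A (2 * pi - t)) has_real_derivative (majorant \<tau> t - majorant \<tau> (2 * pi - t) * (- 1))) (at t)"
      using t by (intro DERIV_diff der DERIV_chain2[where f = ?A] derivative_eq_intros) auto
    then show "((\<lambda>t. ?A t - ?A (2 * pi - t)) has_vector_derivative majorant \<tau> t + majorant \<tau> (2 * pi - t)) (at t within {0..2*pi})"
      by (simp add: has_real_derivative_iff_has_vector_derivative has_vector_derivative_at_within)
  qed simp
  then show ?thesis by (simp add: algebra_simps)
qed

lemma circle_in_ball: "0 \<le> r \<Longrightarrow> r < 1 \<Longrightarrow> sphere 0 r \<subseteq> ball (0::complex) 1"
  by auto

lemma logR_circle_continuous: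
  assumes "0 \<le> r" "r < 1"
  shows "continuous_on (sphere 0 r) (\<lambda>z. logR (cmod (1 - z)) * cmod (1 - z))"
  unfolding logR_def using assms by (intro continuous_intros) auto

lemma off_window_continuous:
  assumes "0 < \<tau>" "\<tau> \<le> 1" "0 < r"
  shows "continuous_on (sphere 0 r) (off_window \<tau> r)"
proof -
  have "cmod (of_real (r * (1 - \<tau>)) :: complex) < r" unfolding norm_of_real using assms by simp
  from poisson_continuous[OF this] show ?thesis unfolding off_window_def by (intro continuous_intros)
qed

text \<open>The primitive of the majorant is a double logarithm, and its value at the far end of the circle
  has a sign that allows to drop it.\<close>

lemma off_window_mean:
  assumes \<tau>: "0 < \<tau>" "\<tau> \<le> 1" and r: "0 < r" "r < 1"
  shows "rmean (\<lambda>z. off_window \<tau> r z * (1 / (2 * (logR (cmod (1 - z)) * cmod (1 - z))))) r \<le> 2 * ln (logR (\<tau> / 12))"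
proof -
  let ?f = "\<lambda>z. off_window \<tau> r z * (1 / (2 * (logR (cmod (1 - z)) * cmod (1 - z))))"
  have nz: "2 * (logR (cmod (1 - z)) * cmod (1 - z)) \<noteq> 0" if "z \<in> sphere 0 r" for z
    using dist_one_pos[of z] logR_ge[of "cmod (1 - z)"] that r by auto
  have cf: "continuous_on (sphere 0 r) ?f"
    using nz r by (intro continuous_intros off_window_continuous \<tau> logR_circle_continuous) auto
  note I = majorant_integral[OF \<tau>]
  have "integral {0..2*pi} (\<lambda>t. ?f (of_real r * cis t)) \<le> integral {0..2*pi} (\<lambda>t. 1 / 2 * (majorant \<tau> t + majorant \<tau> (2 * pi - t)))"
  proof (rule integral_le)
    show "(\<lambda>t. ?f (of_real r * cis t)) integrable_on {0..2*pi}" using r by (intro circle_integrable cf) auto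
    show "(\<lambda>t. 1 / 2 * (majorant \<tau> t + majorant \<tau> (2 * pi - t))) integrable_on {0..2*pi}"
      using has_integral_mult_right[OF I] by blast
    show "?f (of_real r * cis t) \<le> 1 / 2 * (majorant \<tau> t + majorant \<tau> (2 * pi - t))" if "t \<in> {0..2*pi}" for t
      using off_window_le_majorant[OF \<tau> r, of t] that by simp
  qed
  also have "\<dots> = 1 / 2 * (24 * (ln (logR (\<tau> / 12)) - ln (logR ((2 * pi + \<tau>) / 12))))"
    using integral_unique[OF has_integral_mult_right[OF I, of "1 / 2"]] .
  also have "\<dots> \<le> 12 * ln (logR (\<tau> / 12))"
    using majorant_arg(3)[OF \<tau>, of "2 * pi"] by simp
  finally have "rmean ?f r \<le> 12 * ln (logR (\<tau> / 12)) / (2 * pi)"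
    unfolding rmean_def by (intro divide_right_mono) auto
  also have "\<dots> \<le> 2 * ln (logR (\<tau> / 12))"
  proof -
    have "0 \<le> ln (logR (\<tau> / 12))" using majorant_arg(3)[OF \<tau>, of 0] by simp
    then have "12 * ln (logR (\<tau> / 12)) \<le> 2 * ln (logR (\<tau> / 12)) * (2 * pi)" 
      using mult_left_mono[of 3 pi "4 * ln (logR (\<tau> / 12))"] pi_gt3 by simp
    then show ?thesis by (subst pos_divide_le_eq) auto
  qed
  finally show ?thesis .
qed

lemma cantor_arc_Re_neg: "\<xi> \<in> cantor_arc \<Longrightarrow> Re \<xi> < 0"
proof -
  assume "\<xi> \<in> cantor_arc"
  then obtain x where x: "x \<in> {0..1}" "\<xi> = cis (2 + x)" using cantor_subset by (auto simp: cantor_arc_def)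
  have "0 < sin ((2 + x) - pi / 2)" using x pi_less_4 pi_gt3 by (intro sin_gt_zero) auto
  also have "sin ((2 + x) - pi / 2) = - cos (2 + x)" by (simp add: sin_diff)
  finally show ?thesis using x by simp
qed

lemma F1_bounded_right_half: "\<exists>C\<ge>1. \<forall>z\<in>cball 0 1. 0 \<le> Re z \<longrightarrow> cmod (F1 z) \<le> C"
proof -
  let ?S = "cball 0 1 \<inter> {z. 0 \<le> Re z}"
  have "?S \<subseteq> cball 0 1 - cantor_arc" using cantor_arc_Re_neg by force
  then have "continuous_on ?S F1" using F1_continuous continuous_on_subset by blast
  moreover have "compact ?S" by (intro compact_Int_closed closed_halfspace_Re_ge) auto
  ultimately have "bounded (F1 ` ?S)" by (intro compact_imp_bounded compact_continuous_image)
  then obtain C where "\<forall>z\<in>?S. cmod (F1 z) \<le> C" by (auto simp: bounded_iff)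
  then show ?thesis by (intro exI[of _ "max C 1"]) (auto simp: le_max_iff_disj)
qed

text \<open>On the radius ending at \<open>1\<close> the function \<open>F0 = 1 / H0\<close> is real and much larger than \<open>F1\<close>, so
  \<open>1 - \<bar>\<phi> x\<bar>\<close> is comparable with \<open>H0 x\<close>, which exceeds \<open>1 - x\<close> by a squared logarithm. This
  slow approach makes the composition operator compact.\<close>

lemma radial_defect:
  "\<exists>\<delta>>0. \<forall>x. 0 < x \<longrightarrow> x < 1 \<longrightarrow> 1 - x < \<delta> \<longrightarrow>
     (1 - x) * (logR (1 - x))\<^sup>2 / 2 \<le> 1 - cmod (symbol (of_real x))"
proof -
  obtain C where C: "1 \<le> C" "\<And>z. z \<in> cball 0 1 \<Longrightarrow> 0 \<le> Re z \<Longrightarrow> cmod (F1 z) \<le> C"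
    using F1_bounded_right_half by blast
  have "((\<lambda>s. s * (4 - ln s)\<^sup>2) \<longlongrightarrow> (0::real)) (at_right 0)" by real_asymp
  then have "\<forall>\<^sub>F s in at_right 0. s * (logR s)\<^sup>2 < 1 / (C + 1)"
    using C(1) unfolding logR_def by (intro order_tendstoD) auto
  then obtain \<delta> where \<delta>: "0 < \<delta>" "\<And>s. 0 < s \<Longrightarrow> s < \<delta> \<Longrightarrow> s * (logR s)\<^sup>2 < 1 / (C + 1)"
    by (auto simp: eventually_at_right_field)
  have "(1 - x) * (logR (1 - x))\<^sup>2 / 2 \<le> 1 - cmod (symbol (of_real x))"
    if x: "0 < x" "x < 1" "1 - x < \<delta>" for x
  proof -
    let ?z = "of_real x :: complex"
    define s where "s = 1 - x"
    have s: "0 < s" "s \<le> 2" using x by (auto simp: s_def)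
    define h where "h = s * (logR s)\<^sup>2"
    have zb: "?z \<in> ball 0 1" using x by simp
    then have zc: "?z \<in> cball 0 1 - contact" using ball_minus_contact by blast
    have hpos: "0 < h" using logR_ge[OF s] s by (simp add: h_def)
    have hC: "C + 1 \<le> 1 / h" using \<delta>(2)[of s] x hpos C(1) by (simp add: s_def h_def field_simps)
    have "1 - ?z = of_real s" by (simp add: s_def)
    then have "H0 ?z = of_real h"
      using s by (simp add: H0_def logfac_def h_def logR_def Ln_of_real)
    then have F0: "F0 ?z = of_real (1 / h)" by (simp add: F0_def)
    have b: "cmod (F1 ?z) \<le> C" using C(2)[of ?z] zb x by simp
    have "cmod (F ?z + 1) \<le> cmod (F0 ?z) + (cmod (F1 ?z) + 1)"
      using norm_triangle_ineq[of "F0 ?z" "F1 ?z + 1"] norm_triangle_ineq[of "F1 ?z" 1] by (simp add: F_def add.assoc)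
    also have "cmod (F0 ?z) = 1 / h" using hpos by (simp add: F0 norm_divide)
    finally have up: "cmod (F ?z + 1) \<le> 2 / h" using b hC by simp
    have low: "1 / h \<le> Re (F ?z)" using Re_F(1)[OF zc] by (simp add: F0)
    have "h = 4 * (1 / h) / (2 / h)\<^sup>2" using hpos by (simp add: power2_eq_square)
    also have "\<dots> \<le> 4 * Re (F ?z) / (cmod (F ?z + 1))\<^sup>2"
      using low up hpos symbol_modulus(2)[OF zc] Re_F(3)[OF zc] by (intro frac_le mult_left_mono power_mono) auto
    also have "\<dots> = 1 - (cmod (symbol ?z))\<^sup>2" by (rule symbol_modulus(1)[OF zc, symmetric])
    also have "\<dots> = (1 - cmod (symbol ?z)) * (1 + cmod (symbol ?z))" by (simp add: power2_eq_square algebra_simps)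
    also have "\<dots> \<le> (1 - cmod (symbol ?z)) * 2"
      using symbol_modulus(3)[OF zc] by (intro mult_left_mono) auto
    finally show ?thesis by (simp add: h_def s_def)
  qed
  then show ?thesis using \<delta>(1) by blast
qed

lemmas symbol_map = symbol_holomorphic symbol_self_map

lemma hardy2_symbol_continuous:
  assumes "f \<in> hardy2" "0 \<le> r" "r < 1"
  shows "continuous_on (sphere 0 r) (\<lambda>z. f (symbol z))"
proof -
  have "(\<lambda>z. f (symbol z)) holomorphic_on ball 0 1"
    by (rule holomorphic_on_compose_gen[OF symbol_holomorphic hardy2_holomorphic[OF assms(1)] symbol_self_map, unfolded o_def])
  then show ?thesis
    using circle_in_ball[OF assms(2,3)] holomorphic_on_imp_continuous_on holomorphic_on_subset by blast
qed

lemma rmean_Re_F1: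
  assumes "0 \<le> r" "r < 1"
  shows "rmean (\<lambda>z. Re (F1 z)) r = Re (F1 0)" "continuous_on (sphere 0 r) F1"
proof -
  show c: "continuous_on (sphere 0 r) F1"
    using F1_holomorphic circle_in_ball[OF assms] holomorphic_on_imp_continuous_on holomorphic_on_subset by blast
  show "rmean (\<lambda>z. Re (F1 z)) r = Re (F1 0)"
    using Re_circle_mean[OF c assms(1)] circle_mean_holomorphic[OF F1_holomorphic assms] by simp
qed

text \<open>On each circle the sum over the family is split with the cutoff. The part with the Poisson
  kernel is controlled by subordination at the point \<open>x = r (1 - \<tau>)\<close>, where \<open>1 - \<bar>\<phi> x\<bar>\<close> is
  at least of order \<open>\<tau> log\<^sup>2 (1/\<tau>)\<close>; the part off the window is controlled by the reproducing
  kernel. The bounds do not depend on \<open>r\<close>, which then tends to \<open>1\<close>.\<close>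

lemma counting_inequality:
  "\<exists>\<delta> C. 0 < \<delta> \<and> (\<forall>\<tau> B. 0 < \<tau> \<longrightarrow> 2 * \<tau> < \<delta> \<longrightarrow> H.orthonormal B \<longrightarrow>
     (\<Sum>f\<in>B. H.nrm2 (composition_op symbol f)) \<le> real (card B) * (16 / (logR (2 * \<tau>))\<^sup>2) + 2 * ln (logR (\<tau> / 12)) + C)"
proof -
  obtain \<delta>0 where \<delta>0: "0 < \<delta>0" "\<And>x. 0 < x \<Longrightarrow> x < 1 \<Longrightarrow> 1 - x < \<delta>0 \<Longrightarrow>
     (1 - x) * (logR (1 - x))\<^sup>2 / 2 \<le> 1 - cmod (symbol (of_real x))" using radial_defect by blast
  define C where "C = 2 * Re (F1 0) + 3"
  have main: "(\<Sum>f\<in>B. H.nrm2 (composition_op symbol f)) \<le> real (card B) * (16 / (logR (2 * \<tau>))\<^sup>2) + 2 * ln (logR (\<tau> / 12)) + C"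
    if \<tau>: "0 < \<tau>" "2 * \<tau> < min \<delta>0 1" and B: "H.orthonormal B" for \<tau> B
  proof -
    have finB: "finite B" and BV: "\<And>f. f \<in> B \<Longrightarrow> f \<in> hardy2" and nB: "\<And>f. f \<in> B \<Longrightarrow> H.nrm2 f = 1"
      using B by (auto simp: H.orthonormal_def H.nrm2_def)
    have \<tau>1: "\<tau> \<le> 1" using \<tau> by simp
    have circle: "(\<Sum>f\<in>B. rmean (\<lambda>z. (cmod (f (symbol z)))\<^sup>2) r) \<le> real (card B) * (16 / (logR (2 * \<tau>))\<^sup>2) + 2 * ln (logR (\<tau> / 12)) + C"
      if r: "1 - \<tau> < r" "r < 1" for r
    proof -
      have r0: "0 < r" using r \<tau> by simp
      define x where "x = r * (1 - \<tau>)"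
      have x: "0 < x" "x < r" using r0 \<tau> by (auto simp: x_def)
      then have "x < 1" using r by simp
      define s where "s = 1 - x"
      have "1 - x = \<tau> + (1 - r) * (1 - \<tau>)" by (simp add: x_def algebra_simps)
      moreover have "(1 - r) * (1 - \<tau>) \<le> \<tau> * 1" using r \<tau> by (intro mult_mono) auto
      moreover have "0 \<le> (1 - r) * (1 - \<tau>)" using r \<tau> by simp
      ultimately have s: "\<tau> \<le> s" "s \<le> 2 * \<tau>" by (simp_all add: s_def)
      let ?P = "poisson r (of_real x)" and ?W = "off_window \<tau> r"
      let ?S = "\<lambda>z. \<Sum>f\<in>B. (cmod (f (symbol z)))\<^sup>2"
      have xr: "cmod (of_real x :: complex) < r" using x by simp
      have cP: "continuous_on (sphere 0 r) ?P" by (rule poisson_continuous[OF xr])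
      have cW: "continuous_on (sphere 0 r) ?W" by (rule off_window_continuous[OF \<tau>(1) \<tau>1 r0])
      have cf: "continuous_on (sphere 0 r) (\<lambda>z. f (symbol z))" if "f \<in> B" for f
        using hardy2_symbol_continuous[OF BV[OF that]] r0 r by simp
      have nz: "2 * (logR (cmod (1 - z)) * cmod (1 - z)) \<noteq> 0" if "z \<in> sphere 0 r" for z
        using dist_one_pos[of z] logR_ge[of "cmod (1 - z)"] that r by auto
      let ?M = "\<lambda>z. ?W z * (1 / (2 * (logR (cmod (1 - z)) * cmod (1 - z))))"
      have cM: "continuous_on (sphere 0 r) ?M"
        using nz r0 r by (intro continuous_intros cW logR_circle_continuous) auto
      have cF: "continuous_on (sphere 0 r) F1" using rmean_Re_F1(2) r r0 by simp
      have "(\<Sum>f\<in>B. rmean (\<lambda>z. (cmod (f (symbol z)))\<^sup>2) r) = rmean ?S r"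
        using finB r0 cf by (intro rmean_sum[symmetric]) (auto intro!: continuous_intros)
      also have "\<dots> \<le> rmean (\<lambda>z. (\<Sum>f\<in>B. 4 * \<tau> * (?P z * (cmod (f (symbol z)))\<^sup>2)) + (?M z + (2 * Re (F1 z) + 3))) r"
      proof (rule rmean_mono)
        show "continuous_on (sphere 0 r) ?S" using cf by (intro continuous_intros)
        show "continuous_on (sphere 0 r) (\<lambda>z. (\<Sum>f\<in>B. 4 * \<tau> * (?P z * (cmod (f (symbol z)))\<^sup>2)) + (?M z + (2 * Re (F1 z) + 3)))"
          using cf by (intro continuous_intros cP cM cF)
        fix z :: complex assume z: "z \<in> sphere 0 r"
        have zb: "z \<in> ball 0 1" using z r by simp
        have S0: "0 \<le> ?S z" by (intro sum_nonneg) auto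
        have sb: "cmod (symbol z) < 1" using symbol_self_map zb by (auto simp: image_subset_iff)
        have SD: "?S z \<le> 1 / (1 - (cmod (symbol z))\<^sup>2)" by (rule orthonormal_pointwise_bound[OF B sb])
        have W0: "0 \<le> ?W z" "?W z \<le> 1"
          using poisson_nonneg[OF xr, of z] \<tau> by (auto simp: off_window_def x_def)
        have "1 \<le> 4 * \<tau> * ?P z + ?W z" by (simp add: off_window_def x_def)
        then have "1 * ?S z \<le> (4 * \<tau> * ?P z + ?W z) * ?S z" using S0 by (rule mult_right_mono)
        then have "?S z \<le> 4 * \<tau> * ?P z * ?S z + ?W z * ?S z" by (simp add: distrib_right)
        also have "4 * \<tau> * ?P z * ?S z = (\<Sum>f\<in>B. 4 * \<tau> * (?P z * (cmod (f (symbol z)))\<^sup>2))"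
          by (simp add: sum_distrib_left mult.assoc)
        also have "?W z * ?S z \<le> ?W z * (1 / (2 * (logR (cmod (1 - z)) * cmod (1 - z))) + (2 * Re (F1 z) + 3))"
          using SD inverse_defect_le[OF zb] W0 by (intro mult_left_mono) auto
        also have "\<dots> \<le> ?M z + (2 * Re (F1 z) + 3)"
        proof -
          have "1 / 3 \<le> Re (F1 z)" using Re_F(5)[of z] zb ball_minus_contact by blast
          then have "?W z * (2 * Re (F1 z) + 3) \<le> 1 * (2 * Re (F1 z) + 3)" using W0 by (intro mult_right_mono) auto
          then show ?thesis by (simp add: distrib_left)
        qed
        finally show "?S z \<le> (\<Sum>f\<in>B. 4 * \<tau> * (?P z * (cmod (f (symbol z)))\<^sup>2)) + (?M z + (2 * Re (F1 z) + 3))" by simp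
      qed (use r0 in simp)
      also have "\<dots> = (\<Sum>f\<in>B. 4 * \<tau> * rmean (\<lambda>z. ?P z * (cmod (f (symbol z)))\<^sup>2) r) + (rmean ?M r + C)"
      proof -
        have "rmean (\<lambda>z. (\<Sum>f\<in>B. 4 * \<tau> * (?P z * (cmod (f (symbol z)))\<^sup>2)) + (?M z + (2 * Re (F1 z) + 3))) r
            = rmean (\<lambda>z. \<Sum>f\<in>B. 4 * \<tau> * (?P z * (cmod (f (symbol z)))\<^sup>2)) r + (rmean ?M r + rmean (\<lambda>z. 2 * Re (F1 z) + 3) r)"
        proof -
          have r': "0 \<le> r" using r0 by simp
          have c1: "continuous_on (sphere 0 r) (\<lambda>z. \<Sum>f\<in>B. 4 * \<tau> * (?P z * (cmod (f (symbol z)))\<^sup>2))"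
            using cf by (intro continuous_intros cP)
          have c3: "continuous_on (sphere 0 r) (\<lambda>z. 2 * Re (F1 z) + 3)" by (intro continuous_intros cF)
          show ?thesis
            by (simp only: rmean_add[OF c1 continuous_on_add[OF cM c3] r'] rmean_add[OF cM c3 r'])
        qed
        also have "rmean (\<lambda>z. \<Sum>f\<in>B. 4 * \<tau> * (?P z * (cmod (f (symbol z)))\<^sup>2)) r
            = (\<Sum>f\<in>B. 4 * \<tau> * rmean (\<lambda>z. ?P z * (cmod (f (symbol z)))\<^sup>2) r)"
          using cf r0 finB by (subst rmean_sum) (auto intro!: continuous_intros cP simp: rmean_cmult)
        also have "rmean (\<lambda>z. 2 * Re (F1 z) + 3) r = C"
          using r0 r rmean_Re_F1(1)[of r] cF by (subst rmean_add) (auto intro!: continuous_intros simp: rmean_cmult C_def)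
        finally show ?thesis .
      qed
      also have "(\<Sum>f\<in>B. 4 * \<tau> * rmean (\<lambda>z. ?P z * (cmod (f (symbol z)))\<^sup>2) r) \<le> (\<Sum>f\<in>B. 16 / (logR (2 * \<tau>))\<^sup>2)"
      proof (rule sum_mono)
        fix f assume f: "f \<in> B"
        define q where "q = cmod (symbol (of_real x))"
        have q: "0 \<le> q" "s * (logR s)\<^sup>2 / 2 \<le> 1 - q"
          using \<delta>0(2)[of x] x \<open>x < 1\<close> s \<tau> by (auto simp: q_def s_def)
        have L: "3 \<le> logR (2 * \<tau>)" "logR (2 * \<tau>) \<le> logR s"
          using \<tau> s logR_ge[of "2 * \<tau>"] by (auto simp: logR_def)
        have "\<tau> * (logR (2 * \<tau>))\<^sup>2 \<le> s * (logR s)\<^sup>2"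
          using s \<tau> L by (intro mult_mono power_mono) auto
        then have low: "\<tau> * (logR (2 * \<tau>))\<^sup>2 / 2 \<le> 1 - q" using q(2) by simp
        have Lp: "0 < \<tau> * (logR (2 * \<tau>))\<^sup>2 / 2" using \<tau> L by simp
        have "rmean (\<lambda>z. ?P z * (cmod (f (symbol z)))\<^sup>2) r \<le> (1 + q) / (1 - q) * H.nrm2 f"
          unfolding q_def by (rule poisson_mean_composition_le[OF BV[OF f] symbol_map r(2) xr])
        also have "\<dots> \<le> 2 / (\<tau> * (logR (2 * \<tau>))\<^sup>2 / 2)"
          using low Lp q(1) nB[OF f] by (simp only: mult_1_right) (intro frac_le; simp)
        finally have "4 * \<tau> * rmean (\<lambda>z. ?P z * (cmod (f (symbol z)))\<^sup>2) r \<le> 4 * \<tau> * (2 / (\<tau> * (logR (2 * \<tau>))\<^sup>2 / 2))"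
          using \<tau> by (intro mult_left_mono) auto
        also have "\<dots> = 16 / (logR (2 * \<tau>))\<^sup>2" using \<tau> L by simp
        finally show "4 * \<tau> * rmean (\<lambda>z. ?P z * (cmod (f (symbol z)))\<^sup>2) r \<le> 16 / (logR (2 * \<tau>))\<^sup>2" .
      qed
      also have "rmean ?M r \<le> 2 * ln (logR (\<tau> / 12))" by (rule off_window_mean[OF \<tau>(1) \<tau>1 r0 r(2)])
      finally show ?thesis by simp
    qed
    have lim: "((\<lambda>r. \<Sum>f\<in>B. rmean (\<lambda>z. (cmod (f (symbol z)))\<^sup>2) r) \<longlongrightarrow> (\<Sum>f\<in>B. H.nrm2 (composition_op symbol f))) (at_left 1)"
      by (intro tendsto_sum composition_op_mean_tendsto(1)[OF symbol_map] BV)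
    have "\<forall>\<^sub>F r in at_left 1. r \<in> {1 - \<tau><..<1}" using \<tau> by (intro eventually_at_left_real) simp
    then have "\<forall>\<^sub>F r in at_left 1. (\<Sum>f\<in>B. rmean (\<lambda>z. (cmod (f (symbol z)))\<^sup>2) r)
        \<le> real (card B) * (16 / (logR (2 * \<tau>))\<^sup>2) + 2 * ln (logR (\<tau> / 12)) + C"
      by (rule eventually_mono) (use circle in auto)
    then show ?thesis by (rule tendsto_upperbound[OF lim]) simp
  qed
  show ?thesis
    by (rule exI[of _ "min \<delta>0 1"], rule exI[of _ C]) (use main \<delta>0(1) in auto)
qed

text \<open>The choice \<open>logR (2 \<tau>) = \<surd>(32/\<epsilon>)\<close> makes the window term half of the left hand side. What
  remains is of order \<open>log (1/\<epsilon>) / \<epsilon>\<close>, smaller than any power of \<open>1/\<epsilon>\<close> with exponent above \<open>1\<close>.\<close>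

lemma counting_power_bound:
  assumes \<beta>: "1 < \<beta>"
  shows "\<exists>\<epsilon>0>0. \<forall>\<epsilon> B. 0 < \<epsilon> \<longrightarrow> \<epsilon> \<le> \<epsilon>0 \<longrightarrow> H.orthonormal B \<longrightarrow>
    (\<forall>f\<in>B. \<epsilon> \<le> H.nrm2 (composition_op symbol f)) \<longrightarrow> real (card B) \<le> 1 * \<epsilon> powr - \<beta>"
proof -
  obtain \<delta> C where \<delta>: "0 < \<delta>" and ineq: "\<And>\<tau> B. 0 < \<tau> \<Longrightarrow> 2 * \<tau> < \<delta> \<Longrightarrow> H.orthonormal B \<Longrightarrow>
     (\<Sum>f\<in>B. H.nrm2 (composition_op symbol f)) \<le> real (card B) * (16 / (logR (2 * \<tau>))\<^sup>2) + 2 * ln (logR (\<tau> / 12)) + C"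
    using counting_inequality by blast
  have "((\<lambda>\<epsilon>. exp (4 - sqrt (32 / \<epsilon>))) \<longlongrightarrow> (0::real)) (at_right 0)" by real_asymp
  then have "\<forall>\<^sub>F \<epsilon> in at_right 0. exp (4 - sqrt (32 / \<epsilon>)) < \<delta>" using \<delta> by (intro order_tendstoD)
  moreover have "\<forall>\<^sub>F \<epsilon> in at_right (0::real). 2 / \<epsilon> * (2 * ln (sqrt (32 / \<epsilon>) + ln 24) + C) \<le> \<epsilon> powr - \<beta>"
    using \<beta> by real_asymp
  ultimately have "\<forall>\<^sub>F \<epsilon> in at_right (0::real). exp (4 - sqrt (32 / \<epsilon>)) < \<delta> \<and> 2 / \<epsilon> * (2 * ln (sqrt (32 / \<epsilon>) + ln 24) + C) \<le> \<epsilon> powr - \<beta>"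
    by eventually_elim simp
  then obtain \<epsilon>1 where \<epsilon>1: "0 < \<epsilon>1" "\<And>\<epsilon>. 0 < \<epsilon> \<Longrightarrow> \<epsilon> < \<epsilon>1 \<Longrightarrow> exp (4 - sqrt (32 / \<epsilon>)) < \<delta> \<and>
      2 / \<epsilon> * (2 * ln (sqrt (32 / \<epsilon>) + ln 24) + C) \<le> \<epsilon> powr - \<beta>"
    by (auto simp: eventually_at_right_field)
  have "real (card B) \<le> 1 * \<epsilon> powr - \<beta>"
    if \<epsilon>: "0 < \<epsilon>" "\<epsilon> \<le> \<epsilon>1 / 2" and B: "H.orthonormal B" and big: "\<forall>f\<in>B. \<epsilon> \<le> H.nrm2 (composition_op symbol f)" for \<epsilon> B
  proof -
    define q where "q = sqrt (32 / \<epsilon>)"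
    define \<tau> where "\<tau> = exp (4 - q) / 2"
    have e: "exp (4 - q) < \<delta>" "2 / \<epsilon> * (2 * ln (q + ln 24) + C) \<le> \<epsilon> powr - \<beta>"
      using \<epsilon>1(2)[of \<epsilon>] \<epsilon> \<epsilon>1(1) by (auto simp: q_def)
    have \<tau>: "0 < \<tau>" "2 * \<tau> < \<delta>" using e by (auto simp: \<tau>_def)
    have L1: "logR (2 * \<tau>) = q" by (simp add: logR_def \<tau>_def)
    have L2: "logR (\<tau> / 12) = q + ln 24" by (simp add: logR_def \<tau>_def ln_div)
    have q2: "16 / q\<^sup>2 = \<epsilon> / 2" using \<epsilon> by (simp add: q_def)
    have "real (card B) * \<epsilon> \<le> (\<Sum>f\<in>B. H.nrm2 (composition_op symbol f))"
      using big by (intro sum_bounded_below) auto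
    also have "\<dots> \<le> real (card B) * (\<epsilon> / 2) + 2 * ln (q + ln 24) + C"
      using ineq[OF \<tau> B] unfolding L1 L2 q2 .
    finally have "real (card B) * (\<epsilon> / 2) \<le> 2 * ln (q + ln 24) + C" by simp
    then have "real (card B) \<le> 2 / \<epsilon> * (2 * ln (q + ln 24) + C)" using \<epsilon> by (simp add: field_simps)
    then show ?thesis using e(2) by simp
  qed
  then show ?thesis using \<epsilon>1(1) by (intro exI[of _ "\<epsilon>1 / 2"]) auto
qed

section \<open>The composition operator is not a Hilbert--Schmidt operator\<close>

text \<open>The images of the monomials have the squared moduli \<open>\<bar>\<phi>\<bar> ^ (2 * k)\<close>, a geometric series with
  sum \<open>1 / (1 - \<bar>\<phi>\<bar>\<^sup>2)\<close>. On a fixed circle inside the disc \<open>\<bar>\<phi>\<bar>\<^sup>2 \<le> c < 1\<close>, so the partial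
  sums converge uniformly.\<close>

lemma monomial_mean_bound:
  assumes tr: "\<And>N. (\<Sum>k<N. H.nrm2 (composition_op symbol (monomial k))) \<le> D" and r: "0 \<le> r" "r < 1"
  shows "rmean (\<lambda>z. 1 / (1 - (cmod (symbol z))\<^sup>2)) r \<le> D"
proof -
  have cs: "continuous_on (sphere 0 r) symbol"
    using symbol_continuous by (rule continuous_on_subset) (use r in auto)
  have sub: "symbol ` sphere 0 r \<subseteq> ball 0 1" using symbol_self_map circle_in_ball[OF r] by blast
  have "compact (symbol ` sphere 0 r)" by (intro compact_continuous_image cs) auto
  moreover have "symbol ` sphere 0 r \<noteq> {}" using on_circle[OF r(1), of 0] by blast
  ultimately obtain u where u: "u \<in> symbol ` sphere 0 r" "\<And>v. v \<in> symbol ` sphere 0 r \<Longrightarrow> cmod v \<le> cmod u"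
    using continuous_attains_sup[of "symbol ` sphere 0 r" cmod] continuous_on_norm_id by blast
  define c where "c = (cmod u)\<^sup>2"
  have c: "0 \<le> c" "c < 1" using u(1) sub by (auto simp: c_def abs_square_less_1)
  have sc: "(cmod (symbol z))\<^sup>2 \<le> c" if "z \<in> sphere 0 r" for z
    unfolding c_def using u(2)[of "symbol z"] that by (intro power_mono) auto
  let ?g = "\<lambda>z. 1 / (1 - (cmod (symbol z))\<^sup>2)"
  have cg: "continuous_on (sphere 0 r) ?g"
    using cs sc c by (intro continuous_intros) force+
  have le: "(1 - c ^ N) * rmean ?g r \<le> D" for N
  proof -
    have "(1 - c ^ N) * rmean ?g r = rmean (\<lambda>z. (1 - c ^ N) * ?g z) r" by (simp only: rmean_cmult)
    also have "\<dots> \<le> rmean (\<lambda>z. \<Sum>k<N. (cmod (monomial k (symbol z)))\<^sup>2) r"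
    proof (rule rmean_mono)
      show "continuous_on (sphere 0 r) (\<lambda>z. (1 - c ^ N) * ?g z)" by (intro continuous_intros cg)
      show "continuous_on (sphere 0 r) (\<lambda>z. \<Sum>k<N. (cmod (monomial k (symbol z)))\<^sup>2)"
        using r by (intro continuous_intros hardy2_symbol_continuous) auto
      fix z :: complex assume z: "z \<in> sphere 0 r"
      define v where "v = (cmod (symbol z))\<^sup>2"
      have v: "0 \<le> v" "v \<le> c" "v < 1" using sc[OF z] c by (auto simp: v_def)
      have "symbol z \<in> ball 0 1" using z sub by blast
      then have "(cmod (monomial k (symbol z)))\<^sup>2 = v ^ k" for k
        by (simp add: monomial_eq norm_power v_def power_mult[symmetric] mult.commute)
      then have "(\<Sum>k<N. (cmod (monomial k (symbol z)))\<^sup>2) = (1 - v ^ N) / (1 - v)"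
        using v sum_gp_strict[of v N] by simp
      also have "\<dots> \<ge> (1 - c ^ N) / (1 - v)"
        using v by (intro divide_right_mono diff_left_mono power_mono) auto
      finally show "(1 - c ^ N) * ?g z \<le> (\<Sum>k<N. (cmod (monomial k (symbol z)))\<^sup>2)" by (simp add: v_def)
    qed (rule r)
    also have "\<dots> = (\<Sum>k<N. rmean (\<lambda>z. (cmod (monomial k (symbol z)))\<^sup>2) r)"
      using r by (intro rmean_sum) (auto intro!: continuous_intros hardy2_symbol_continuous)
    also have "\<dots> \<le> (\<Sum>k<N. H.nrm2 (composition_op symbol (monomial k)))"
      using r by (intro sum_mono composition_op_mean_tendsto(2)[OF symbol_map]) auto
    finally show ?thesis using tr[of N] by linarith
  qed
  have "(\<lambda>N. (1 - c ^ N) * rmean ?g r) \<longlonglongrightarrow> (1 - 0) * rmean ?g r"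
    using c by (intro tendsto_intros LIMSEQ_power_zero) auto
  then have "(1 - 0) * rmean ?g r \<le> D" by (rule tendsto_upperbound) (use le in auto)
  then show ?thesis by simp
qed

text \<open>On the circle of radius \<open>1 - \<tau>\<^sup>2\<close> the points with angle \<open>t \<ge> \<tau>\<close> are so close to the unit
  circle that \<open>Re (1 - z)\<close> is of order \<open>t\<^sup>2\<close>, and \<open>Re H0\<close> is at most of order \<open>t logR t\<close>.
  Near \<open>1\<close> the function \<open>F1\<close> is bounded, hence negligible against \<open>F0\<close>.\<close>

lemma inverse_defect_ge:
  "\<exists>t0>0. t0 \<le> 1 \<and> (\<forall>\<tau> t. 0 < \<tau> \<longrightarrow> \<tau> \<le> t \<longrightarrow> t \<le> t0 \<longrightarrow>
     1 / (288 * (t * logR t)) \<le> 1 / (1 - (cmod (symbol (of_real (1 - \<tau>\<^sup>2) * cis t)))\<^sup>2))"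
proof -
  obtain C where C: "1 \<le> C" "\<And>z. z \<in> cball 0 1 \<Longrightarrow> 0 \<le> Re z \<Longrightarrow> cmod (F1 z) \<le> C"
    using F1_bounded_right_half by blast
  have "\<forall>\<^sub>F t in at_right (0::real). 16 * t * (4 - ln t)\<^sup>2 \<le> 1 / (2 * (C + 1)) \<and> 8 * t * (4 - ln t) \<le> 1 \<and> 256 * C * t * (4 - ln t) ^ 3 \<le> 1 \<and> t \<le> 1/4"
  proof -
    have "((\<lambda>t. 16 * t * (4 - ln t)\<^sup>2) \<longlongrightarrow> (0::real)) (at_right 0)" by real_asymp
    then have "\<forall>\<^sub>F t in at_right 0. 16 * t * (4 - ln t)\<^sup>2 < 1 / (2 * (C + 1))" using C by (intro order_tendstoD) auto
    moreover have "((\<lambda>t. 8 * t * (4 - ln t)) \<longlongrightarrow> (0::real)) (at_right 0)" by real_asymp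
    then have "\<forall>\<^sub>F t in at_right 0. 8 * t * (4 - ln t) < (1::real)" by (intro order_tendstoD) auto
    moreover have "((\<lambda>t. 256 * C * t * (4 - ln t) ^ 3) \<longlongrightarrow> (0::real)) (at_right 0)" by real_asymp
    then have "\<forall>\<^sub>F t in at_right 0. 256 * C * t * (4 - ln t) ^ 3 < (1::real)" by (intro order_tendstoD) auto
    moreover have "\<forall>\<^sub>F t in at_right (0::real). t \<in> {0<..<1/4}" by (rule eventually_at_right_real) simp
    ultimately show ?thesis by eventually_elim auto
  qed
  then obtain t1 where t1: "0 < t1" "\<And>t. 0 < t \<Longrightarrow> t < t1 \<Longrightarrow> 16 * t * (logR t)\<^sup>2 \<le> 1 / (2 * (C + 1)) \<and> 8 * t * logR t \<le> 1 \<and> 256 * C * t * (logR t) ^ 3 \<le> 1 \<and> t \<le> 1/4"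
    by (auto simp: eventually_at_right_field logR_def)
  have "1 / (288 * (t * logR t)) \<le> 1 / (1 - (cmod (symbol (of_real (1 - \<tau>\<^sup>2) * cis t)))\<^sup>2)"
    if \<tau>: "0 < \<tau>" "\<tau> \<le> t" and t: "t < t1" for \<tau> t
  proof -
    have t0: "0 < t" using \<tau> by simp
    define l where "l = logR t"
    have small: "16 * t * l\<^sup>2 \<le> 1 / (2 * (C + 1))" "8 * t * l \<le> 1" "256 * C * t * l ^ 3 \<le> 1" "t \<le> 1/4"
      using t1(2)[OF t0 t] by (auto simp: l_def)
    have l3: "4 \<le> l" using small(4) t0 by (simp add: l_def logR_def)
    define r where "r = 1 - \<tau>\<^sup>2"
    have "\<tau> * \<tau> \<le> t * t" by (rule mult_mono) (use \<tau> in auto)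
    moreover have "\<tau> * \<tau> \<le> 1/4 * t" by (rule mult_mono) (use \<tau> small(4) in auto)
    ultimately have \<tau>2: "\<tau>\<^sup>2 \<le> t\<^sup>2" "\<tau>\<^sup>2 \<le> t / 4" "\<tau>\<^sup>2 \<le> 1/2" "0 < \<tau>\<^sup>2" using \<tau> small(4) by (auto simp: power2_eq_square)
    have r: "1/2 \<le> r" "r < 1" using \<tau>2 by (auto simp: r_def)
    define z where "z = of_real r * cis t"
    have zr: "cmod z = r" using r by (simp add: z_def norm_mult)
    have zb: "z \<in> ball 0 1" using zr r by simp
    then have zc: "z \<in> cball 0 1 - contact" using ball_minus_contact by blast
    then have z1: "z \<in> cball 0 1" "z \<noteq> 1" by (auto simp: contact_def)
    define d where "d = cmod (1 - z)"
    have ct: "cmod (cis t - 1) \<le> t" using cis_dist_le[of t 0] t0 by simp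
    have e1: "cis t - z = of_real (1 - r) * cis t" by (simp add: z_def algebra_simps)
    have e2: "cmod (cis t - z) = 1 - r" unfolding e1 using r by (simp add: norm_mult del: of_real_diff)
    have d_up: "d \<le> 2 * t"
    proof -
      have "d \<le> cmod (1 - cis t) + cmod (cis t - z)" using norm_triangle_ineq[of "1 - cis t" "cis t - z"] by (simp add: d_def)
      also have "\<dots> \<le> t + \<tau>\<^sup>2" using ct e2 by (simp add: norm_minus_commute r_def)
      finally show ?thesis using \<tau>2 t0 by simp
    qed
    have d_low: "t / 6 \<le> d"
    proof -
      have "t \<le> pi" using small(4) pi_gt3 by simp
      then have "t / 3 \<le> cmod (cis t - 1)" using dist_cis_one[of t] t0 by (simp add: min_def)
      also have "\<dots> \<le> cmod (cis t - z) + cmod (z - 1)" using norm_triangle_ineq[of "cis t - z" "z - 1"] by simp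
      also have "\<dots> \<le> d + d" using norm_triangle_ineq2[of 1 z] zr unfolding e2 by (simp add: d_def norm_minus_commute)
      finally show ?thesis by simp
    qed
    define R where "R = logR d"
    have d0: "0 < d" "d \<le> 2" using d_low t0 d_up small(4) by auto
    have R3: "3 \<le> R" unfolding R_def by (rule logR_ge[OF d0])
    have R_up: "R \<le> 2 * l"
    proof -
      have "ln t - ln 6 \<le> ln d" using d_low t0 d0 ln_mono[of "t / 6" d] by (simp add: ln_div)
      moreover have "ln (6::real) \<le> 4"
      proof -
        have "ln (6::real) = ln 2 + ln 3" using ln_mult[of 2 "3::real"] by simp
        then show ?thesis using ln_le_minus_one[of "2::real"] ln_le_minus_one[of "3::real"] by simp
      qed
      moreover have "4 \<le> l" by (rule l3)
      ultimately show ?thesis by (simp add: R_def l_def logR_def)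
    qed
    have x: "Re (1 - z) \<le> 2 * t\<^sup>2"
    proof -
      have "1 - cos t \<le> t\<^sup>2"
      proof -
        have "1 - cos t = 2 * (sin (t / 2))\<^sup>2" using cos_double_sin[of "t / 2"] by simp
        also have "\<dots> \<le> 2 * (t / 2)\<^sup>2" using abs_sin_x_le_abs_x[of "t / 2"] unfolding abs_le_square_iff by simp
        also have "\<dots> \<le> t\<^sup>2" by (simp add: power_divide)
        finally show ?thesis .
      qed
      moreover have "r * (1 - cos t) \<le> 1 - cos t" using r by (intro mult_left_le_one_le) auto
      ultimately have "r * (1 - cos t) \<le> t\<^sup>2" by (rule order_trans[rotated])
      moreover have "Re (1 - z) = \<tau>\<^sup>2 + r * (1 - cos t)" by (simp add: z_def r_def algebra_simps)
      ultimately show ?thesis using add_mono[OF \<tau>2(1), of "r * (1 - cos t)" "t\<^sup>2"] by simp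
    qed
    note hb = H0_bounds[OF z1, folded d_def R_def]
    have R2: "R\<^sup>2 \<le> (2 * l)\<^sup>2" using R_up R3 by (intro power_mono) auto
    have h1: "cmod (H0 z) \<le> 16 * t * l\<^sup>2"
    proof -
      have "2 * d * R\<^sup>2 \<le> 2 * (2 * t) * (2 * l)\<^sup>2" using R2 d_up d0 t0 by (intro mult_mono) auto
      then show ?thesis using hb(2) by (simp add: power_mult_distrib)
    qed
    have h2: "Re (H0 z) \<le> 17 * (t * l)"
    proof -
      have "Re (1 - z) * R\<^sup>2 \<le> 2 * t\<^sup>2 * (2 * l)\<^sup>2"
        using x R2 Re_one_minus[OF z1] by (intro mult_mono) auto
      also have "\<dots> = t * l * (8 * t * l)" by (simp add: power2_eq_square)
      also have "\<dots> \<le> t * l * 1" using small(2) t0 l3 by (intro mult_left_mono) auto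
      finally have a: "Re (1 - z) * R\<^sup>2 \<le> t * l" by simp
      have "pi * R * d \<le> 4 * (2 * l) * (2 * t)"
        using R_up R3 d_up d0 l3 pi_less_4 by (intro mult_mono) auto
      also have "\<dots> = 16 * (t * l)" by simp
      finally show ?thesis using hb(3) a by linarith
    qed
    have h3: "C * (cmod (H0 z))\<^sup>2 \<le> t * l"
    proof -
      have "(cmod (H0 z))\<^sup>2 \<le> (16 * t * l\<^sup>2)\<^sup>2" using h1 by (intro power_mono) auto
      then have "C * (cmod (H0 z))\<^sup>2 \<le> C * (16 * t * l\<^sup>2)\<^sup>2" using C by (intro mult_left_mono) auto
      also have "\<dots> = t * l * (256 * C * t * l ^ 3)" by (simp add: power2_eq_square power3_eq_cube)
      also have "\<dots> \<le> t * l * 1" using small(3) t0 l3 by (intro mult_left_mono) auto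
      finally show ?thesis by simp
    qed
    define A where "A = cmod (F0 z)"
    have Hne: "0 < cmod (H0 z)" using F0_bounds(4)[OF z1] by simp
    have A: "A = 1 / cmod (H0 z)" by (simp add: A_def F0_def norm_divide)
    have Apos: "0 < A" using Hne A by simp
    have "2 * (C + 1) \<le> A"
    proof -
      have "cmod (H0 z) \<le> 1 / (2 * (C + 1))" using h1 small(1) by linarith
      then have "1 / (1 / (2 * (C + 1))) \<le> 1 / cmod (H0 z)" using Hne C by (intro divide_left_mono) auto
      then show ?thesis using A by simp
    qed
    have F1C: "cmod (F1 z) \<le> C"
    proof (rule C(2)[OF z1(1)])
      have "t \<le> pi / 2" using small(4) pi_gt3 by simp
      then have "0 \<le> cos t" using t0 by (intro cos_ge_zero) auto
      then show "0 \<le> Re z" using r by (simp add: z_def)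
    qed
    \<comment> \<open>Since \<open>A \<ge> 2 (C + 1)\<close>, the term \<open>F1 + 1\<close> has at most half the modulus of \<open>F0\<close>.\<close>
    have low: "A / 2 \<le> cmod (F z + 1)"
    proof -
      have "F0 z = (F z + 1) - (F1 z + 1)" by (simp add: F_def)
      then have "A \<le> cmod (F z + 1) + cmod (F1 z + 1)" unfolding A_def by (metis norm_triangle_ineq4)
      moreover have "cmod (F1 z + 1) \<le> C + 1" using norm_triangle_ineq[of "F1 z" 1] F1C by simp
      ultimately show ?thesis using \<open>2 * (C + 1) \<le> A\<close> by simp
    qed
    have up: "Re (F z) \<le> A\<^sup>2 * (Re (H0 z) + C * (cmod (H0 z))\<^sup>2)"
    proof -
      have "Re (F z) \<le> Re (F0 z) + C" using complex_Re_le_cmod[of "F1 z"] F1C by (simp add: F_def)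
      also have "Re (F0 z) = A\<^sup>2 * Re (H0 z)" using F0_bounds(5)[OF z1] by (simp add: A_def)
      also have "C = A\<^sup>2 * (C * (cmod (H0 z))\<^sup>2)" using Hne by (simp add: A power_divide)
      finally show ?thesis by (simp add: distrib_left)
    qed
    have tl: "0 < t * l" using t0 l3 by simp
    have "1 / (288 * (t * l)) \<le> (A / 2)\<^sup>2 / (4 * (A\<^sup>2 * (18 * (t * l))))"
    proof -
      have "(A / 2)\<^sup>2 / (4 * (A\<^sup>2 * (18 * (t * l)))) = (A\<^sup>2 * 1) / (A\<^sup>2 * (288 * (t * l)))" by (simp add: power_divide)
      also have "\<dots> = 1 / (288 * (t * l))" using Apos by (subst mult_divide_mult_cancel_left) auto
      finally show ?thesis by simp
    qed
    also have "\<dots> \<le> (cmod (F z + 1))\<^sup>2 / (4 * Re (F z))"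
    proof (rule frac_le)
      show "(A / 2)\<^sup>2 \<le> (cmod (F z + 1))\<^sup>2" using low Apos by (intro power_mono) auto
      show "0 < 4 * Re (F z)" using Re_F(3)[OF zc] by simp
      have "A\<^sup>2 * (Re (H0 z) + C * (cmod (H0 z))\<^sup>2) \<le> A\<^sup>2 * (18 * (t * l))"
        using h2 h3 by (intro mult_left_mono) auto
      from order_trans[OF up this] show "4 * Re (F z) \<le> 4 * (A\<^sup>2 * (18 * (t * l)))"
        by (rule mult_left_mono) simp
    qed simp
    also have "\<dots> = 1 / (1 - (cmod (symbol z))\<^sup>2)" unfolding symbol_modulus(1)[OF zc] by simp
    finally show ?thesis by (simp add: z_def r_def l_def)
  qed
  then show ?thesis using t1(1) by (intro exI[of _ "min (t1 / 2) 1"]) auto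
qed

text \<open>A primitive of \<open>1 / (t logR t)\<close> is \<open>- ln (logR t)\<close>, which is unbounded at \<open>0\<close>.\<close>

lemma trace_infinite: "\<exists>N. D < (\<Sum>k<N. H.nrm2 (composition_op symbol (monomial k)))"
proof (rule ccontr)
  assume "\<nexists>N. D < (\<Sum>k<N. H.nrm2 (composition_op symbol (monomial k)))"
  then have tr: "(\<Sum>k<N. H.nrm2 (composition_op symbol (monomial k))) \<le> D" for N by (simp add: not_less)
  obtain t0 where t0: "0 < t0" "t0 \<le> 1" and low: "\<And>\<tau> t. 0 < \<tau> \<Longrightarrow> \<tau> \<le> t \<Longrightarrow> t \<le> t0 \<Longrightarrow>
     1 / (288 * (t * logR t)) \<le> 1 / (1 - (cmod (symbol (of_real (1 - \<tau>\<^sup>2) * cis t)))\<^sup>2)"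
    using inverse_defect_ge by blast
  have bound: "ln (logR \<tau>) \<le> ln (logR t0) + 288 * (2 * pi * D)" if \<tau>: "0 < \<tau>" "\<tau> < t0" for \<tau>
  proof -
    define r where "r = 1 - \<tau>\<^sup>2"
    have "\<tau>\<^sup>2 < 1" using \<tau> t0 by (simp add: power_less_one_iff)
    then have r: "0 \<le> r" "r < 1" using \<tau> by (auto simp: r_def)
    let ?g = "\<lambda>z. 1 / (1 - (cmod (symbol z))\<^sup>2)"
    let ?gt = "\<lambda>t. ?g (of_real r * cis t)"
    have sb: "(cmod (symbol z))\<^sup>2 < 1" if "z \<in> sphere 0 r" for z
      using symbol_modulus(3)[of z] that r ball_minus_contact by (auto simp: abs_square_less_1 subset_iff)
    have "continuous_on (sphere 0 r) symbol"
      using symbol_continuous by (rule continuous_on_subset) (use r in auto)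
    then have cg: "continuous_on (sphere 0 r) ?g" using sb by (intro continuous_intros) force+
    have ig: "?gt integrable_on {0..2*pi}" by (rule circle_integrable[OF cg r(1)])
    have "((\<lambda>t. 1 / (t * logR t)) has_integral (- ln (logR t0) - (- ln (logR \<tau>)))) {\<tau>..t0}"
    proof (rule fundamental_theorem_of_calculus)
      fix t assume t: "t \<in> {\<tau>..t0}"
      then have "0 < t" "3 \<le> 4 - ln t" using \<tau> t0 logR_ge[of t] by (auto simp: logR_def)
      then have "((\<lambda>t. - ln (logR t)) has_real_derivative 1 / (t * logR t)) (at t)"
        unfolding logR_def by (auto intro!: derivative_eq_intros simp: field_simps)
      then show "((\<lambda>t. - ln (logR t)) has_vector_derivative 1 / (t * logR t)) (at t within {\<tau>..t0})"
        by (simp add: has_real_derivative_iff_has_vector_derivative has_vector_derivative_at_within)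
    qed (use \<tau> in simp)
    from has_integral_mult_right[OF this, of "1 / 288"]
    have I: "((\<lambda>t. 1 / (288 * (t * logR t))) has_integral 1 / 288 * (ln (logR \<tau>) - ln (logR t0))) {\<tau>..t0}"
      by simp
    have sub: "{\<tau>..t0} \<subseteq> {0..2*pi}" using \<tau> t0 pi_gt3 by auto
    have ig': "?gt integrable_on {\<tau>..t0}" by (rule integrable_on_subinterval[OF ig sub])
    have "1 / 288 * (ln (logR \<tau>) - ln (logR t0)) \<le> integral {\<tau>..t0} ?gt"
      using low[OF \<tau>(1)] unfolding integral_unique[OF I, symmetric] r_def[symmetric]
      by (intro integral_le ig' has_integral_integrable[OF I]) auto
    also have "\<dots> \<le> integral {0..2*pi} ?gt"
    proof (rule integral_subset_le[OF sub ig' ig])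
      show "\<forall>t\<in>{0..2*pi}. 0 \<le> ?gt t" using sb[OF on_circle[OF r(1)]] by (simp add: less_imp_le)
    qed
    also have "\<dots> = rmean ?g r * (2 * pi)" unfolding rmean_def by simp
    also have "\<dots> \<le> D * (2 * pi)" by (intro mult_right_mono monomial_mean_bound[OF tr r]) simp
    finally show ?thesis by (simp add: mult.commute)
  qed
  have "filterlim (\<lambda>\<tau>. ln (4 - ln \<tau>) :: real) at_top (at_right 0)" by real_asymp
  then have "\<forall>\<^sub>F \<tau> in at_right 0. ln (logR t0) + 288 * (2 * pi * D) < ln (logR \<tau>)"
    unfolding filterlim_at_top_dense logR_def by blast
  moreover have "\<forall>\<^sub>F \<tau> in at_right 0. \<tau> \<in> {0<..<t0}" using t0(1) by (rule eventually_at_right_real)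
  ultimately have "\<forall>\<^sub>F \<tau> in at_right (0::real). False"
    by eventually_elim (use bound in force)
  then show False by simp
qed

theorem corollary3p4:
  fixes p :: real
  assumes "p > 2"
  shows "\<exists>\<phi>. \<phi> ` ball 0 1 \<subseteq> ball 0 1 \<and> \<phi> \<in> disc_algebra \<and>
           composition_op \<phi> \<in> schatten p - schatten 2 \<and>
           hausdorff_dim (contact_set \<phi>) = 1"
proof -
  define C where "C = (1 + cmod (symbol 0)) / (1 - cmod (symbol 0))"
  have "cmod (symbol 0) < 1" using symbol_self_map by (auto simp: image_subset_iff)
  then have C: "0 \<le> C" by (simp add: C_def)
  note lin = composition_op_linear[OF symbol_map]
  have bdd: "H.nrm2 (composition_op symbol f) \<le> C * H.nrm2 f" if "f \<in> hardy2" for f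
    unfolding C_def by (rule composition_op_in(2)[OF symbol_map that])
  \<comment> \<open>Any exponent strictly between \<open>1\<close> and \<open>p/2\<close> will do.\<close>
  define \<beta> where "\<beta> = (p / 2 + 1) / 2"
  have \<beta>: "1 < \<beta>" "0 < \<beta>" "2 * \<beta> < p" using assms by (auto simp: \<beta>_def)
  obtain \<epsilon>0 where \<epsilon>0: "0 < \<epsilon>0" and count: "\<And>\<epsilon> B. \<lbrakk>0 < \<epsilon>; \<epsilon> \<le> \<epsilon>0; H.orthonormal B;
      \<forall>f\<in>B. \<epsilon> \<le> H.nrm2 (composition_op symbol f)\<rbrakk> \<Longrightarrow> real (card B) \<le> 1 * \<epsilon> powr - \<beta>"
    using counting_power_bound[OF \<beta>(1)] by blast
  have "composition_op symbol \<in> schatten p"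
    by (rule schatten_if_counting[OF lin bdd C \<epsilon>0 zero_less_one \<beta>(2,3) count])
  moreover have "composition_op symbol \<notin> schatten 2"
    by (rule not_schatten_2_if_trace_infinite[OF lin bdd C
          finite_counting_from_power_bound[OF \<epsilon>0 count] trace_infinite])
  ultimately show ?thesis
    using symbol_self_map symbol_disc_algebra hausdorff_dim_contact by blast
qed

end
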